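(* Let $\Omega$, $W$, $m$ satisfy the assumptions listed in the context and let $r_0:=(1-m)/2$. Let $E_0\subset\Omega$ be a volume-constrained local perimeter minimizer with $\mathcal{L}^n(E_0)=r_0$. Fix $\delta>0$, and suppose that the local isoperimetric function $\mathcal{I}_\Omega^{\delta,E_0}$ admits a Taylor expansion of order two at $r_0$. Assume that $u_{0,\varepsilon}\in X_1\cap L^\infty(\Omega)$ satisfy $$u_{0,\varepsilon}\to u_{E_0}\ \text{ in } L^1(\Omega)\ \text{ as }\varepsilon\to0^+$$ and $$\mathcal{G}_\varepsilon[u_{0,\varepsilon}]\le \mathcal{G}_0[u_{E_0}]+C\varepsilon$$ for some $C>0$. Let $u_\varepsilon$ be a solution of the nonlocal Allen--Cahn problem with initial datum $u_{0,\varepsilon}$. Then, for any $M>0$, $$\sup_{0\le t\le M\varepsilon^{-1}}\|u_\varepsilon(t)-u_{E_0}\|_{L^1}\to0\quad\text{as }\varepsilon\to0^+.$$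
   Context: Assumptions. $1<n\le 7$; $\Omega\subset\mathbb{R}^n$ is open, bounded, connected, $\mathcal{L}^n(\Omega)=1$, and $\partial\Omega$ is of class $C^{4,\sigma}$ for some $\sigma\in(0,1]$. The potential $W:\mathbb{R}\to[0,\infty)$ is of class $C^2$ and has precisely two zeros, at $-1$ and $1$; $W''(-1)=W''(1)>0$; $W'$ has exactly three zeros $-1<c<1$, and $W''(c)<0$; $\liminf_{|s|\to\infty}|W'(s)|=\infty$. The mass satisfies $m\in(-1,1)$. Notation. $\mathcal{L}^n$ is Lebesgue measure and $P(E;\Omega)$ is the relative perimeter of $E$ in $\Omega$, i.e. the total variation of $\chi_E$ in $\Omega$. $X_1:=\{u\in L^2(\Omega):\int_\Omega u\,dx=m\}$. A measurable set $E_0\subset\Omega$ is a volume-constrained local perimeter minimizer if there is $\rho>0$ with $P(E_0;\Omega)=\inf\{P(E;\Omega):E\subset\Omega\text{ Borel},\ \mathcal{L}^n(E_0)=\mathcal{L}^n(E),\ \mathcal{L}^n(E_0\Delta E)<\rho\}$. $u_{E_0}:=-\chi_{E_0}+\chi_{\Omega\setminus E_0}$. For Borel sets $E_1,E_2\subset\Omega$ let $\alpha(E_1,E_2):=\min\{\mathcal{L}^n(E_1\setminus E_2),\mathcal{L}^n(E_2\setminus E_1)\}$. The local isoperimetric function of parameter $\delta>0$ about $E_0$ is $\mathcal{I}_\Omega^{\delta,E_0}(r):=\inf\{P(E;\Omega):E\subset\Omega\text{ Borel},\ \mathcal{L}^n(E)=r,\ \alpha(E_0,E)\le\delta\}$.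 A function $\mathcal{I}$ admits a Taylor expansion of order two at $r_0$ if there are a neighborhood $U$ of $r_0$ and $\varsigma\in(0,1]$ such that $\mathcal{I}(r)=\mathcal{I}(r_0)+\frac{d\mathcal{I}}{dr}(r_0)(r-r_0)+O(|r-r_0|^{1+\varsigma})$ for all $r\in U$. Energies. For $u\in L^1(\Omega)$, $\mathcal{G}_\varepsilon[u]:=\int_\Omega\big(\frac1\varepsilon W(u)+\frac\varepsilon2|\nabla u|^2\big)dx$ if $u\in H^1(\Omega)$ and $\int_\Omega u\,dx=m$, and $\mathcal{G}_\varepsilon[u]:=\infty$ otherwise. $\mathcal{G}_0[u]:=2c_W\,P(\{u=-1\};\Omega)$ if $u\in BV(\Omega;\{-1,1\})$ and $\int_\Omega u\,dx=m$, and $\mathcal{G}_0[u]:=\infty$ otherwise, where $c_W:=\int_{-1}^1W^{1/2}(s)\,ds$. Nonlocal Allen--Cahn problem: $\partial_tu_\varepsilon=\varepsilon^2\Delta u_\varepsilon-W'(u_\varepsilon)+\varepsilon\lambda_\varepsilon$ in $\Omega\times[0,\infty)$, $\partial u_\varepsilon/\partial\nu=0$ on $\partial\Omega\times[0,\infty)$, $u_\varepsilon=u_{0,\varepsilon}$ on $\Omega\times\{0\}$, with the Lagrange multiplier $\lambda_\varepsilon=\frac{1}{\varepsilon\mathcal{L}^n(\Omega)}\int_\Omega W'(u_\varepsilon)\,dx$. *)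

theory Defs
  imports "HOL-Analysis.Analysis"
begin

section \<open>Domains with \<open>C\<^sup>k\<^sup>,\<^sup>\<sigma>\<close> boundary\<close>

(* Functions on the whole space that are k times differentiable with sigma-Hoelder continuous
   derivatives of order k (the vector g x below is the gradient of f at x).  Hoelder continuity
   is global; this is harmless below, where the graph functions only matter near a point and can
   be cut off. *)
primrec holder_diff :: "real \<Rightarrow> nat \<Rightarrow> (real ^ 'n \<Rightarrow> real) \<Rightarrow> bool" where
  "holder_diff \<sigma> 0 f \<longleftrightarrow> (\<exists>L. \<forall>x y. \<bar>f x - f y\<bar> \<le> L * dist x y powr \<sigma>)"
| "holder_diff \<sigma> (Suc k) f \<longleftrightarrow>
     (\<exists>g. (\<forall>x. (f has_derivative (\<lambda>h. g x \<bullet> h)) (at x)) \<and>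
          (\<forall>i. holder_diff \<sigma> k (\<lambda>x. g x $ i)))"

(* Near each boundary point, after choosing a unit vector e as "vertical" direction, Omega is the
   strict supergraph of a function of the projection onto the orthogonal complement of e. *)
definition boundary_of_class :: "nat \<Rightarrow> real \<Rightarrow> (real ^ 'n) set \<Rightarrow> bool" where
  "boundary_of_class k \<sigma> \<Omega> \<longleftrightarrow>
     (\<forall>p\<in>frontier \<Omega>. \<exists>\<rho>>0. \<exists>e \<gamma>. norm e = 1 \<and> holder_diff \<sigma> k \<gamma> \<and>
        ball p \<rho> \<inter> \<Omega> = {x \<in> ball p \<rho>. x \<bullet> e > \<gamma> (x - (x \<bullet> e) *\<^sub>R e)})"


section \<open>Sobolev functions, total variation, perimeter\<close>

definition C1_compact_field :: "(real ^ 'n) set \<Rightarrow> (real ^ 'n \<Rightarrow> real ^ 'n) \<Rightarrow> bool" where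
  "C1_compact_field \<Omega> \<phi> \<longleftrightarrow>
     \<phi> differentiable_on UNIV \<and> continuous_on UNIV (\<lambda>x. jacobian \<phi> (at x)) \<and>
     (\<exists>K. compact K \<and> K \<subseteq> \<Omega> \<and> (\<forall>x. x \<notin> K \<longrightarrow> \<phi> x = 0))"

definition divergence :: "(real ^ 'n \<Rightarrow> real ^ 'n) \<Rightarrow> real ^ 'n \<Rightarrow> real" where
  "divergence \<phi> x = trace (jacobian \<phi> (at x))"

definition L2_fun :: "'a measure \<Rightarrow> ('a \<Rightarrow> 'b::euclidean_space) \<Rightarrow> bool" where
  "L2_fun M f \<longleftrightarrow> f \<in> borel_measurable M \<and> integrable M (\<lambda>x. (norm (f x))\<^sup>2)"

definition H1_with_gradient ::
    "(real ^ 'n) set \<Rightarrow> (real ^ 'n \<Rightarrow> real) \<Rightarrow> (real ^ 'n \<Rightarrow> real ^ 'n) \<Rightarrow> bool" where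
  "H1_with_gradient \<Omega> u g \<longleftrightarrow>
     L2_fun (lebesgue_on \<Omega>) u \<and> L2_fun (lebesgue_on \<Omega>) g \<and>
     (\<forall>\<phi>. C1_compact_field \<Omega> \<phi> \<longrightarrow>
        (\<integral>x. u x * divergence \<phi> x \<partial>lebesgue_on \<Omega>) = - (\<integral>x. g x \<bullet> \<phi> x \<partial>lebesgue_on \<Omega>))"

definition H1 :: "(real ^ 'n) set \<Rightarrow> (real ^ 'n \<Rightarrow> real) set" where
  "H1 \<Omega> = {u. \<exists>g. H1_with_gradient \<Omega> u g}"

(* The weak gradient is unique up to null sets of Omega; some representative is chosen. *)
definition weak_grad :: "(real ^ 'n) set \<Rightarrow> (real ^ 'n \<Rightarrow> real) \<Rightarrow> real ^ 'n \<Rightarrow> real ^ 'n" where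
  "weak_grad \<Omega> u = (SOME g. H1_with_gradient \<Omega> u g)"

(* ennreal truncates negative integrals to 0; the supremum is unaffected since the zero field
   is admissible. *)
definition total_variation :: "(real ^ 'n) set \<Rightarrow> (real ^ 'n \<Rightarrow> real) \<Rightarrow> ennreal" where
  "total_variation \<Omega> u =
     (SUP \<phi>\<in>{\<phi>. C1_compact_field \<Omega> \<phi> \<and> (\<forall>x. norm (\<phi> x) \<le> 1)}.
        ennreal (\<integral>x. u x * divergence \<phi> x \<partial>lebesgue_on \<Omega>))"

definition perimeter :: "(real ^ 'n) set \<Rightarrow> (real ^ 'n) set \<Rightarrow> ennreal" where
  "perimeter E \<Omega> = total_variation \<Omega> (indicator E)"

definition BV_pm1 :: "(real ^ 'n) set \<Rightarrow> (real ^ 'n \<Rightarrow> real) set" where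
  "BV_pm1 \<Omega> = {u. integrable (lebesgue_on \<Omega>) u \<and> total_variation \<Omega> u < \<infinity> \<and>
                  (AE x in lebesgue_on \<Omega>. u x \<in> {-1, 1})}"


section \<open>Local perimeter minimizers and the local isoperimetric function\<close>

definition local_perimeter_minimizer :: "(real ^ 'n) set \<Rightarrow> (real ^ 'n) set \<Rightarrow> bool" where
  "local_perimeter_minimizer \<Omega> E0 \<longleftrightarrow>
     E0 \<in> sets lebesgue \<and> E0 \<subseteq> \<Omega> \<and>
     (\<exists>\<rho>>0. perimeter E0 \<Omega> =
        (INF E\<in>{E. E \<in> sets borel \<and> E \<subseteq> \<Omega> \<and> measure lebesgue E0 = measure lebesgue E \<and>
                   measure lebesgue ((E0 - E) \<union> (E - E0)) < \<rho>}. perimeter E \<Omega>))"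

definition set_alpha :: "(real ^ 'n) set \<Rightarrow> (real ^ 'n) set \<Rightarrow> real" where
  "set_alpha E1 E2 = min (measure lebesgue (E1 - E2)) (measure lebesgue (E2 - E1))"

definition local_isoperimetric ::
    "(real ^ 'n) set \<Rightarrow> real \<Rightarrow> (real ^ 'n) set \<Rightarrow> real \<Rightarrow> ennreal" where
  "local_isoperimetric \<Omega> \<delta> E0 r =
     (INF E\<in>{E. E \<in> sets borel \<and> E \<subseteq> \<Omega> \<and> measure lebesgue E = r \<and> set_alpha E0 E \<le> \<delta>}.
        perimeter E \<Omega>)"

(* The expansion is one of real numbers, so the function has to be finite near r0. *)
definition taylor_order_two :: "(real \<Rightarrow> ennreal) \<Rightarrow> real \<Rightarrow> bool" where
  "taylor_order_two J r0 \<longleftrightarrow>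
     (\<exists>U \<zeta> d K. open U \<and> r0 \<in> U \<and> 0 < \<zeta> \<and> \<zeta> \<le> 1 \<and>
        (\<forall>r\<in>U. J r < \<infinity>) \<and> ((\<lambda>r. enn2real (J r)) has_real_derivative d) (at r0) \<and>
        (\<forall>r\<in>U. \<bar>enn2real (J r) - (enn2real (J r0) + d * (r - r0))\<bar>
                 \<le> K * \<bar>r - r0\<bar> powr (1 + \<zeta>)))"


section \<open>The potential and the energies\<close>

definition double_well :: "(real \<Rightarrow> real) \<Rightarrow> bool" where
  "double_well W \<longleftrightarrow>
     (\<forall>s. 0 \<le> W s) \<and>
     W differentiable_on UNIV \<and> deriv W differentiable_on UNIV \<and>
     continuous_on UNIV (deriv (deriv W)) \<and>
     {s. W s = 0} = {-1, 1} \<and>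
     deriv (deriv W) (-1) = deriv (deriv W) 1 \<and> deriv (deriv W) 1 > 0 \<and>
     (\<exists>c. -1 < c \<and> c < 1 \<and> {s. deriv W s = 0} = {-1, c, 1} \<and> deriv (deriv W) c < 0) \<and>
     Liminf at_infinity (\<lambda>s. ereal \<bar>deriv W s\<bar>) = \<infinity>"

definition energy ::
    "(real ^ 'n) set \<Rightarrow> (real \<Rightarrow> real) \<Rightarrow> real \<Rightarrow> real \<Rightarrow> (real ^ 'n \<Rightarrow> real) \<Rightarrow> ennreal" where
  "energy \<Omega> W m \<epsilon> u =
     (if u \<in> H1 \<Omega> \<and> (\<integral>x. u x \<partial>lebesgue_on \<Omega>) = m
      then \<integral>\<^sup>+x. ennreal (1 / \<epsilon> * W (u x) + \<epsilon> / 2 * (norm (weak_grad \<Omega> u x))\<^sup>2) \<partial>lebesgue_on \<Omega>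
      else \<infinity>)"

definition c_W :: "(real \<Rightarrow> real) \<Rightarrow> real" where
  "c_W W = integral {-1..1} (\<lambda>s. sqrt (W s))"

definition limit_energy ::
    "(real ^ 'n) set \<Rightarrow> (real \<Rightarrow> real) \<Rightarrow> real \<Rightarrow> (real ^ 'n \<Rightarrow> real) \<Rightarrow> ennreal" where
  "limit_energy \<Omega> W m u =
     (if u \<in> BV_pm1 \<Omega> \<and> (\<integral>x. u x \<partial>lebesgue_on \<Omega>) = m
      then ennreal (2 * c_W W) * perimeter {x \<in> \<Omega>. u x = -1} \<Omega>
      else \<infinity>)"

definition two_phase :: "(real ^ 'n) set \<Rightarrow> (real ^ 'n) set \<Rightarrow> real ^ 'n \<Rightarrow> real" where
  "two_phase \<Omega> E0 x = - indicator E0 x + indicator (\<Omega> - E0) x"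

definition X1 :: "(real ^ 'n) set \<Rightarrow> real \<Rightarrow> (real ^ 'n \<Rightarrow> real) set" where
  "X1 \<Omega> m = {u. L2_fun (lebesgue_on \<Omega>) u \<and> (\<integral>x. u x \<partial>lebesgue_on \<Omega>) = m}"

definition Linf :: "(real ^ 'n) set \<Rightarrow> (real ^ 'n \<Rightarrow> real) set" where
  "Linf \<Omega> = {u. u \<in> borel_measurable (lebesgue_on \<Omega>) \<and>
                (\<exists>B. AE x in lebesgue_on \<Omega>. \<bar>u x\<bar> \<le> B)}"


section \<open>The nonlocal Allen--Cahn problem\<close>

definition lagrange_multiplier ::
    "(real ^ 'n) set \<Rightarrow> (real \<Rightarrow> real) \<Rightarrow> real \<Rightarrow> (real ^ 'n \<Rightarrow> real) \<Rightarrow> real" where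
  "lagrange_multiplier \<Omega> W \<epsilon> u =
     1 / (\<epsilon> * measure lebesgue \<Omega>) * (\<integral>x. deriv W (u x) \<partial>lebesgue_on \<Omega>)"

(* Weak solutions u in H^1(0,T; L^2) and L^2(0,T; H^1) with W'(u) in L^2, for every T (bounded
   solutions satisfy the last condition automatically).  The function v is the time derivative:
   u(t) = u(0) + (integral of v over 0..t) in L^2(Omega) for every t, so u is a continuous curve
   in L^2 and its value at each time is meaningful.  The function g is the spatial gradient.
   Testing with all of H^1(Omega), not only with functions vanishing on the boundary, encodes the
   homogeneous Neumann condition. *)
definition nonlocal_AC_solution ::
    "(real ^ 'n) set \<Rightarrow> (real \<Rightarrow> real) \<Rightarrow> real \<Rightarrow> (real ^ 'n \<Rightarrow> real)
       \<Rightarrow> (real \<Rightarrow> real ^ 'n \<Rightarrow> real) \<Rightarrow> bool" where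
  "nonlocal_AC_solution \<Omega> W \<epsilon> u0 u \<longleftrightarrow>
     (AE x in lebesgue_on \<Omega>. u 0 x = u0 x) \<and>
     (\<exists>v g.
        (\<forall>T>0. L2_fun (lebesgue_on {0..T} \<Otimes>\<^sub>M lebesgue_on \<Omega>) (\<lambda>(t, x). u t x) \<and>
               L2_fun (lebesgue_on {0..T} \<Otimes>\<^sub>M lebesgue_on \<Omega>) (\<lambda>(t, x). v t x) \<and>
               L2_fun (lebesgue_on {0..T} \<Otimes>\<^sub>M lebesgue_on \<Omega>) (\<lambda>(t, x). g t x) \<and>
               L2_fun (lebesgue_on {0..T} \<Otimes>\<^sub>M lebesgue_on \<Omega>) (\<lambda>(t, x). deriv W (u t x))) \<and>
        (\<forall>t\<ge>0. AE x in lebesgue_on \<Omega>. u t x = u 0 x + (\<integral>s. v s x \<partial>lebesgue_on {0..t})) \<and>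
        (AE t in lebesgue_on {0..}.
           H1_with_gradient \<Omega> (u t) (g t) \<and>
           (\<forall>\<phi> h. H1_with_gradient \<Omega> \<phi> h \<longrightarrow>
              (\<integral>x. v t x * \<phi> x \<partial>lebesgue_on \<Omega>) =
                - \<epsilon>\<^sup>2 * (\<integral>x. g t x \<bullet> h x \<partial>lebesgue_on \<Omega>)
                - (\<integral>x. deriv W (u t x) * \<phi> x \<partial>lebesgue_on \<Omega>)
                + \<epsilon> * lagrange_multiplier \<Omega> W \<epsilon> (u t) * (\<integral>x. \<phi> x \<partial>lebesgue_on \<Omega>))))"

end

theory Submission
  imports Defs
begin

text \<open>The solution stays near its initial state because it has too little energy to dissipate.  The equation is the gradient flow, in \<open>L\<^sup>2\<close> under
the mass constraint, of \<open>\<epsilon>\<close> times the energy, so that along a solution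
\<open>\<integral>\<integral> (\<partial>\<^sub>t u)\<^sup>2 + \<integral> W(u(T)) \<le> \<epsilon> K\<close>, where \<open>K\<close> bounds the energies of the initial data.
Let \<open>\<Psi>\<close> be a primitive of \<open>min 1 (sqrt W)\<close>.  By the chain rule and the inequality of Cauchy and Schwarz
the change of \<open>\<Psi>(u)\<close> up to the time \<open>T\<close> has \<open>L\<^sup>1\<close> norm at most
\<open>\<integral>\<integral> sqrt (W(u)) \<bar>\<partial>\<^sub>t u\<bar> \<le> sqrt (T \<epsilon> K) * sqrt (\<epsilon> K)\<close>,
which is of order \<open>sqrt \<epsilon>\<close> as long as \<open>T \<le> M / \<epsilon>\<close>.  This is the argument of Bronsard and Kohn.  The values \<open>-1\<close> and \<open>1\<close> are the
zeros of \<open>W\<close>, which grows at least linearly at infinity, and \<open>\<Psi>\<close> is strictly increasing, so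
smallness of \<open>\<integral> W(u)\<close> and of the \<open>L\<^sup>1\<close> distance of \<open>\<Psi>(u)\<close> to \<open>\<Psi>\<close> of the two-phase function makes \<open>u\<close> itself
close to the two-phase function (\<open>well_distance_bound\<close>, \<open>L1_distance_estimate\<close>).

Two points need work.  First, the time derivative of a weak solution is not an admissible test function.
The equation at time \<open>t\<close> is therefore tested with the backward difference \<open>u(t) - u(t - h)\<close>, where the
solution is continued to negative times by its initial value.  Convexity of the Dirichlet integral turns
this into a difference inequality (\<open>dissipation_step\<close>) which telescopes on integration in time.
For \<open>h \<rightarrow> 0\<close> the difference quotients, which are Steklov averages of the time derivative,
converge in \<open>L\<^sup>2\<close> (\<open>steklov_tendsto_L2\<close>, \<open>energy_inequality_limit\<close>).  Continuing by the initial value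
is what lets the energy of the initial datum itself appear on the right-hand side.

Second, the uniform bound \<open>K\<close> on the initial energies requires that the limit energy of the two-phase function be
finite, that is, that the minimizer has finite perimeter.  For this it suffices to exhibit one set of finite
perimeter, of the same volume and as close to the minimizer as desired
(\<open>finite_perimeter_competitor\<close>): a finite union of boxes, with the volume corrected by one
more box.  Perimeters are bounded from the behaviour of a set under small translations, because an integral of
a divergence is a limit of difference quotients (\<open>integral_directional_derivative_le\<close>).\<close>

section \<open>Square-integrable functions on finite measure spaces\<close>

lemma borel_measurable_lebesgue_on_id:
  fixes S :: "'a::euclidean_space set"
  shows "(\<lambda>x. x) \<in> borel_measurable (lebesgue_on S)"
  using id_borel_measurable_lebesgue_on[of S] unfolding id_def .

lemma borel_measurable_lebesgue_on_compose:
  fixes S :: "'a::euclidean_space set"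
  shows "f \<in> borel_measurable borel \<Longrightarrow> f \<in> borel_measurable (lebesgue_on S)"
  by (rule measurable_compose[OF borel_measurable_lebesgue_on_id])

lemma square_integrable_imp_integrable_finite:
  fixes g :: "'a \<Rightarrow> real"
  assumes "finite_measure M" "g \<in> borel_measurable M" "integrable M (\<lambda>x. (g x)\<^sup>2)"
  shows "integrable M g"
proof (rule Bochner_Integration.integrable_bound)
  interpret finite_measure M by fact
  show "integrable M (\<lambda>x. 1 + (g x)\<^sup>2)" using assms by auto
  show "AE x in M. norm (g x) \<le> norm (1 + (g x)\<^sup>2)"
  proof (rule AE_I2)
    fix x
    have "0 \<le> (1 - \<bar>g x\<bar>)\<^sup>2" by simp
    then have "2 * \<bar>g x\<bar> \<le> 1 + (g x)\<^sup>2" unfolding power2_diff by simp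
    then show "norm (g x) \<le> norm (1 + (g x)\<^sup>2)" by simp
  qed
qed (use assms in auto)

text \<open>The inequality of Cauchy and Schwarz against the constant function, from
\<open>0 \<le> \<integral> (g - c)\<^sup>2\<close> with \<open>c\<close> the mean value of \<open>g\<close>.\<close>

lemma square_integral_le:
  fixes g :: "'a \<Rightarrow> real"
  assumes "finite_measure M" "g \<in> borel_measurable M" "integrable M (\<lambda>x. (g x)\<^sup>2)"
  shows "(\<integral>x. g x \<partial>M)\<^sup>2 \<le> measure M (space M) * (\<integral>x. (g x)\<^sup>2 \<partial>M)"
proof -
  interpret finite_measure M by fact
  have g: "integrable M g" using square_integrable_imp_integrable_finite assms by blast
  define \<mu> where "\<mu> = measure M (space M)"
  define I where "I = (\<integral>x. g x \<partial>M)"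
  define J where "J = (\<integral>x. (g x)\<^sup>2 \<partial>M)"
  have *: "0 \<le> J - 2 * c * I + c\<^sup>2 * \<mu>" for c
  proof -
    have "0 \<le> (\<integral>x. (g x - c)\<^sup>2 \<partial>M)" by simp
    also have "\<dots> = (\<integral>x. (g x)\<^sup>2 - 2 * c * g x + c\<^sup>2 \<partial>M)"
      by (intro Bochner_Integration.integral_cong) (auto simp: power2_diff)
    also have "\<dots> = J - 2 * c * I + c\<^sup>2 * \<mu>" using g assms(3)
      by (simp add: I_def J_def \<mu>_def)
    finally show ?thesis .
  qed
  have mu: "0 \<le> \<mu>" by (simp add: \<mu>_def)
  show ?thesis
  proof (cases "\<mu> = 0")
    case True
    then have "emeasure M (space M) = 0" by (simp add: \<mu>_def emeasure_eq_measure)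
    then have "AE x in M. g x = 0" by (intro AE_I[of _ _ "space M"]) auto
    then have "(\<integral>x. g x \<partial>M) = (\<integral>x. 0 \<partial>M)" using assms by (intro integral_cong_AE) auto
    then show ?thesis by simp
  next
    case False
    with mu have "0 < \<mu>" by simp
    then have "I\<^sup>2 \<le> \<mu> * J" using *[of "I/\<mu>"] by (simp add: field_simps power2_eq_square)
    then show ?thesis by (simp add: I_def J_def \<mu>_def)
  qed
qed

lemma finite_measure_time [simp, intro]: "finite_measure (lebesgue_on {a..b::real})"
  by (rule finite_measure_lebesgue_on) (metis cbox_interval lmeasurable_cbox)

lemma continuous_measurable_time:
  "continuous_on UNIV (c::real\<Rightarrow>real) \<Longrightarrow> c \<in> borel_measurable (lebesgue_on S)"
  using borel_measurable_continuous_onI measurable_compose[OF borel_measurable_lebesgue_on_id] by blast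

lemma bounded_integrable_time:
  fixes f :: "real \<Rightarrow> real"
  assumes "f \<in> borel_measurable (lebesgue_on {a..b})" "\<And>t. t \<in> {a..b} \<Longrightarrow> \<bar>f t\<bar> \<le> B"
  shows "integrable (lebesgue_on {a..b}) f"
  using assms by (intro finite_measure.integrable_const_bound[of _ _ B]) (auto intro!: AE_I2)

lemma square_sum_le: "(x + y::real)\<^sup>2 \<le> 2 * x\<^sup>2 + 2 * y\<^sup>2"
proof -
  have "0 \<le> (x - y)\<^sup>2" by simp
  then show ?thesis by (simp add: power2_eq_square algebra_simps)
qed

lemma L2_add:
  fixes f g :: "'a \<Rightarrow> real"
  assumes "f \<in> borel_measurable M" "integrable M (\<lambda>x. (f x)\<^sup>2)"
    "g \<in> borel_measurable M" "integrable M (\<lambda>x. (g x)\<^sup>2)"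
  shows "integrable M (\<lambda>x. (f x + g x)\<^sup>2)"
  by (rule Bochner_Integration.integrable_bound[of _ "\<lambda>x. 2 * (f x)\<^sup>2 + 2 * (g x)\<^sup>2"])
    (use assms in \<open>auto intro!: AE_I2 square_sum_le\<close>)

lemma L2_diff:
  fixes f g :: "'a \<Rightarrow> real"
  assumes "f \<in> borel_measurable M" "integrable M (\<lambda>x. (f x)\<^sup>2)"
    "g \<in> borel_measurable M" "integrable M (\<lambda>x. (g x)\<^sup>2)"
  shows "integrable M (\<lambda>x. (f x - g x)\<^sup>2)"
  using L2_add[of f M "\<lambda>x. - g x"] assms by auto

lemma L2_mult:
  fixes f g :: "'a \<Rightarrow> real"
  assumes "f \<in> borel_measurable M" "integrable M (\<lambda>x. (f x)\<^sup>2)"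
    "g \<in> borel_measurable M" "integrable M (\<lambda>x. (g x)\<^sup>2)"
  shows "integrable M (\<lambda>x. f x * g x)"
proof -
  have "f x * g x = ((f x + g x)\<^sup>2 - (f x - g x)\<^sup>2) / 4" for x
    by (simp add: power2_eq_square algebra_simps)
  then have eq: "(\<lambda>x. f x * g x) = (\<lambda>x. ((f x + g x)\<^sup>2 - (f x - g x)\<^sup>2) / 4)" by auto
  show ?thesis unfolding eq using L2_add[OF assms] L2_diff[OF assms] by simp
qed

lemma square_diff_triangle_integral:
  fixes f g h :: "'a \<Rightarrow> real"
  assumes "f \<in> borel_measurable M" "integrable M (\<lambda>x. (f x)\<^sup>2)"
    "g \<in> borel_measurable M" "integrable M (\<lambda>x. (g x)\<^sup>2)"
    "h \<in> borel_measurable M" "integrable M (\<lambda>x. (h x)\<^sup>2)"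
  shows "(\<integral>x. (f x - h x)\<^sup>2 \<partial>M) \<le> 2 * (\<integral>x. (f x - g x)\<^sup>2 \<partial>M) + 2 * (\<integral>x. (g x - h x)\<^sup>2 \<partial>M)"
proof -
  have "(\<integral>x. (f x - h x)\<^sup>2 \<partial>M) \<le> (\<integral>x. 2 * (f x - g x)\<^sup>2 + 2 * (g x - h x)\<^sup>2 \<partial>M)"
  proof (rule integral_mono)
    fix x show "(f x - h x)\<^sup>2 \<le> 2 * (f x - g x)\<^sup>2 + 2 * (g x - h x)\<^sup>2"
      using square_sum_le[of "f x - g x" "g x - h x"] by simp
  qed (use assms in \<open>auto intro!: Bochner_Integration.integrable_add integrable_mult_right L2_diff\<close>)
  also have "\<dots> = 2 * (\<integral>x. (f x - g x)\<^sup>2 \<partial>M) + 2 * (\<integral>x. (g x - h x)\<^sup>2 \<partial>M)"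
    using assms by (simp add: L2_diff)
  finally show ?thesis .
qed

lemma tendsto_zero_obtain:
  fixes X :: "nat \<Rightarrow> real"
  assumes "X \<longlonglongrightarrow> 0" "0 < e"
  obtains k where "X k < e"
  using order_tendstoD(2)[OF assms] by (auto simp: eventually_sequentially)

text \<open>Truncation reduces this to bounded functions.  A bounded measurable function is an almost everywhere limit of
continuous functions, which may be truncated at the same level, and dominated convergence applies.\<close>

lemma continuous_dense_L2:
  fixes f :: "real \<Rightarrow> real"
  assumes f[measurable]: "f \<in> borel_measurable (lebesgue_on {0..T})"
    and f2: "integrable (lebesgue_on {0..T}) (\<lambda>t. (f t)\<^sup>2)" and e: "0 < e"
  shows "\<exists>c. continuous_on UNIV c \<and> (LINT t|lebesgue_on {0..T}. (f t - c t)\<^sup>2) < e"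
proof -
  let ?P = "lebesgue_on {0..T}"
  define cut where "cut = (\<lambda>(k::nat) y. max (- real k) (min (real k) (y::real)))"
  have cutb: "\<bar>cut k y\<bar> \<le> real k" for k y by (auto simp: cut_def)
  have cutm[measurable]: "cut k \<in> borel_measurable borel" for k unfolding cut_def by measurable
  have "(\<lambda>k. LINT t|?P. (f t - cut k (f t))\<^sup>2) \<longlonglongrightarrow> (LINT t|?P. 0)"
  proof (rule integral_dominated_convergence[where w="\<lambda>t. (f t)\<^sup>2"])
    show "AE t in ?P. (\<lambda>k. (f t - cut k (f t))\<^sup>2) \<longlonglongrightarrow> 0"
    proof (rule AE_I2)
      fix t
      have "\<forall>\<^sub>F k in sequentially. (f t - cut k (f t))\<^sup>2 = 0"
      proof -
        obtain K where "\<bar>f t\<bar> \<le> real K" using real_arch_simple by blast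
        then show ?thesis unfolding eventually_sequentially by (intro exI[of _ K]) (auto simp: cut_def)
      qed
      then show "(\<lambda>k. (f t - cut k (f t))\<^sup>2) \<longlonglongrightarrow> 0" by (rule tendsto_eventually)
    qed
    show "AE x in ?P. norm ((f x - cut k (f x))\<^sup>2) \<le> (f x)\<^sup>2" for k
      by (rule AE_I2) (auto simp: cut_def abs_le_square_iff[symmetric])
  qed (use f2 in measurable)
  then obtain k where k: "(LINT t|?P. (f t - cut k (f t))\<^sup>2) < e / 4"
    using e tendsto_zero_obtain[of _ "e/4"] by auto
  define fk where "fk = (\<lambda>t. cut k (f t))"
  have fkm[measurable]: "fk \<in> borel_measurable ?P" unfolding fk_def by measurable
  have "(\<lambda>t. if t \<in> {0..T} then f t else 0) \<in> borel_measurable lebesgue"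
    using borel_measurable_if[of "{0..T}" f] f by simp
  then have "(\<lambda>t. if t \<in> {0..T} then f t else 0) measurable_on UNIV"
    using lebesgue_measurable_imp_measurable_on[of "\<lambda>t. if t \<in> {0..T} then f t else 0" UNIV] by simp
  then obtain N g where N: "negligible N" and g: "\<And>n::nat. continuous_on UNIV (g n)"
     and lim: "\<And>t. t \<notin> N \<Longrightarrow> (\<lambda>n. g n t) \<longlonglongrightarrow> (if t \<in> {0..T} then f t else 0)"
    unfolding measurable_on_def by auto
  define c where "c = (\<lambda>n t. cut k (g n t))"
  have cc: "continuous_on UNIV (c n)" for n unfolding c_def cut_def using g by (intro continuous_intros) auto
  have cm[measurable]: "c n \<in> borel_measurable ?P" for n using cc continuous_measurable_time by blast
  have "(\<lambda>n. LINT t|?P. (fk t - c n t)\<^sup>2) \<longlonglongrightarrow> (LINT t|?P. 0)"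
  proof (rule integral_dominated_convergence[where w="\<lambda>t. (2 * real k)\<^sup>2"])
    have "AE t in lebesgue. t \<notin> N"
      using N by (metis negligible_iff_null_sets AE_not_in)
    then have "AE t in ?P. t \<notin> N" by (auto simp: AE_restrict_space_iff elim: eventually_mono)
    then show "AE t in ?P. (\<lambda>n. (fk t - c n t)\<^sup>2) \<longlonglongrightarrow> 0"
    proof (rule AE_mp, intro AE_I2 impI)
      fix t assume t: "t \<in> space ?P" "t \<notin> N"
      then have "(\<lambda>n. g n t) \<longlonglongrightarrow> f t" using lim[of t] by simp
      moreover have "isCont (cut k) (f t)" unfolding cut_def by (intro continuous_intros)
      ultimately have "(\<lambda>n. c n t) \<longlonglongrightarrow> fk t" unfolding c_def fk_def using isCont_tendsto_compose by blast
      then have "(\<lambda>n. (fk t - c n t)\<^sup>2) \<longlonglongrightarrow> (fk t - fk t)\<^sup>2" by (intro tendsto_intros)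
      then show "(\<lambda>n. (fk t - c n t)\<^sup>2) \<longlonglongrightarrow> 0" by simp
    qed
    show "AE t in ?P. norm ((fk t - c n t)\<^sup>2) \<le> (2 * real k)\<^sup>2" for n
    proof (rule AE_I2)
      fix t
      have "\<bar>fk t - c n t\<bar> \<le> \<bar>2 * real k\<bar>"
        using cutb[of k "f t"] cutb[of k "g n t"] unfolding fk_def c_def by linarith
      then show "norm ((fk t - c n t)\<^sup>2) \<le> (2 * real k)\<^sup>2"
        unfolding abs_le_square_iff by simp
    qed
  qed measurable
  then obtain n where n: "(LINT t|?P. (fk t - c n t)\<^sup>2) < e / 4"
    using e tendsto_zero_obtain[of _ "e/4"] by auto
  have "integrable ?P (\<lambda>t. (fk t)\<^sup>2)"
  proof (rule bounded_integrable_time[where B="(real k)\<^sup>2"])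
    show "\<bar>(fk t)\<^sup>2\<bar> \<le> (real k)\<^sup>2" for t
      using cutb[of k "f t"] by (simp add: fk_def abs_le_square_iff[symmetric])
  qed measurable
  moreover have "integrable ?P (\<lambda>t. (c n t)\<^sup>2)"
  proof (rule bounded_integrable_time[where B="(real k)\<^sup>2"])
    show "\<bar>(c n t)\<^sup>2\<bar> \<le> (real k)\<^sup>2" for t
      using cutb[of k "g n t"] by (simp add: c_def abs_le_square_iff[symmetric])
  qed measurable
  ultimately have "(LINT t|?P. (f t - c n t)\<^sup>2) \<le> 2 * (LINT t|?P. (f t - fk t)\<^sup>2) + 2 * (LINT t|?P. (fk t - c n t)\<^sup>2)"
    using f2 by (intro square_diff_triangle_integral) auto
  also have "\<dots> < e" using k n by (simp add: fk_def)
  finally show ?thesis using cc by blast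
qed

section \<open>Steklov averages of functions of time\<close>

text \<open>For \<open>t \<le> 0\<close> the interval of integration is null and the primitive vanishes.  The function is thus
tacitly extended by zero to negative times, and no case distinction is needed for differences
that reach back before the time \<open>0\<close>.\<close>

definition primitive :: "(real \<Rightarrow> real) \<Rightarrow> real \<Rightarrow> real" where
  "primitive f t = (LINT s|lebesgue_on {0..t}. f s)"

text \<open>The mean value over \<open>{t - h..t}\<close> of the function extended by zero to negative times.\<close>

definition steklov :: "real \<Rightarrow> (real \<Rightarrow> real) \<Rightarrow> real \<Rightarrow> real" where
  "steklov h f t = (primitive f t - primitive f (t - h)) / h"

lemma AE_nonzero_time: "AE t in lebesgue_on {0..T}. t \<noteq> (0::real)"
proof -
  have "AE t in lebesgue. t \<noteq> (0::real)" by (rule AE_I'[of "{0}"]) auto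
  then show ?thesis by (auto simp: AE_restrict_space_iff elim!: eventually_mono)
qed

lemma primitive_nonpos: "t \<le> 0 \<Longrightarrow> primitive f t = 0"
proof -
  assume t: "t \<le> 0"
  have "AE s in lebesgue_on {0..t}. f s = 0"
    using AE_nonzero_time AE_space by eventually_elim (use t in auto)
  then show ?thesis unfolding primitive_def by (rule integral_eq_zero_AE)
qed

text \<open>Writing all primitives up to time \<open>T\<close> as integrals over one and the same measure space makes them
accessible to the theorem of Fubini.\<close>

lemma primitive_eq:
  assumes "t \<le> T"
  shows "primitive f t = (LINT s|lebesgue_on {0..T}. indicator {..t} s * f s)"
proof -
  have "(\<lambda>s. indicator {0..t} s *\<^sub>R f s) = (\<lambda>s. indicator {0..T} s *\<^sub>R (indicator {..t} s * f s))"
    using assms by (auto simp: indicator_def)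
  then show ?thesis unfolding primitive_def by (subst (1 2) integral_restrict_space) simp_all
qed

lemma integrable_indicator_time:
  fixes f :: "real \<Rightarrow> real"
  assumes "integrable (lebesgue_on {0..T}) f" "A \<in> sets borel"
  shows "integrable (lebesgue_on {0..T}) (\<lambda>s. indicator A s * f s)"
proof -
  have [measurable]: "(\<lambda>s. indicator A s :: real) \<in> borel_measurable (lebesgue_on {0..T})"
    using assms(2) by (intro borel_measurable_lebesgue_on_compose borel_measurable_indicator)
  show ?thesis
    by (rule Bochner_Integration.integrable_bound[OF assms(1)])
      (use assms in \<open>auto intro!: AE_I2 borel_measurable_times split: split_indicator\<close>)
qed

lemma primitive_diff:
  fixes f :: "real \<Rightarrow> real"
  assumes "integrable (lebesgue_on {0..T}) f" "s \<le> t" "t \<le> T"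
  shows "primitive f t - primitive f s = (LINT r|lebesgue_on {0..T}. indicator {s<..t} r * f r)"
proof -
  have "primitive f t - primitive f s = (LINT r|lebesgue_on {0..T}. indicator {..t} r * f r - indicator {..s} r * f r)"
    using assms by (simp add: primitive_eq[of _ T] integrable_indicator_time)
  also have "\<dots> = (LINT r|lebesgue_on {0..T}. indicator {s<..t} r * f r)"
    by (intro Bochner_Integration.integral_cong) (use assms in \<open>auto simp: indicator_def\<close>)
  finally show ?thesis .
qed

lemma borel_measurable_fst_lebesgue_on:
  fixes S :: "'a::euclidean_space set"
  shows "fst \<in> borel_measurable (lebesgue_on S \<Otimes>\<^sub>M N)"
  using measurable_compose[OF measurable_fst borel_measurable_lebesgue_on_id] .

lemma borel_measurable_snd_lebesgue_on:
  fixes S :: "'a::euclidean_space set"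
  shows "snd \<in> borel_measurable (N \<Otimes>\<^sub>M lebesgue_on S)"
  using measurable_compose[OF measurable_snd borel_measurable_lebesgue_on_id] .

lemma primitive_measurable:
  assumes [measurable]: "f \<in> borel_measurable (lebesgue_on {0..T})" and that: "0 \<le> h"
  shows "(\<lambda>t. primitive f (t - h)) \<in> borel_measurable (lebesgue_on {0..T})"
proof -
  interpret sigma_finite_measure "lebesgue_on {0..T}"
    by (simp add: finite_measure.axioms(1))
  note [measurable] = borel_measurable_fst_lebesgue_on borel_measurable_snd_lebesgue_on
  have "(\<lambda>t. LINT s|lebesgue_on {0..T}. (if s \<le> t - h then 1 else 0) * f s) \<in> borel_measurable (lebesgue_on {0..T})"
    by measurable
  then have "(\<lambda>t. LINT s|lebesgue_on {0..T}. indicator {..t - h} s * f s) \<in> borel_measurable (lebesgue_on {0..T})"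
    by (simp add: indicator_def of_bool_def)
  then show ?thesis
    by (rule measurable_cong[THEN iffD1, rotated]) (use that in \<open>auto intro!: primitive_eq[symmetric]\<close>)
qed

lemma steklov_measurable:
  assumes [measurable]: "f \<in> borel_measurable (lebesgue_on {0..T})" and h: "0 \<le> h"
  shows "steklov h f \<in> borel_measurable (lebesgue_on {0..T})"
  using primitive_measurable[OF assms] primitive_measurable[OF assms(1), of 0]
  unfolding steklov_def by simp

lemma averaging_window_le:
  fixes h t T :: real
  assumes "0 \<le> h"
  shows "(LINT s|lebesgue_on {0..T}. indicator {t-h<..t} s) \<le> h"
proof -
  have "(LINT s|lebesgue_on {0..T}. indicator {t-h<..t} s) = measure lebesgue ({0..T} \<inter> {t-h<..t})"
    by (subst integral_restrict_space) (auto simp flip: indicator_inter_arith)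
  also have "\<dots> \<le> measure lebesgue {t-h<..t}"
    by (rule measure_mono_fmeasurable) (auto intro!: bounded_set_imp_lmeasurable)
  finally show ?thesis using assms by simp
qed

text \<open>The inequality of Jensen for the square, obtained by expanding \<open>0 \<le> \<integral> (f - m)\<^sup>2\<close> over the averaging window, where \<open>m\<close> is the
average.\<close>

lemma steklov_square_le:
  fixes f :: "real \<Rightarrow> real"
  assumes f[measurable]: "f \<in> borel_measurable (lebesgue_on {0..T})"
    and f2: "integrable (lebesgue_on {0..T}) (\<lambda>t. (f t)\<^sup>2)" and h: "0 < h" and t: "t \<le> T"
  shows "(steklov h f t)\<^sup>2 \<le> (LINT s|lebesgue_on {0..T}. indicator {t-h<..t} s * (f s)\<^sup>2) / h"
proof -
  let ?P = "lebesgue_on {0..T}"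
  interpret finite_measure ?P by simp
  have fi: "integrable ?P f" by (rule square_integrable_imp_integrable_finite) (use f2 in auto)
  define m where "m = steklov h f t"
  let ?i = "indicator {t-h<..t} :: real \<Rightarrow> real"
  have i[measurable]: "?i \<in> borel_measurable ?P"
    by (intro borel_measurable_lebesgue_on_compose) measurable
  have hm: "h * m = (LINT s|?P. ?i s * f s)"
    using primitive_diff[OF fi, of "t-h" t] h t by (simp add: m_def steklov_def)
  have ii: "integrable ?P ?i" by (rule bounded_integrable_time[where B=1]) (auto simp: indicator_def)
  have meas: "(LINT s|?P. ?i s) \<le> h" using h by (intro averaging_window_le) simp
  have i1: "integrable ?P (\<lambda>s. ?i s * f s)" "integrable ?P (\<lambda>s. ?i s * (f s)\<^sup>2)"
    using integrable_indicator_time[OF fi] integrable_indicator_time[OF f2] by auto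
  have "0 \<le> (LINT s|?P. ?i s * (f s - m)\<^sup>2)" by simp
  also have "\<dots> = (LINT s|?P. ?i s * (f s)\<^sup>2 - 2 * m * (?i s * f s) + m\<^sup>2 * ?i s)"
    by (intro Bochner_Integration.integral_cong) (auto simp: power2_diff algebra_simps)
  also have "\<dots> = (LINT s|?P. ?i s * (f s)\<^sup>2) - 2 * m * (h * m) + m\<^sup>2 * (LINT s|?P. ?i s)"
    using i1 ii by (simp add: hm)
  also have "\<dots> \<le> (LINT s|?P. ?i s * (f s)\<^sup>2) - 2 * m * (h * m) + m\<^sup>2 * h"
    using meas by (simp add: mult_left_mono)
  finally show ?thesis using h by (simp add: m_def[symmetric] field_simps power2_eq_square)
qed

text \<open>By the preceding bound and Fubini, the value of \<open>f\<^sup>2\<close> at \<open>s\<close> is counted with the weight \<open>1 / h\<close> for the times \<open>t\<close> in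
\<open>{s..<s + h}\<close>, hence with total weight at most one.\<close>

lemma steklov_contraction:
  fixes f :: "real \<Rightarrow> real"
  assumes f[measurable]: "f \<in> borel_measurable (lebesgue_on {0..T})"
    and f2: "integrable (lebesgue_on {0..T}) (\<lambda>t. (f t)\<^sup>2)" and h: "0 < h"
  shows "integrable (lebesgue_on {0..T}) (\<lambda>t. (steklov h f t)\<^sup>2)"
    and "(LINT t|lebesgue_on {0..T}. (steklov h f t)\<^sup>2) \<le> (LINT t|lebesgue_on {0..T}. (f t)\<^sup>2)"
proof -
  let ?P = "lebesgue_on {0..T}"
  interpret P: finite_measure ?P by simp
  interpret PP: pair_sigma_finite ?P ?P ..
  have [measurable]: "steklov h f \<in> borel_measurable ?P" using h by (intro steklov_measurable) auto
  have [measurable]: "(\<lambda>p. indicator {fst p-h<..fst p} (snd p) :: real) \<in> borel_measurable (?P \<Otimes>\<^sub>M ?P)"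
    unfolding indicator_def greaterThanAtMost_iff of_bool_def
    using borel_measurable_fst_lebesgue_on[measurable] borel_measurable_snd_lebesgue_on[measurable] by measurable
  let ?g = "\<lambda>t s. ennreal (indicator {t-h<..t} s * (f s)\<^sup>2 / h)"
  have gm: "case_prod ?g \<in> borel_measurable (?P \<Otimes>\<^sub>M ?P)"
    unfolding case_prod_unfold by measurable
  have "(\<integral>\<^sup>+t. ennreal ((steklov h f t)\<^sup>2) \<partial>?P) \<le> (\<integral>\<^sup>+t. \<integral>\<^sup>+s. ?g t s \<partial>?P \<partial>?P)"
  proof (rule nn_integral_mono)
    fix t assume t: "t \<in> space ?P"
    have i: "integrable ?P (\<lambda>s. indicator {t-h<..t} s * (f s)\<^sup>2)" by (rule integrable_indicator_time[OF f2]) auto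
    have "ennreal ((steklov h f t)\<^sup>2) \<le> ennreal (LINT s|?P. indicator {t-h<..t} s * (f s)\<^sup>2 / h)"
      using steklov_square_le[OF f f2 h, of t] t by (intro ennreal_leI) simp
    also have "\<dots> = (\<integral>\<^sup>+s. ?g t s \<partial>?P)"
      by (rule nn_integral_eq_integral[symmetric]) (use i h in auto)
    finally show "ennreal ((steklov h f t)\<^sup>2) \<le> (\<integral>\<^sup>+s. ?g t s \<partial>?P)" .
  qed
  also have "\<dots> = (\<integral>\<^sup>+s. \<integral>\<^sup>+t. ?g t s \<partial>?P \<partial>?P)"
    using PP.Fubini[OF gm] by simp
  also have "\<dots> \<le> (\<integral>\<^sup>+s. ennreal ((f s)\<^sup>2) \<partial>?P)"
  proof (rule nn_integral_mono)
    fix s assume "s \<in> space ?P"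
    have "(\<integral>\<^sup>+t. ?g t s \<partial>?P) = (\<integral>\<^sup>+t. ennreal ((f s)\<^sup>2 / h) * indicator {s..<s+h} t \<partial>?P)"
      by (intro nn_integral_cong) (auto simp: indicator_def)
    also have "\<dots> = ennreal ((f s)\<^sup>2 / h) * emeasure ?P ({s..<s+h} \<inter> space ?P)"
      by (subst nn_integral_cmult_indicator[symmetric])
         (auto simp: sets_restrict_space_iff intro!: nn_integral_cong split: split_indicator)
    also have "\<dots> \<le> ennreal ((f s)\<^sup>2 / h) * ennreal h"
    proof (intro mult_left_mono)
      have "emeasure ?P ({s..<s+h} \<inter> space ?P) = emeasure lebesgue ({s..<s+h} \<inter> {0..T})"
        by (subst emeasure_restrict_space) auto
      also have "\<dots> \<le> emeasure lebesgue {s..<s+h}" by (intro emeasure_mono) auto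
      also have "\<dots> = ennreal h" using h by (simp)
      finally show "emeasure ?P ({s..<s+h} \<inter> space ?P) \<le> ennreal h" .
    qed auto
    also have "\<dots> = ennreal ((f s)\<^sup>2)" using h by (simp flip: ennreal_mult)
    finally show "(\<integral>\<^sup>+t. ?g t s \<partial>?P) \<le> ennreal ((f s)\<^sup>2)" .
  qed
  also have "\<dots> = ennreal (LINT t|?P. (f t)\<^sup>2)" by (rule nn_integral_eq_integral[OF f2]) auto
  finally have le: "(\<integral>\<^sup>+t. ennreal ((steklov h f t)\<^sup>2) \<partial>?P) \<le> ennreal (LINT t|?P. (f t)\<^sup>2)" .
  then show int: "integrable ?P (\<lambda>t. (steklov h f t)\<^sup>2)"
    by (intro integrableI_nonneg) (auto simp: le_less_trans[OF _ ennreal_less_top])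
  have "ennreal (LINT t|?P. (steklov h f t)\<^sup>2) \<le> ennreal (LINT t|?P. (f t)\<^sup>2)"
    using le by (subst (asm) nn_integral_eq_integral[OF int]) auto
  then show "(LINT t|?P. (steklov h f t)\<^sup>2) \<le> (LINT t|?P. (f t)\<^sup>2)" by simp
qed

lemma primitive_abs_diff_le:
  fixes f g :: "real \<Rightarrow> real"
  assumes "integrable (lebesgue_on {0..T}) f" "integrable (lebesgue_on {0..T}) g" "t \<le> T"
  shows "\<bar>primitive f t - primitive g t\<bar> \<le> (LINT s|lebesgue_on {0..T}. \<bar>f s - g s\<bar>)"
proof -
  let ?P = "lebesgue_on {0..T}"
  have i: "integrable ?P (\<lambda>s. indicator {..t} s * (f s - g s))"
    using assms by (intro integrable_indicator_time) auto
  have "primitive f t - primitive g t = (LINT s|?P. indicator {..t} s * f s - indicator {..t} s * g s)"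
    using assms by (simp add: primitive_eq[of t T] integrable_indicator_time)
  also have "\<dots> = (LINT s|?P. indicator {..t} s * (f s - g s))"
    by (simp add: algebra_simps)
  also have "\<bar>\<dots>\<bar> \<le> (LINT s|?P. \<bar>indicator {..t} s * (f s - g s)\<bar>)" by (rule integral_abs_bound)
  also have "\<dots> \<le> (LINT s|?P. \<bar>f s - g s\<bar>)"
    using i assms by (intro integral_mono) (auto simp: indicator_def)
  finally show ?thesis .
qed

lemma primitive_continuous_deriv:
  assumes c: "continuous_on UNIV (c::real \<Rightarrow> real)" and t: "0 \<le> t" "t \<le> T"
  shows "(primitive c has_real_derivative c t) (at t within {0..T})"
proof -
  have i: "integrable (lebesgue_on {0..r}) c" for r
    by (rule continuous_imp_integrable_real) (rule continuous_on_subset[OF c], simp)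
  have "((\<lambda>x. integral {0..x} c) has_real_derivative c t) (at t within {0..T})"
    by (rule integral_has_real_derivative) (use t continuous_on_subset[OF c] in auto)
  moreover have "primitive c = (\<lambda>x. integral {0..x} c)"
    unfolding primitive_def using i by (auto intro!: lebesgue_integral_eq_integral)
  ultimately show ?thesis by simp
qed

lemma steklov_continuous_tendsto:
  fixes c :: "real \<Rightarrow> real" and h :: "nat \<Rightarrow> real"
  assumes c: "continuous_on UNIV c" and h: "\<And>n. 0 < h n" "h \<longlonglongrightarrow> 0" and t: "0 < t"
  shows "(\<lambda>n. steklov (h n) c t) \<longlonglongrightarrow> c t"
proof -
  have "(primitive c has_real_derivative c t) (at t within {0..t+1})"
    by (rule primitive_continuous_deriv[OF c]) (use t in auto)
  moreover have "at t within {0..t+1} = at t"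
    using t by (intro at_within_interior) auto
  ultimately have D: "(primitive c has_real_derivative c t) (at t)" by simp
  have "filterlim (\<lambda>n. t - h n) (at t) sequentially"
    unfolding filterlim_at using tendsto_diff[OF tendsto_const h(2), of t] h(1)
    by (auto intro!: always_eventually simp: less_imp_neq)
  then have "(\<lambda>n. (primitive c (t - h n) - primitive c t) / (t - h n - t)) \<longlonglongrightarrow> c t"
    using D unfolding has_field_derivative_iff by (rule filterlim_compose[rotated])
  moreover have "(primitive c (t - h n) - primitive c t) / (t - h n - t) = steklov (h n) c t" for n
    unfolding steklov_def using h(1)[of n] by (simp add: field_simps)
  ultimately show ?thesis by simp
qed

lemma continuous_bounded_on_time:
  fixes c :: "real \<Rightarrow> real"
  assumes c: "continuous_on UNIV c"
  obtains B where "\<And>t. t \<in> {a..b} \<Longrightarrow> \<bar>c t\<bar> \<le> B"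
proof -
  have "bounded (c ` {a..b})"
    by (intro compact_imp_bounded compact_continuous_image continuous_on_subset[OF c]) auto
  then obtain B where "\<forall>x\<in>c ` {a..b}. norm x \<le> B" unfolding bounded_iff by blast
  then show ?thesis by (intro that[of B]) auto
qed

lemma continuous_L2_time:
  assumes c: "continuous_on UNIV (c::real\<Rightarrow>real)"
  shows "c \<in> borel_measurable (lebesgue_on {0..T})" "integrable (lebesgue_on {0..T}) (\<lambda>t. (c t)\<^sup>2)"
proof -
  show "c \<in> borel_measurable (lebesgue_on {0..T})" by (rule continuous_measurable_time[OF c])
  show "integrable (lebesgue_on {0..T}) (\<lambda>t. (c t)\<^sup>2)"
    by (intro continuous_imp_integrable_real continuous_intros continuous_on_subset[OF c]) auto
qed

lemma steklov_continuous_L2: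
  fixes c :: "real \<Rightarrow> real" and h :: "nat \<Rightarrow> real"
  assumes c: "continuous_on UNIV c" and h: "\<And>n. 0 < h n" "h \<longlonglongrightarrow> 0"
  shows "(\<lambda>n. LINT t|lebesgue_on {0..T}. (steklov (h n) c t - c t)\<^sup>2) \<longlonglongrightarrow> 0"
proof -
  let ?P = "lebesgue_on {0..T}"
  interpret finite_measure ?P by simp
  have [measurable]: "c \<in> borel_measurable ?P" by (rule continuous_measurable_time[OF c])
  have [measurable]: "steklov (h n) c \<in> borel_measurable ?P" for n
    by (rule steklov_measurable) (use h(1)[of n] in auto)
  obtain B where B: "\<And>t. t \<in> {0..T} \<Longrightarrow> \<bar>c t\<bar> \<le> B" using continuous_bounded_on_time[OF c] by blast
  note c2i = continuous_L2_time(2)[OF c, where T=T]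
  have SB: "\<bar>steklov (h n) c t\<bar> \<le> B" if t: "t \<in> {0..T}" for n t
  proof -
    have "0 \<le> B" using B[OF t] by linarith
    have 1: "(steklov (h n) c t)\<^sup>2 \<le> (LINT s|lebesgue_on {0..T}. indicator {t-h n<..t} s * (c s)\<^sup>2) / h n"
      by (rule steklov_square_le) (use t h(1) c2i in auto)
    have "(LINT s|?P. indicator {t-h n<..t} s * (c s)\<^sup>2) \<le> (LINT s|?P. indicator {t-h n<..t} s * B\<^sup>2)"
    proof (intro integral_mono)
      show "integrable ?P (\<lambda>s. indicator {t-h n<..t} s * (c s)\<^sup>2)" by (rule integrable_indicator_time[OF c2i]) auto
      show "integrable ?P (\<lambda>s. indicator {t-h n<..t} s * B\<^sup>2)" by (rule integrable_indicator_time) auto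
      fix s assume "s \<in> space ?P"
      then have "\<bar>c s\<bar>\<^sup>2 \<le> B\<^sup>2" using B by (intro power_mono) auto
      then show "indicator {t - h n<..t} s * (c s)\<^sup>2 \<le> indicator {t - h n<..t} s * B\<^sup>2"
        by (auto simp: indicator_def)
    qed
    also have "\<dots> = (LINT s|?P. indicator {t-h n<..t} s) * B\<^sup>2"
      by (rule integral_mult_left_zero)
    also have "\<dots> \<le> h n * B\<^sup>2"
      using less_imp_le[OF h(1)] by (intro mult_right_mono averaging_window_le) auto
    finally have "(LINT s|?P. indicator {t-h n<..t} s * (c s)\<^sup>2) / h n \<le> B\<^sup>2"
      using h(1)[of n] by (simp add: field_simps)
    with 1 have "(steklov (h n) c t)\<^sup>2 \<le> B\<^sup>2" by linarith
    then show ?thesis using \<open>0 \<le> B\<close> by (simp add: abs_le_square_iff[symmetric])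
  qed
  have "(\<lambda>n. LINT t|?P. (steklov (h n) c t - c t)\<^sup>2) \<longlonglongrightarrow> (LINT t|?P. 0)"
  proof (rule integral_dominated_convergence[where w="\<lambda>t. (2*B)\<^sup>2"])
    show "AE t in ?P. (\<lambda>n. (steklov (h n) c t - c t)\<^sup>2) \<longlonglongrightarrow> 0"
      using AE_nonzero_time AE_space
    proof eventually_elim
      case (elim t)
      then have "0 < t" by simp
      then have "(\<lambda>n. (steklov (h n) c t - c t)\<^sup>2) \<longlonglongrightarrow> (c t - c t)\<^sup>2"
        by (intro tendsto_intros steklov_continuous_tendsto[OF c h])
      then show ?case by simp
    qed
    show "AE t in ?P. norm ((steklov (h n) c t - c t)\<^sup>2) \<le> (2*B)\<^sup>2" for n
    proof (rule AE_I2)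
      fix t assume "t \<in> space ?P"
      then have "\<bar>steklov (h n) c t - c t\<bar> \<le> \<bar>2 * B\<bar>" using SB[of t n] B[of t] by fastforce
      then show "norm ((steklov (h n) c t - c t)\<^sup>2) \<le> (2*B)\<^sup>2" unfolding abs_le_square_iff by simp
    qed
  qed auto
  then show ?thesis by simp
qed

lemma steklov_diff:
  assumes "integrable (lebesgue_on {0..T}) f" "integrable (lebesgue_on {0..T}) g" "t \<le> T" "0 < h"
  shows "steklov h (\<lambda>s. f s - g s) t = steklov h f t - steklov h g t"
proof -
  have "primitive (\<lambda>s. f s - g s) t = primitive f t - primitive g t" if "t \<le> T" for t
    unfolding primitive_eq[OF that] using assms
    by (simp add: integrable_indicator_time right_diff_distrib)
  from this[of t] this[of "t - h"] show ?thesis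
    using assms unfolding steklov_def by (simp flip: diff_divide_distrib)
qed

text \<open>For continuous functions the averages converge pointwise and boundedly; since averaging is a contraction,
density of the continuous functions extends the convergence to all square-integrable functions.\<close>

lemma steklov_tendsto_L2:
  fixes f :: "real \<Rightarrow> real" and h :: "nat \<Rightarrow> real"
  assumes f[measurable]: "f \<in> borel_measurable (lebesgue_on {0..T})"
    and f2: "integrable (lebesgue_on {0..T}) (\<lambda>t. (f t)\<^sup>2)"
    and h: "\<And>n. 0 < h n" "h \<longlonglongrightarrow> 0"
  shows "(\<lambda>n. LINT t|lebesgue_on {0..T}. (steklov (h n) f t - f t)\<^sup>2) \<longlonglongrightarrow> 0"
proof (rule LIMSEQ_I, goal_cases)
  case (1 e)
  let ?P = "lebesgue_on {0..T}"
  have fin: "finite_measure ?P" by simp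
  obtain c where c: "continuous_on UNIV c" and fc: "(LINT t|?P. (f t - c t)\<^sup>2) < e / 12"
    using continuous_dense_L2[OF f f2, of "e/12"] 1 by auto
  note cm[measurable] = continuous_L2_time(1)[OF c, where T=T] and c2 = continuous_L2_time(2)[OF c, where T=T]
  have fi: "integrable ?P f" and ci: "integrable ?P c"
    using square_integrable_imp_integrable_finite fin f f2 cm c2 by blast+
  obtain N where N: "\<And>n. n \<ge> N \<Longrightarrow> (LINT t|?P. (steklov (h n) c t - c t)\<^sup>2) < e / 12"
    using order_tendstoD(2)[OF steklov_continuous_L2[OF c h, of T], of "e/12"] 1
    by (auto simp: eventually_sequentially)
  show ?case
  proof (intro exI allI impI)
    fix n assume n: "N \<le> n"
    have sm: "steklov (h n) f \<in> borel_measurable ?P" "steklov (h n) c \<in> borel_measurable ?P"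
      by (rule steklov_measurable; use h(1)[of n] in auto)+
    note s2 = steklov_contraction(1)[OF f f2 h(1)[of n]] steklov_contraction(1)[OF cm c2 h(1)[of n]]
    have 1: "(LINT t|?P. (steklov (h n) f t - steklov (h n) c t)\<^sup>2) \<le> (LINT t|?P. (f t - c t)\<^sup>2)"
    proof -
      have "(LINT t|?P. (steklov (h n) f t - steklov (h n) c t)\<^sup>2) = (LINT t|?P. (steklov (h n) (\<lambda>s. f s - c s) t)\<^sup>2)"
        by (intro Bochner_Integration.integral_cong) (use steklov_diff[OF fi ci _ h(1)[of n]] in auto)
      also have "\<dots> \<le> (LINT t|?P. (f t - c t)\<^sup>2)"
        by (rule steklov_contraction(2)) (use h(1) L2_diff[OF f f2 cm c2] in auto)
      finally show ?thesis .
    qed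
    have "(LINT t|?P. (steklov (h n) f t - f t)\<^sup>2) \<le> 2 * (LINT t|?P. (steklov (h n) f t - steklov (h n) c t)\<^sup>2)
        + 2 * (LINT t|?P. (steklov (h n) c t - f t)\<^sup>2)"
      by (rule square_diff_triangle_integral) (use sm s2 f f2 in auto)
    also have "(LINT t|?P. (steklov (h n) c t - f t)\<^sup>2) \<le> 2 * (LINT t|?P. (steklov (h n) c t - c t)\<^sup>2)
        + 2 * (LINT t|?P. (c t - f t)\<^sup>2)"
      by (rule square_diff_triangle_integral) (use sm s2 f f2 cm c2 in auto)
    also have "(LINT t|?P. (c t - f t)\<^sup>2) = (LINT t|?P. (f t - c t)\<^sup>2)"
      by (simp add: power2_commute)
    finally have "(LINT t|?P. (steklov (h n) f t - f t)\<^sup>2) < e" using 1 N[OF n] fc \<open>0 < e\<close> by simp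
    moreover have "0 \<le> (LINT t|?P. (steklov (h n) f t - f t)\<^sup>2)" by simp
    ultimately show "norm ((LINT t|?P. (steklov (h n) f t - f t)\<^sup>2) - 0) < e" by simp
  qed
qed

section \<open>The chain rule along primitives of square-integrable functions\<close>

lemma square_integral_abs_le:
  fixes g :: "real \<Rightarrow> real"
  assumes "g \<in> borel_measurable (lebesgue_on {0..T})" "integrable (lebesgue_on {0..T}) (\<lambda>x. (g x)\<^sup>2)" "0 \<le> T"
  shows "(LINT t|lebesgue_on {0..T}. \<bar>g t\<bar>)\<^sup>2 \<le> T * (LINT t|lebesgue_on {0..T}. (g t)\<^sup>2)"
proof -
  have "measure (lebesgue_on {0..T}) {0..T} = T"
    using assms by (simp add: measure_restrict_space)
  then show ?thesis
    using square_integral_le[of "lebesgue_on {0..T}" "\<lambda>t. \<bar>g t\<bar>"] assms by simp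
qed

lemma chain_rule_continuous:
  fixes \<psi> \<Psi> :: "real \<Rightarrow> real"
  assumes \<psi>: "continuous_on UNIV \<psi>" and \<Psi>: "\<And>x. (\<Psi> has_real_derivative \<psi> x) (at x)"
    and c: "continuous_on UNIV c" and T: "0 \<le> T"
  shows "(LINT t|lebesgue_on {0..T}. \<psi> (a + primitive c t) * c t) = \<Psi> (a + primitive c T) - \<Psi> a"
proof -
  have D: "((\<lambda>t. \<Psi> (a + primitive c t)) has_real_derivative \<psi> (a + primitive c t) * c t) (at t within {0..T})"
    if "t \<in> {0..T}" for t
  proof -
    have "((\<lambda>t. a + primitive c t) has_real_derivative c t) (at t within {0..T})"
      using primitive_continuous_deriv[OF c, of t T] that by (auto intro!: derivative_eq_intros)
    then show ?thesis by (rule DERIV_chain2[OF \<Psi>])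
  qed
  have cp: "continuous_on {0..T} (\<lambda>t. a + primitive c t)"
    using primitive_continuous_deriv[OF c] by (intro continuous_intros DERIV_continuous_on[where D=c]) auto
  have "continuous_on {0..T} (\<lambda>t. \<psi> (a + primitive c t) * c t)"
    by (intro continuous_on_mult continuous_on_compose2[OF \<psi> cp] continuous_on_subset[OF c]) auto
  then have "integrable (lebesgue_on {0..T}) (\<lambda>t. \<psi> (a + primitive c t) * c t)"
    by (rule continuous_imp_integrable_real)
  then have "(LINT t|lebesgue_on {0..T}. \<psi> (a + primitive c t) * c t) = integral {0..T} (\<lambda>t. \<psi> (a + primitive c t) * c t)"
    by (rule lebesgue_integral_eq_integral) simp
  also have "\<dots> = \<Psi> (a + primitive c T) - \<Psi> (a + primitive c 0)"
    by (rule integral_unique, rule fundamental_theorem_of_calculus)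
      (use T D in \<open>auto simp flip: has_real_derivative_iff_has_vector_derivative\<close>)
  finally show ?thesis by (simp add: primitive_nonpos)
qed

lemma L2_approx_sequence:
  fixes f :: "real \<Rightarrow> real"
  assumes f[measurable]: "f \<in> borel_measurable (lebesgue_on {0..T})"
    and f2: "integrable (lebesgue_on {0..T}) (\<lambda>t. (f t)\<^sup>2)"
  obtains c :: "nat \<Rightarrow> real \<Rightarrow> real" where "\<And>n. continuous_on UNIV (c n)"
    "(\<lambda>n. LINT t|lebesgue_on {0..T}. (f t - c n t)\<^sup>2) \<longlonglongrightarrow> 0"
proof -
  have "\<exists>c. \<forall>n. continuous_on UNIV (c n) \<and> (LINT t|lebesgue_on {0..T}. (f t - c n t)\<^sup>2) < 1 / real (Suc n)"
    by (rule choice) (intro allI continuous_dense_L2 f f2, simp)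
  then obtain c where c: "\<And>n. continuous_on UNIV (c n)"
    "\<And>n. (LINT t|lebesgue_on {0..T}. (f t - c n t)\<^sup>2) < 1 / real (Suc n)" by blast
  have "(\<lambda>n. LINT t|lebesgue_on {0..T}. (f t - c n t)\<^sup>2) \<longlonglongrightarrow> 0"
    by (rule tendsto_sandwich[OF _ _ tendsto_const LIMSEQ_inverse_real_of_nat])
      (use c(2) in \<open>auto intro!: always_eventually less_imp_le simp: inverse_eq_divide\<close>)
  with c that show ?thesis by blast
qed

lemma tendsto_zero_abs_square:
  fixes X :: "nat \<Rightarrow> real"
  assumes "(\<lambda>n. (X n)\<^sup>2) \<longlonglongrightarrow> 0" shows "X \<longlonglongrightarrow> 0"
  using tendsto_real_sqrt[OF assms] by (simp add: tendsto_rabs_zero_iff)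

text \<open>For a continuous integrand this is the fundamental theorem of calculus.  When continuous functions approximate \<open>f\<close> in
mean square, their primitives converge uniformly, so both sides pass to the limit.\<close>

lemma chain_rule_primitive:
  fixes \<psi> \<Psi> f :: "real \<Rightarrow> real"
  assumes \<psi>: "continuous_on UNIV \<psi>" and \<Psi>: "\<And>x. (\<Psi> has_real_derivative \<psi> x) (at x)"
    and f[measurable]: "f \<in> borel_measurable (lebesgue_on {0..T})"
    and f2: "integrable (lebesgue_on {0..T}) (\<lambda>t. (f t)\<^sup>2)" and T: "0 \<le> T"
  shows "(LINT t|lebesgue_on {0..T}. \<psi> (a + primitive f t) * f t) = \<Psi> (a + primitive f T) - \<Psi> a"
proof -
  let ?P = "lebesgue_on {0..T}"
  interpret finite_measure ?P by simp
  obtain c where c: "\<And>n. continuous_on UNIV (c n)"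
    and lim: "(\<lambda>n. LINT t|?P. (f t - c n t)\<^sup>2) \<longlonglongrightarrow> 0" using L2_approx_sequence[OF f f2] by blast
  note cm = continuous_L2_time(1)[OF c, where T=T] and c2 = continuous_L2_time(2)[OF c, where T=T]
  note [measurable] = cm
  have fi: "integrable ?P f" by (rule square_integrable_imp_integrable_finite) (use f2 in auto)
  have ci: "integrable ?P (c n)" for n by (rule square_integrable_imp_integrable_finite) (use c2 in auto)
  define \<delta> where "\<delta> n = (LINT t|?P. \<bar>f t - c n t\<bar>)" for n
  have \<delta>0: "0 \<le> \<delta> n" for n by (simp add: \<delta>_def)
  have \<delta>: "\<delta> \<longlonglongrightarrow> 0"
  proof (rule tendsto_zero_abs_square)
    have "(\<lambda>n. T * (LINT t|?P. (f t - c n t)\<^sup>2)) \<longlonglongrightarrow> T * 0" by (intro tendsto_intros lim)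
    then have "(\<lambda>n. T * (LINT t|?P. (f t - c n t)\<^sup>2)) \<longlonglongrightarrow> 0" by simp
    then show "(\<lambda>n. (\<delta> n)\<^sup>2) \<longlonglongrightarrow> 0"
    proof (rule tendsto_sandwich[OF _ _ tendsto_const, rotated 2])
      show "\<forall>\<^sub>F n in sequentially. (\<delta> n)\<^sup>2 \<le> T * (LINT t|?P. (f t - c n t)\<^sup>2)"
        unfolding \<delta>_def using T L2_diff[OF f f2 cm c2] by (intro always_eventually allI square_integral_abs_le) auto
    qed auto
  qed
  define U where "U t = a + primitive f t" for t
  define V where "V n t = a + primitive (c n) t" for n t
  have UV: "\<bar>V n t - U t\<bar> \<le> \<delta> n" if "t \<le> T" for n t
    using primitive_abs_diff_le[OF fi ci that, of n] by (simp add: U_def V_def \<delta>_def abs_minus_commute)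
  define B where "B = \<bar>a\<bar> + (LINT t|?P. \<bar>f t\<bar>)"
  have UB: "\<bar>U t\<bar> \<le> B" if "t \<le> T" for t
    using primitive_abs_diff_le[OF fi, of "\<lambda>_. 0" t] that by (simp add: U_def B_def primitive_def)
  have meas: "(\<lambda>t. \<psi> (a + primitive g t)) \<in> borel_measurable ?P" if "g \<in> borel_measurable ?P" for g
    using primitive_measurable[OF that, of 0] borel_measurable_continuous_onI[OF \<psi>] by simp
  have Um[measurable]: "(\<lambda>t. \<psi> (U t)) \<in> borel_measurable ?P" "\<And>n. (\<lambda>t. \<psi> (V n t)) \<in> borel_measurable ?P"
    unfolding U_def V_def by (rule meas, measurable)+
  have cpt: "compact {-(B+1)..B+1}" by simp
  have uc: "uniformly_continuous_on {-(B+1)..B+1} \<psi>"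
    by (rule compact_uniformly_continuous[OF continuous_on_subset[OF \<psi>] cpt]) simp
  obtain K where K: "\<And>x. x \<in> {-(B+1)..B+1} \<Longrightarrow> \<bar>\<psi> x\<bar> \<le> K" using continuous_bounded_on_time[OF \<psi>] by blast
  have ev1: "\<forall>\<^sub>F n in sequentially. \<delta> n < 1" using order_tendstoD(2)[OF \<delta>, of 1] by simp
  have Ur: "U t \<in> {-(B+1)..B+1}" if "t \<le> T" for t using UB[OF that] by (auto simp: abs_le_iff)
  have Vr: "V n t \<in> {-(B+1)..B+1}" if "t \<le> T" "\<delta> n < 1" for n t
    using UB[OF that(1)] UV[OF that(1), of n] that(2) by (auto simp: abs_le_iff)
  have iU: "integrable ?P (\<lambda>t. \<psi> (U t) * f t)"
    by (rule Bochner_Integration.integrable_bound[of _ "\<lambda>t. K * f t"])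
      (use fi K[OF Ur] in \<open>auto intro!: AE_I2 mult_right_mono simp: abs_mult intro: order_trans[OF _ abs_ge_self]\<close>)
  have K0: "0 \<le> K" using K[OF Ur[of T]] by linarith
  have "(\<lambda>n. LINT t|?P. \<psi> (V n t) * c n t) \<longlonglongrightarrow> (LINT t|?P. \<psi> (U t) * f t)"
  proof (rule LIMSEQ_I)
    fix e :: real assume e: "0 < e"
    define A where "A = (LINT t|?P. \<bar>f t\<bar>) + 1"
    have A: "0 < A" unfolding A_def by (simp add: add_nonneg_pos)
    obtain d where d: "0 < d" "\<And>x y. \<lbrakk>x \<in> {-(B+1)..B+1}; y \<in> {-(B+1)..B+1}; \<bar>x - y\<bar> < d\<rbrakk> \<Longrightarrow> \<bar>\<psi> x - \<psi> y\<bar> < e / (2 * A)"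
      using uc e A unfolding uniformly_continuous_on_def dist_real_def
      by (metis divide_pos_pos mult_pos_pos zero_less_numeral)
    have "\<forall>\<^sub>F n in sequentially. \<delta> n < d" "\<forall>\<^sub>F n in sequentially. \<delta> n < e / (2 * (K + 1))"
      using order_tendstoD(2)[OF \<delta>, of d] order_tendstoD(2)[OF \<delta>, of "e / (2 * (K+1))"] d e K0 by auto
    with ev1 have "\<forall>\<^sub>F n in sequentially. \<delta> n < 1 \<and> \<delta> n < d \<and> \<delta> n < e / (2 * (K + 1))"
      by eventually_elim auto
    then obtain N where N: "\<And>n. N \<le> n \<Longrightarrow> \<delta> n < 1 \<and> \<delta> n < d \<and> \<delta> n < e / (2 * (K + 1))"
      unfolding eventually_sequentially by blast
    show "\<exists>N. \<forall>n\<ge>N. norm ((LINT t|?P. \<psi> (V n t) * c n t) - (LINT t|?P. \<psi> (U t) * f t)) < e"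
    proof (intro exI allI impI)
      fix n assume "N \<le> n"
      then have n: "\<delta> n < 1" "\<delta> n < d" "\<delta> n < e / (2 * (K + 1))" using N by auto
      have iV: "integrable ?P (\<lambda>t. \<psi> (V n t) * c n t)"
        by (rule Bochner_Integration.integrable_bound[of _ "\<lambda>t. K * c n t"])
          (use ci K[OF Vr] n in \<open>auto intro!: AE_I2 mult_right_mono simp: abs_mult intro: order_trans[OF _ abs_ge_self]\<close>)
      have fc: "integrable ?P (\<lambda>t. \<bar>f t - c n t\<bar>)" using fi ci by auto
      have "\<bar>(LINT t|?P. \<psi> (V n t) * c n t) - (LINT t|?P. \<psi> (U t) * f t)\<bar>
          = \<bar>LINT t|?P. \<psi> (V n t) * c n t - \<psi> (U t) * f t\<bar>" using iU iV by simp
      also have "\<dots> \<le> (LINT t|?P. \<bar>\<psi> (V n t) * c n t - \<psi> (U t) * f t\<bar>)" by (rule integral_abs_bound)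
      also have "\<dots> \<le> (LINT t|?P. K * \<bar>f t - c n t\<bar> + e / (2 * A) * \<bar>f t\<bar>)"
      proof (rule integral_mono)
        fix t assume "t \<in> space ?P"
        then have t: "t \<le> T" by simp
        have "\<psi> (V n t) * c n t - \<psi> (U t) * f t = \<psi> (V n t) * (c n t - f t) + (\<psi> (V n t) - \<psi> (U t)) * f t"
          by (simp add: algebra_simps)
        also have "\<bar>\<dots>\<bar> \<le> \<bar>\<psi> (V n t)\<bar> * \<bar>c n t - f t\<bar> + \<bar>\<psi> (V n t) - \<psi> (U t)\<bar> * \<bar>f t\<bar>"
          by (metis abs_mult abs_triangle_ineq)
        also have "\<dots> \<le> K * \<bar>c n t - f t\<bar> + e / (2 * A) * \<bar>f t\<bar>"
        proof (intro add_mono mult_right_mono)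
          show "\<bar>\<psi> (V n t)\<bar> \<le> K" using K Vr t n by blast
          have "\<bar>V n t - U t\<bar> < d" using UV[OF t, of n] n by linarith
          then show "\<bar>\<psi> (V n t) - \<psi> (U t)\<bar> \<le> e / (2 * A)" using d(2) Vr[OF t n(1)] Ur[OF t] by (meson less_imp_le)
        qed auto
        finally show "\<bar>\<psi> (V n t) * c n t - \<psi> (U t) * f t\<bar> \<le> K * \<bar>f t - c n t\<bar> + e / (2 * A) * \<bar>f t\<bar>"
          by (simp add: abs_minus_commute)
      qed (use iU iV fc fi in auto)
      also have "\<dots> = K * \<delta> n + e / (2 * A) * (LINT t|?P. \<bar>f t\<bar>)"
        using fc fi by (simp add: \<delta>_def)
      also have "\<dots> < e / 2 + e / 2"
      proof (rule add_le_less_mono)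
        have "K * \<delta> n \<le> (K + 1) * \<delta> n" using \<delta>0[of n] by (simp add: algebra_simps)
        also have "\<dots> \<le> (K + 1) * (e / (2 * (K + 1)))" using n K0 by (intro mult_left_mono) auto
        also have "\<dots> = e / 2" using K0 by (simp add: field_simps)
        finally show "K * \<delta> n \<le> e / 2" .
        have "e / (2 * A) * (LINT t|?P. \<bar>f t\<bar>) < e / (2 * A) * A" using e A by (intro mult_strict_left_mono) (auto simp: A_def)
        then show "e / (2 * A) * (LINT t|?P. \<bar>f t\<bar>) < e / 2" using A by simp
      qed
      finally show "norm ((LINT t|?P. \<psi> (V n t) * c n t) - (LINT t|?P. \<psi> (U t) * f t)) < e" by simp
    qed
  qed
  moreover have "(\<lambda>n. LINT t|?P. \<psi> (V n t) * c n t) \<longlonglongrightarrow> \<Psi> (U T) - \<Psi> a"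
  proof -
    have "(\<lambda>n. V n T - U T) \<longlonglongrightarrow> 0"
      by (rule Lim_null_comparison[OF _ \<delta>]) (use UV in \<open>auto intro!: always_eventually\<close>)
    then have "(\<lambda>n. V n T) \<longlonglongrightarrow> U T" by (simp add: LIM_zero_iff)
    then have "(\<lambda>n. \<Psi> (V n T)) \<longlonglongrightarrow> \<Psi> (U T)" by (rule isCont_tendsto_compose[OF DERIV_isCont[OF \<Psi>]])
    then have "(\<lambda>n. \<Psi> (V n T) - \<Psi> a) \<longlonglongrightarrow> \<Psi> (U T) - \<Psi> a" by (intro tendsto_intros)
    then show ?thesis unfolding V_def using chain_rule_continuous[OF \<psi> \<Psi> c T, of a] by simp
  qed
  ultimately show ?thesis using LIMSEQ_unique unfolding U_def by blast
qed

section \<open>From difference inequalities to the dissipation inequality\<close>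

text \<open>Young's inequality; the free parameter \<open>a\<close> balances the two terms when they are of different size.\<close>

lemma integral_product_abs_le:
  fixes f g :: "'a \<Rightarrow> real"
  assumes "f \<in> borel_measurable M" "integrable M (\<lambda>x. (f x)\<^sup>2)"
    "g \<in> borel_measurable M" "integrable M (\<lambda>x. (g x)\<^sup>2)" "0 < a"
  shows "\<bar>\<integral>x. f x * g x \<partial>M\<bar> \<le> a / 2 * (\<integral>x. (f x)\<^sup>2 \<partial>M) + 1 / (2 * a) * (\<integral>x. (g x)\<^sup>2 \<partial>M)"
proof -
  have "\<bar>\<integral>x. f x * g x \<partial>M\<bar> \<le> (\<integral>x. \<bar>f x * g x\<bar> \<partial>M)" by (rule integral_abs_bound)
  also have "\<dots> \<le> (\<integral>x. a / 2 * (f x)\<^sup>2 + 1 / (2 * a) * (g x)\<^sup>2 \<partial>M)"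
  proof (rule integral_mono)
    fix x
    have "0 \<le> (a * \<bar>f x\<bar> - \<bar>g x\<bar>)\<^sup>2" by simp
    then have "2 * a * (\<bar>f x\<bar> * \<bar>g x\<bar>) \<le> a\<^sup>2 * (f x)\<^sup>2 + (g x)\<^sup>2"
      by (simp add: power2_diff power_mult_distrib algebra_simps)
    then have "\<bar>f x * g x\<bar> \<le> (a\<^sup>2 * (f x)\<^sup>2 + (g x)\<^sup>2) / (2 * a)"
      using assms(5) by (simp add: abs_mult pos_le_divide_eq mult.commute)
    also have "\<dots> = a / 2 * (f x)\<^sup>2 + 1 / (2 * a) * (g x)\<^sup>2"
      using assms(5) by (simp add: field_simps power2_eq_square)
    finally show "\<bar>f x * g x\<bar> \<le> a / 2 * (f x)\<^sup>2 + 1 / (2 * a) * (g x)\<^sup>2" .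
  qed (use assms L2_mult[OF assms(1-4)] in auto)
  also have "\<dots> = a / 2 * (\<integral>x. (f x)\<^sup>2 \<partial>M) + 1 / (2 * a) * (\<integral>x. (g x)\<^sup>2 \<partial>M)"
    using assms by simp
  finally show ?thesis .
qed

lemma steklov_weak_tendsto:
  fixes f w :: "real \<Rightarrow> real" and h :: "nat \<Rightarrow> real"
  assumes f: "f \<in> borel_measurable (lebesgue_on {0..T})" "integrable (lebesgue_on {0..T}) (\<lambda>t. (f t)\<^sup>2)"
    and w: "w \<in> borel_measurable (lebesgue_on {0..T})" "integrable (lebesgue_on {0..T}) (\<lambda>t. (w t)\<^sup>2)"
    and h: "\<And>n. 0 < h n" "h \<longlonglongrightarrow> 0"
  shows "(\<lambda>n. LINT t|lebesgue_on {0..T}. w t * steklov (h n) f t) \<longlonglongrightarrow> (LINT t|lebesgue_on {0..T}. w t * f t)"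
proof -
  let ?P = "lebesgue_on {0..T}"
  have sm: "steklov (h n) f \<in> borel_measurable ?P" for n
    by (rule steklov_measurable[OF f(1)]) (use h(1)[of n] in simp)
  have s2: "integrable ?P (\<lambda>t. (steklov (h n) f t)\<^sup>2)" for n by (rule steklov_contraction(1)[OF f h(1)])
  define W where "W = (LINT t|?P. (w t)\<^sup>2)"
  have W0: "0 \<le> W" by (simp add: W_def)
  have "(\<lambda>n. (LINT t|?P. w t * steklov (h n) f t) - (LINT t|?P. w t * f t)) \<longlonglongrightarrow> 0"
  proof (rule LIMSEQ_I)
    fix e :: real assume e: "0 < e"
    define a where "a = e / (W + 1)"
    have a: "0 < a" using e W0 by (simp add: a_def)
    have aW: "a / 2 * W \<le> e / 2" using e W0 by (simp add: a_def field_simps)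
    obtain N where N: "\<And>n. n \<ge> N \<Longrightarrow> (LINT t|?P. (steklov (h n) f t - f t)\<^sup>2) < e * a"
      using order_tendstoD(2)[OF steklov_tendsto_L2[OF f h], of "e * a"] e a
      by (auto simp: eventually_sequentially)
    show "\<exists>N. \<forall>n\<ge>N. norm ((LINT t|?P. w t * steklov (h n) f t) - (LINT t|?P. w t * f t) - 0) < e"
    proof (intro exI allI impI)
      fix n assume n: "N \<le> n"
      have "(LINT t|?P. w t * steklov (h n) f t) - (LINT t|?P. w t * f t) = (LINT t|?P. w t * (steklov (h n) f t - f t))"
        using L2_mult[OF w sm s2] L2_mult[OF w f] by (simp add: right_diff_distrib)
      also have "\<bar>\<dots>\<bar> \<le> a / 2 * W + 1 / (2 * a) * (LINT t|?P. (steklov (h n) f t - f t)\<^sup>2)"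
        unfolding W_def by (intro integral_product_abs_le w a borel_measurable_diff L2_diff sm s2 f)
      also have "1 / (2 * a) * (LINT t|?P. (steklov (h n) f t - f t)\<^sup>2) < 1 / (2 * a) * (e * a)"
        using a N[OF n] by (intro mult_strict_left_mono) auto
      also have "1 / (2 * a) * (e * a) = e / 2" using a by simp
      finally show "norm ((LINT t|?P. w t * steklov (h n) f t) - (LINT t|?P. w t * f t) - 0) < e" using aW by simp
    qed
  qed
  then show ?thesis by (simp add: LIM_zero_iff)
qed

text \<open>The integral telescopes: what remains is the contribution of \<open>D0\<close> on \<open>{0..h}\<close> minus the integral of \<open>D\<close> over the last
interval of length \<open>h\<close>, and the latter is nonnegative.\<close>

lemma shifted_difference_integral:
  fixes D :: "real \<Rightarrow> real"
  assumes D: "integrable (lebesgue_on {0..T}) D" "\<And>t. 0 \<le> D t" and h: "0 < h" "h \<le> T" and D0: "0 \<le> D0"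
  shows "integrable (lebesgue_on {0..T}) (\<lambda>t. if t < h then D0 else D (t - h))"
    and "(LINT t|lebesgue_on {0..T}. (if t < h then D0 else D (t - h)) - D t) \<le> h * D0"
proof -
  let ?P = "lebesgue_on {0..T}"
  let ?f = "\<lambda>t. if t < h then D0 else D (t - h)"
  have DI: "(D has_integral integral\<^sup>L ?P D) {0..T}"
    by (rule has_integral_integral_lebesgue_on[OF D(1)]) simp
  then have Don: "D integrable_on {0..T-h}"
    by (rule integrable_on_subinterval[OF has_integral_integrable]) (use h in auto)
  then obtain I where I: "(D has_integral I) (cbox 0 (T-h))" unfolding integrable_on_def by auto
  have "I \<le> integral\<^sup>L ?P D"
    by (rule has_integral_subset_le[OF _ I[unfolded cbox_interval] DI]) (use D(2) h in auto)
  have "((\<lambda>t. D (t - h)) has_integral I) {h..T}"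
    using has_integral_affinity'[OF I, of 1 "-h"] by simp
  then have 2: "(?f has_integral I) {h..T}"
    by (rule has_integral_eq[rotated]) auto
  have "((\<lambda>t. D0) has_integral h * D0) {0..h}" using has_integral_const_real[of D0 0 h] h by simp
  then have 1: "(?f has_integral h * D0) {0..h}"
    by (rule has_integral_spike[of "{h}", rotated 2]) auto
  have f: "(?f has_integral h * D0 + I) {0..T}"
    by (rule has_integral_combine[OF _ _ 1 2]) (use h in auto)
  then have "?f absolutely_integrable_on {0..T}"
    by (intro nonnegative_absolutely_integrable_1) (use D0 D(2) in auto)
  then show int: "integrable ?P ?f" by (rule absolutely_integrable_imp_integrable) simp
  have "integral\<^sup>L ?P ?f = h * D0 + I"
    using has_integral_unique[OF f has_integral_integral_lebesgue_on[OF int]] by simp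
  then have "(LINT t|?P. ?f t - D t) = h * D0 + I - integral\<^sup>L ?P D" using int D by simp
  with \<open>I \<le> _\<close> show "(LINT t|?P. ?f t - D t) \<le> h * D0" by simp
qed

lemma sigma_finite_time: "sigma_finite_measure (lebesgue_on {a..b::real})"
  using finite_measure.axioms(1)[OF finite_measure_time] .

lemma primitive_pair_measurable:
  fixes v :: "real \<Rightarrow> 'a \<Rightarrow> real"
  assumes v[measurable]: "case_prod v \<in> borel_measurable (lebesgue_on {0..T} \<Otimes>\<^sub>M N)" and h: "0 \<le> h"
  shows "(\<lambda>(t, x). primitive (\<lambda>s. v s x) (t - h)) \<in> borel_measurable (lebesgue_on {0..T} \<Otimes>\<^sub>M N)"
proof -
  let ?P = "lebesgue_on {0..T}"
  interpret sigma_finite_measure ?P by (rule sigma_finite_time)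
  have [measurable]: "(\<lambda>q. fst (fst q)) \<in> borel_measurable ((?P \<Otimes>\<^sub>M N) \<Otimes>\<^sub>M ?P)"
    by (rule measurable_compose[OF measurable_fst borel_measurable_fst_lebesgue_on])
  note [measurable] = borel_measurable_snd_lebesgue_on[where S="{0..T}" and N="?P \<Otimes>\<^sub>M N"]
  have [measurable]: "(\<lambda>q. v (snd q) (snd (fst q))) \<in> borel_measurable ((?P \<Otimes>\<^sub>M N) \<Otimes>\<^sub>M ?P)"
  proof -
    have "(\<lambda>q. (snd q, snd (fst q))) \<in> measurable ((?P \<Otimes>\<^sub>M N) \<Otimes>\<^sub>M ?P) (?P \<Otimes>\<^sub>M N)"
      by (intro measurable_Pair measurable_snd measurable_compose[OF measurable_fst])
    from measurable_compose[OF this v] show ?thesis by simp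
  qed
  have "(\<lambda>q. (if snd q \<le> fst (fst q) - h then 1 else 0) * v (snd q) (snd (fst q))) \<in> borel_measurable ((?P \<Otimes>\<^sub>M N) \<Otimes>\<^sub>M ?P)"
    by measurable
  then have "(\<lambda>p. LINT s|?P. (if s \<le> fst p - h then 1 else 0) * v s (snd p)) \<in> borel_measurable (?P \<Otimes>\<^sub>M N)"
    by (intro borel_measurable_lebesgue_integral) (simp add: case_prod_unfold)
  then show ?thesis
    by (rule measurable_cong[THEN iffD1, rotated])
      (use h in \<open>auto simp: space_pair_measure primitive_eq[of _ T] indicator_def of_bool_def\<close>)
qed

text \<open>Here \<open>D\<close> stands for the Dirichlet energy along a curve with time derivative \<open>v\<close>, and \<open>D0\<close> for its value at time \<open>0\<close>.
Integrated in time and divided by \<open>h\<close>, the hypothesis bounds the integral of \<open>w\<close> against the Steklov averages of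
\<open>v\<close> by \<open>D0\<close>.  At each point \<open>x\<close> these integrals converge, and the contraction property
provides a dominating function of \<open>x\<close> that does not depend on \<open>h\<close>.\<close>

lemma energy_inequality_limit:
  fixes v w :: "real \<Rightarrow> 'a \<Rightarrow> real" and D :: "real \<Rightarrow> real"
  assumes N: "finite_measure N" and T: "0 < T"
    and v[measurable]: "case_prod v \<in> borel_measurable (lebesgue_on {0..T} \<Otimes>\<^sub>M N)"
    and v2: "integrable (lebesgue_on {0..T} \<Otimes>\<^sub>M N) (\<lambda>(t,x). (v t x)\<^sup>2)"
    and w[measurable]: "case_prod w \<in> borel_measurable (lebesgue_on {0..T} \<Otimes>\<^sub>M N)"
    and w2: "integrable (lebesgue_on {0..T} \<Otimes>\<^sub>M N) (\<lambda>(t,x). (w t x)\<^sup>2)"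
    and D: "integrable (lebesgue_on {0..T}) D" "\<And>t. 0 \<le> D t" and D0: "0 \<le> D0"
    and ineq: "\<And>h. 0 < h \<Longrightarrow> h \<le> T \<Longrightarrow> AE t in lebesgue_on {0..T}.
        (\<integral>x. w t x * (primitive (\<lambda>s. v s x) t - primitive (\<lambda>s. v s x) (t - h)) \<partial>N)
          \<le> (if t < h then D0 else D (t - h)) - D t"
  shows "(\<integral>x. (LINT t|lebesgue_on {0..T}. w t x * v t x) \<partial>N) \<le> D0"
proof -
  let ?P = "lebesgue_on {0..T}"
  interpret N: finite_measure N by fact
  interpret P: sigma_finite_measure ?P by (rule sigma_finite_time)
  interpret PN: pair_sigma_finite ?P N ..
  have vs: "(\<lambda>t. v t x) \<in> borel_measurable ?P" and ws: "(\<lambda>t. w t x) \<in> borel_measurable ?P" if "x \<in> space N" for x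
    using measurable_compose[OF measurable_Pair2'[OF that] v] measurable_compose[OF measurable_Pair2'[OF that] w] by auto
  have AEv: "AE x in N. integrable ?P (\<lambda>t. (v t x)\<^sup>2)" and AEw: "AE x in N. integrable ?P (\<lambda>t. (w t x)\<^sup>2)"
    using PN.AE_integrable_snd[of "\<lambda>t x. (v t x)\<^sup>2"] v2 PN.AE_integrable_snd[of "\<lambda>t x. (w t x)\<^sup>2"] w2 by auto
  have iv: "integrable N (\<lambda>x. LINT t|?P. (v t x)\<^sup>2)" and iw: "integrable N (\<lambda>x. LINT t|?P. (w t x)\<^sup>2)"
    using PN.integrable_snd[of "\<lambda>t x. (v t x)\<^sup>2"] v2 PN.integrable_snd[of "\<lambda>t x. (w t x)\<^sup>2"] w2 by auto
  define S where "S h t x = steklov h (\<lambda>s. v s x) t" for h t x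
  have Sm: "case_prod (S h) \<in> borel_measurable (?P \<Otimes>\<^sub>M N)" if "0 < h" for h
    using primitive_pair_measurable[OF v, of h] primitive_pair_measurable[OF v, of 0] that
    unfolding S_def steklov_def case_prod_unfold by simp
  have S2: "integrable (?P \<Otimes>\<^sub>M N) (\<lambda>(t,x). (S h t x)\<^sup>2)" if h: "0 < h" for h
  proof (rule integrableI_nonneg)
    have m: "(\<lambda>(t,x). (S h t x)\<^sup>2) \<in> borel_measurable (?P \<Otimes>\<^sub>M N)"
      using Sm[OF h] unfolding case_prod_unfold by simp
    then show "(\<lambda>(t,x). (S h t x)\<^sup>2) \<in> borel_measurable (?P \<Otimes>\<^sub>M N)" .
    have "(\<integral>\<^sup>+p. ennreal (case p of (t,x) \<Rightarrow> (S h t x)\<^sup>2) \<partial>(?P \<Otimes>\<^sub>M N)) = (\<integral>\<^sup>+x. \<integral>\<^sup>+t. ennreal ((S h t x)\<^sup>2) \<partial>?P \<partial>N)"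
      by (subst PN.nn_integral_snd[symmetric]) (use m in \<open>auto simp: case_prod_unfold\<close>)
    also have "\<dots> \<le> (\<integral>\<^sup>+x. ennreal (LINT t|?P. (v t x)\<^sup>2) \<partial>N)"
    proof (rule nn_integral_mono_AE)
      show "AE x in N. (\<integral>\<^sup>+t. ennreal ((S h t x)\<^sup>2) \<partial>?P) \<le> ennreal (LINT t|?P. (v t x)\<^sup>2)"
        using AEv AE_space
      proof eventually_elim
        case (elim x)
        note c = steklov_contraction[OF vs[OF elim(2)] elim(1) h]
        show ?case unfolding S_def using c by (subst nn_integral_eq_integral) (auto intro: ennreal_leI)
      qed
    qed
    also have "\<dots> < \<infinity>" using iv by (subst nn_integral_eq_integral) auto
    finally show "(\<integral>\<^sup>+p. ennreal (case p of (t,x) \<Rightarrow> (S h t x)\<^sup>2) \<partial>(?P \<Otimes>\<^sub>M N)) < \<infinity>" .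
  qed auto
  have wS: "integrable (?P \<Otimes>\<^sub>M N) (\<lambda>(t,x). w t x * S h t x)" if h: "0 < h" for h
    using L2_mult[of "case_prod w" "?P \<Otimes>\<^sub>M N" "case_prod (S h)"] w w2 Sm[OF h] S2[OF h]
    by (simp add: case_prod_unfold)
  have step: "(\<integral>x. (LINT t|?P. w t x * S h t x) \<partial>N) \<le> D0" if h: "0 < h" "h \<le> T" for h
  proof -
    have "h * (\<integral>x. (LINT t|?P. w t x * S h t x) \<partial>N) = h * (LINT t|?P. (\<integral>x. w t x * S h t x \<partial>N))"
      using PN.Fubini_integral[OF wS[OF h(1)]] by simp
    also have "\<dots> = (LINT t|?P. h * (\<integral>x. w t x * S h t x \<partial>N))" by simp
    also have "\<dots> \<le> (LINT t|?P. (if t < h then D0 else D (t - h)) - D t)"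
    proof (rule integral_mono_AE)
      show "integrable ?P (\<lambda>t. h * (\<integral>x. w t x * S h t x \<partial>N))"
        using PN.integrable_fst[OF wS[OF h(1)]] by simp
      show "integrable ?P (\<lambda>t. (if t < h then D0 else D (t - h)) - D t)"
        using shifted_difference_integral(1)[OF D h D0] D(1) by simp
      have "h * (\<integral>x. w t x * S h t x \<partial>N) = (\<integral>x. w t x * (primitive (\<lambda>s. v s x) t - primitive (\<lambda>s. v s x) (t - h)) \<partial>N)" for t
        using h by (subst integral_mult_right_zero[symmetric]) (simp add: S_def steklov_def)
      then show "AE t in ?P. h * (\<integral>x. w t x * S h t x \<partial>N) \<le> (if t < h then D0 else D (t - h)) - D t"
        using ineq[OF h] by simp
    qed
    also have "\<dots> \<le> h * D0" by (rule shifted_difference_integral(2)[OF D h D0])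
    finally show ?thesis using h by simp
  qed
  define h where "h n = T / real (Suc n)" for n
  have h: "0 < h n" "h n \<le> T" for n
    using T mult_left_mono[of 1 "real (Suc n)" T] by (auto simp: h_def divide_le_eq)
  have h0: "h \<longlonglongrightarrow> 0"
    using tendsto_mult_right_zero[OF LIMSEQ_inverse_real_of_nat, of T] unfolding h_def divide_inverse .
  have "(\<lambda>n. \<integral>x. (LINT t|?P. w t x * S (h n) t x) \<partial>N) \<longlonglongrightarrow> (\<integral>x. (LINT t|?P. w t x * v t x) \<partial>N)"
  proof (rule integral_dominated_convergence[where w="\<lambda>x. 1/2 * (LINT t|?P. (w t x)\<^sup>2) + 1/2 * (LINT t|?P. (v t x)\<^sup>2)"])
    show "(\<lambda>x. LINT t|?P. w t x * v t x) \<in> borel_measurable N"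
      using L2_mult[of "case_prod w" "?P \<Otimes>\<^sub>M N" "case_prod v"] w w2 v v2
      by (intro borel_measurable_integrable PN.integrable_snd[of "\<lambda>t x. w t x * v t x"]) (simp add: case_prod_unfold)
    show "(\<lambda>x. LINT t|?P. w t x * S (h n) t x) \<in> borel_measurable N" for n
      by (intro borel_measurable_integrable PN.integrable_snd[OF wS] h)
    show "integrable N (\<lambda>x. 1/2 * (LINT t|?P. (w t x)\<^sup>2) + 1/2 * (LINT t|?P. (v t x)\<^sup>2))"
      using iv iw by simp
    show "AE x in N. (\<lambda>n. LINT t|?P. w t x * S (h n) t x) \<longlonglongrightarrow> (LINT t|?P. w t x * v t x)"
      using AEv AEw AE_space
    proof eventually_elim
      case (elim x)
      show ?case unfolding S_def
        by (rule steklov_weak_tendsto[OF vs[OF elim(3)] elim(1) ws[OF elim(3)] elim(2) h(1) h0])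
    qed
    show "AE x in N. norm (LINT t|?P. w t x * S (h n) t x) \<le> 1/2 * (LINT t|?P. (w t x)\<^sup>2) + 1/2 * (LINT t|?P. (v t x)\<^sup>2)" for n
      using AEv AEw AE_space
    proof eventually_elim
      case (elim x)
      have sm: "steklov (h n) (\<lambda>s. v s x) \<in> borel_measurable ?P"
        by (rule steklov_measurable[OF vs[OF elim(3)]]) (use h(1)[of n] in simp)
      note c = steklov_contraction[OF vs[OF elim(3)] elim(1) h(1)]
      show ?case unfolding S_def
        using integral_product_abs_le[OF ws[OF elim(3)] elim(2) sm c(1), of 1] c(2)[of n] by simp
    qed
  qed
  then show ?thesis by (rule LIMSEQ_le_const2) (use step h in blast)
qed

section \<open>Integrals of divergences and sets of finite perimeter\<close>

lemma lborel_integral_shift: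
  fixes g :: "'a::euclidean_space \<Rightarrow> real"
  assumes [measurable]: "g \<in> borel_measurable borel"
  shows "(\<integral>x. g (x + c) \<partial>lborel) = (\<integral>x. g x \<partial>lborel)"
proof -
  have "(\<integral>x. g x \<partial>lborel) = (\<integral>x. g x \<partial>distr lborel borel ((+) c))" by (simp add: lborel_distr_plus)
  also have "\<dots> = (\<integral>x. g (c + x) \<partial>lborel)" by (rule integral_distr) auto
  finally show ?thesis by (simp add: add.commute)
qed

lemma lborel_integrable_compact_support:
  fixes f :: "'a::euclidean_space \<Rightarrow> real"
  assumes "f \<in> borel_measurable borel" "\<And>x. \<bar>f x\<bar> \<le> B" "\<And>x. x \<notin> cball 0 R \<Longrightarrow> f x = 0"
  shows "integrable lborel f"
proof (rule Bochner_Integration.integrable_bound[of _ "\<lambda>x. B * indicator (cball 0 R) x"])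
  show "integrable lborel (\<lambda>x. B * indicator (cball 0 R) x)"
    by (intro integrable_mult_right integrable_real_indicator) (auto intro!: emeasure_compact_finite[unfolded infinity_ennreal_def])
  have "0 \<le> B" using assms(2)[of 0] by linarith
  then show "AE x in lborel. norm (f x) \<le> norm (B * indicator (cball 0 R) x)"
    using assms(2,3) by (intro AE_I2) (auto simp: indicator_def)
qed (use assms in auto)

text \<open>The integral over \<open>A\<close> of the derivative of \<open>f\<close> in the direction \<open>e\<close> is the limit of integrals of difference quotients.  Moving the translation
from \<open>f\<close> to \<open>A\<close> leaves only the symmetric difference of \<open>A\<close> and its translate, whose measure is of
order \<open>h\<close>.  This replaces the divergence theorem on \<open>A\<close>.\<close>

lemma integral_directional_derivative_le:
  fixes f p :: "'a::euclidean_space \<Rightarrow> real"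
  assumes f: "continuous_on UNIV f" "\<And>x. \<bar>f x\<bar> \<le> 1" "\<And>x. x \<notin> cball 0 R \<Longrightarrow> f x = 0"
    and p: "continuous_on UNIV p" "\<And>x. \<bar>p x\<bar> \<le> B"
    and D: "\<And>x s. ((\<lambda>s. f (x + s *\<^sub>R e)) has_real_derivative p (x + s *\<^sub>R e)) (at s)"
    and A: "A \<in> sets borel"
    and Ai: "\<And>h. 0 < h \<Longrightarrow> h \<le> 1 \<Longrightarrow> integrable lborel (\<lambda>x. \<bar>indicator A (x - h *\<^sub>R e) - indicator A x\<bar> :: real)"
    and AC: "\<And>h. 0 < h \<Longrightarrow> h \<le> 1 \<Longrightarrow> (\<integral>x. \<bar>indicator A (x - h *\<^sub>R e) - indicator A x\<bar> \<partial>lborel) \<le> C * h"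
  shows "\<bar>\<integral>x. indicator A x * p x \<partial>lborel\<bar> \<le> C"
proof -
  have [measurable]: "f \<in> borel_measurable borel" "p \<in> borel_measurable borel"
    using f p by (auto intro: borel_measurable_continuous_onI)
  note [measurable] = A
  have B0: "0 \<le> B" using p(2)[of 0] by linarith
  have lip: "\<bar>f (x + h *\<^sub>R e) - f x\<bar> \<le> B * h" if "0 < h" for x h
  proof -
    have "\<exists>z>0. z < h \<and> f (x + h *\<^sub>R e) - f (x + 0 *\<^sub>R e) = (h - 0) * p (x + z *\<^sub>R e)"
      by (rule MVT2[OF that]) (use D in auto)
    then obtain z where "f (x + h *\<^sub>R e) - f x = h * p (x + z *\<^sub>R e)" by auto
    then show ?thesis using p(2)[of "x + z *\<^sub>R e"] that by (simp add: abs_mult mult.commute mult_left_mono)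
  qed
  define h where "h n = 1 / real (Suc n)" for n
  have h: "0 < h n" "h n \<le> 1" for n by (auto simp: h_def)
  have h0: "h \<longlonglongrightarrow> 0" using LIMSEQ_inverse_real_of_nat unfolding h_def by (simp add: inverse_eq_divide)
  have hat: "filterlim h (at 0) sequentially"
    unfolding filterlim_at using h0 h(1) by (auto simp: less_imp_neq[symmetric] intro!: always_eventually)
  let ?R = "R + norm e"
  let ?q = "\<lambda>n x. indicator A x * ((f (x + h n *\<^sub>R e) - f x) / h n)"
  have supp: "f (x + s *\<^sub>R e) = 0" "f x = 0" if "x \<notin> cball 0 ?R" "0 \<le> s" "s \<le> 1" for x s
  proof -
    have "norm x \<le> norm (x + s *\<^sub>R e) + norm (s *\<^sub>R e)" by (metis add_diff_cancel norm_triangle_ineq4)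
    also have "norm (s *\<^sub>R e) \<le> norm e" using that by (simp add: mult_left_le_one_le)
    finally have "R < norm (x + s *\<^sub>R e)" using that by simp
    then show "f (x + s *\<^sub>R e) = 0" using f(3) by simp
    have "R < norm x" using that by (simp add: not_le) (use norm_ge_zero[of e] in linarith)
    then show "f x = 0" using f(3) by simp
  qed
  have lim: "(\<lambda>n. \<integral>x. ?q n x \<partial>lborel) \<longlonglongrightarrow> (\<integral>x. indicator A x * p x \<partial>lborel)"
  proof (rule integral_dominated_convergence[where w="\<lambda>x. B * indicator (cball 0 ?R) x"])
    show "integrable lborel (\<lambda>x. B * indicator (cball 0 ?R) x)"
      by (intro integrable_mult_right integrable_real_indicator) (auto intro!: emeasure_compact_finite[unfolded infinity_ennreal_def])
    show "AE x in lborel. norm (?q n x) \<le> B * indicator (cball 0 ?R) x" for n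
    proof (rule AE_I2)
      fix x
      show "norm (?q n x) \<le> B * indicator (cball 0 ?R) x"
      proof (cases "x \<in> cball 0 ?R")
        case True
        have "\<bar>(f (x + h n *\<^sub>R e) - f x) / h n\<bar> \<le> B"
          using lip[OF h(1), of x n] h(1)[of n] by (simp add: abs_divide divide_le_eq)
        then show ?thesis using True B0 by (auto simp: indicator_def)
      next
        case False
        then show ?thesis using supp[OF False, of "h n"] h(1)[of n] h(2)[of n] B0 by simp
      qed
    qed
    show "AE x in lborel. (\<lambda>n. ?q n x) \<longlonglongrightarrow> indicator A x * p x"
    proof (rule AE_I2)
      fix x
      have "((\<lambda>k. (f (x + k *\<^sub>R e) - f x) / k) \<longlongrightarrow> p x) (at 0)"
        using D[of x 0] unfolding has_field_derivative_iff by simp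
      then have "(\<lambda>n. (f (x + h n *\<^sub>R e) - f x) / h n) \<longlonglongrightarrow> p x" by (rule filterlim_compose[OF _ hat])
      then show "(\<lambda>n. ?q n x) \<longlonglongrightarrow> indicator A x * p x" by (intro tendsto_intros)
    qed
  qed auto
  have "\<bar>\<integral>x. ?q n x \<partial>lborel\<bar> \<le> C" for n
  proof -
    let ?h = "h n"
    have i1: "integrable lborel (\<lambda>x. indicator A x * f (x + ?h *\<^sub>R e))"
      using f(2) supp h(1)[of n] h(2)[of n]
      by (intro lborel_integrable_compact_support[where B=1 and R="?R"]) (auto simp: indicator_def)
    have i2: "integrable lborel (\<lambda>x. indicator A x * f x)"
      using f(2,3) by (intro lborel_integrable_compact_support[where B=1 and R="R"]) (auto simp: indicator_def)
    have i3: "integrable lborel (\<lambda>x. indicator A (x - ?h *\<^sub>R e) * f x)"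
      using f(2,3) by (intro lborel_integrable_compact_support[where B=1 and R="R"]) (auto simp: indicator_def)
    have "?h * (\<integral>x. ?q n x \<partial>lborel) = (\<integral>x. ?h * ?q n x \<partial>lborel)" by simp
    also have "\<dots> = (\<integral>x. indicator A x * f (x + ?h *\<^sub>R e) - indicator A x * f x \<partial>lborel)"
      using h(1)[of n] by (intro Bochner_Integration.integral_cong) (simp_all add: field_simps)
    also have "\<dots> = (\<integral>x. indicator A x * f (x + ?h *\<^sub>R e) \<partial>lborel) - (\<integral>x. indicator A x * f x \<partial>lborel)"
      using i1 i2 by simp
    also have "(\<integral>x. indicator A x * f (x + ?h *\<^sub>R e) \<partial>lborel) = (\<integral>x. indicator A (x - ?h *\<^sub>R e) * f x \<partial>lborel)"
      using lborel_integral_shift[of "\<lambda>x. indicator A (x - ?h *\<^sub>R e) * f x" "?h *\<^sub>R e"] by simp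
    also have "\<dots> - (\<integral>x. indicator A x * f x \<partial>lborel) = (\<integral>x. (indicator A (x - ?h *\<^sub>R e) - indicator A x) * f x \<partial>lborel)"
      using i2 i3 by (simp add: left_diff_distrib)
    also have "\<bar>\<dots>\<bar> \<le> (\<integral>x. \<bar>indicator A (x - ?h *\<^sub>R e) - indicator A x\<bar> \<partial>lborel)"
    proof (rule order_trans[OF integral_abs_bound integral_mono])
      show "integrable lborel (\<lambda>x. \<bar>(indicator A (x - ?h *\<^sub>R e) - indicator A x) * f x\<bar>)"
        using i2 i3 by (simp add: left_diff_distrib)
      show "\<bar>(indicator A (x - ?h *\<^sub>R e) - indicator A x) * f x\<bar> \<le> \<bar>indicator A (x - ?h *\<^sub>R e) - indicator A x\<bar>" for x
        using f(2)[of x] by (auto simp: abs_mult indicator_def)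
    qed (rule Ai[OF h])
    also have "\<dots> \<le> C * ?h" by (rule AC[OF h])
    finally have "?h * \<bar>\<integral>x. ?q n x \<partial>lborel\<bar> \<le> C * ?h" using h(1)[of n] by (simp add: abs_mult)
    then show ?thesis using h(1)[of n] by (simp add: mult.commute divide_le_eq)
  qed
  then show ?thesis using LIMSEQ_le_const2[OF tendsto_rabs[OF lim]] by blast
qed

lemma C1_compact_field_jacobian:
  assumes "C1_compact_field \<Omega> \<phi>"
  shows "\<And>x. (\<phi> has_derivative (\<lambda>h. jacobian \<phi> (at x) *v h)) (at x)"
    "\<And>i. continuous_on UNIV (\<lambda>x. jacobian \<phi> (at x) $ i $ i)"
    "continuous_on UNIV \<phi>"
    "\<exists>R. \<forall>x. x \<notin> cball 0 R \<longrightarrow> \<phi> x = 0"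
    "\<exists>K. compact K \<and> K \<subseteq> \<Omega> \<and> (\<forall>x. x \<notin> K \<longrightarrow> \<phi> x = 0 \<and> jacobian \<phi> (at x) = 0)"
proof -
  from assms obtain K where d: "\<phi> differentiable_on UNIV" and c: "continuous_on UNIV (\<lambda>x. jacobian \<phi> (at x))"
    and K: "compact K" "K \<subseteq> \<Omega>" "\<And>x. x \<notin> K \<Longrightarrow> \<phi> x = 0" unfolding C1_compact_field_def by blast
  show D: "(\<phi> has_derivative (\<lambda>h. jacobian \<phi> (at x) *v h)) (at x)" for x
    using d unfolding differentiable_on_def jacobian_works[symmetric] by auto
  show "continuous_on UNIV (\<lambda>x. jacobian \<phi> (at x) $ i $ i)" for i using c by (intro continuous_intros) auto
  show "continuous_on UNIV \<phi>" using d by (rule differentiable_imp_continuous_on)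
  obtain R where "K \<subseteq> cball 0 R" using bounded_subset_ballD[OF compact_imp_bounded[OF K(1)], of 0] ball_subset_cball by blast
  then show "\<exists>R. \<forall>x. x \<notin> cball 0 R \<longrightarrow> \<phi> x = 0" using K(3) by blast
  have "jacobian \<phi> (at x) = 0" if "x \<notin> K" for x
  proof -
    have "open (-K)" using K(1) by (simp add: compact_imp_closed open_Compl)
    then have "(\<phi> has_derivative (\<lambda>h. 0)) (at x)"
      using that K(3) by (intro has_derivative_transform_within_open[OF has_derivative_const, of "-K" x 0]) auto
    then have "frechet_derivative \<phi> (at x) = (\<lambda>h. 0)" by (rule frechet_derivative_at[symmetric])
    then show ?thesis unfolding jacobian_def by (simp add: matrix_def vec_eq_iff)
  qed
  then show "\<exists>K. compact K \<and> K \<subseteq> \<Omega> \<and> (\<forall>x. x \<notin> K \<longrightarrow> \<phi> x = 0 \<and> jacobian \<phi> (at x) = 0)"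
    using K by blast
qed

text \<open>The integral is the measure of the symmetric difference of \<open>A\<close> and its translate along a coordinate axis.  In terms of
indicator functions the property passes to unions by a pointwise inequality.  It is what bounds the perimeter of \<open>A\<close>.\<close>

definition shift_bound :: "real \<Rightarrow> (real ^ 'n) set \<Rightarrow> bool" where
  "shift_bound C A \<longleftrightarrow> A \<in> sets borel \<and> (\<forall>i h. 0 < h \<longrightarrow> h \<le> 1 \<longrightarrow>
     integrable lborel (\<lambda>x. \<bar>indicator A (x - h *\<^sub>R axis i 1) - indicator A x\<bar> :: real) \<and>
     (\<integral>x. \<bar>indicator A (x - h *\<^sub>R axis i 1) - indicator A x\<bar> \<partial>lborel) \<le> C * h)"

lemma integral_divergence_le:
  fixes \<phi> :: "real ^ 'n \<Rightarrow> real ^ 'n"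
  assumes \<phi>: "C1_compact_field \<Omega> \<phi>" "\<And>x. norm (\<phi> x) \<le> 1" and A: "shift_bound C A"
  shows "integrable lebesgue (\<lambda>x. indicator A x * divergence \<phi> x)"
    "\<bar>\<integral>x. indicator A x * divergence \<phi> x \<partial>lebesgue\<bar> \<le> real CARD('n) * C"
proof -
  note J = C1_compact_field_jacobian[OF \<phi>(1)]
  have [measurable]: "A \<in> sets borel" using A by (simp add: shift_bound_def)
  obtain K where K: "compact K" "\<And>x. x \<notin> K \<Longrightarrow> \<phi> x = 0 \<and> jacobian \<phi> (at x) = 0" using J(5) by blast
  obtain R where R: "K \<subseteq> cball 0 R"
    using bounded_subset_ballD[OF compact_imp_bounded[OF K(1)], of 0] ball_subset_cball by blast
  have "\<exists>B. \<forall>x. \<bar>jacobian \<phi> (at x) $ i $ i\<bar> \<le> B" for i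
  proof -
    have "bounded ((\<lambda>x. jacobian \<phi> (at x) $ i $ i) ` K)"
      by (intro compact_imp_bounded compact_continuous_image continuous_on_subset[OF J(2)] K) auto
    then obtain B where "0 < B" "\<forall>y\<in>(\<lambda>x. jacobian \<phi> (at x) $ i $ i) ` K. norm y \<le> B" unfolding bounded_pos by blast
    then have "\<bar>jacobian \<phi> (at x) $ i $ i\<bar> \<le> B" for x using K(2)[of x] by (cases "x \<in> K") auto
    then show ?thesis by blast
  qed
  then obtain B where B: "\<And>i x. \<bar>jacobian \<phi> (at x) $ i $ i\<bar> \<le> B i" by metis
  have Jm[measurable]: "(\<lambda>x. jacobian \<phi> (at x) $ i $ i) \<in> borel_measurable borel" for i
    using J(2) by (rule borel_measurable_continuous_onI)
  have one: "\<bar>\<integral>x. indicator A x * jacobian \<phi> (at x) $ i $ i \<partial>lborel\<bar> \<le> C" for i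
  proof (rule integral_directional_derivative_le[where f="\<lambda>x. \<phi> x $ i" and e="axis i 1" and B="B i" and R=R])
    show "continuous_on UNIV (\<lambda>x. \<phi> x $ i)" using J(3) by (intro continuous_intros)
    show "\<bar>\<phi> x $ i\<bar> \<le> 1" for x using component_le_norm_cart[of "\<phi> x" i] \<phi>(2)[of x] by linarith
    show "\<phi> x $ i = 0" if "x \<notin> cball 0 R" for x
      using K(2)[OF contra_subsetD[OF R that]] by simp
    show "((\<lambda>s. \<phi> (x + s *\<^sub>R axis i 1) $ i) has_real_derivative jacobian \<phi> (at (x + s *\<^sub>R axis i 1)) $ i $ i) (at s)" for x s
    proof -
      have 1: "((\<lambda>s. x + s *\<^sub>R axis i 1) has_derivative (\<lambda>k. k *\<^sub>R axis i 1)) (at s)"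
        by (auto intro!: derivative_eq_intros)
      have "((\<lambda>s. \<phi> (x + s *\<^sub>R axis i 1)) has_derivative
         (\<lambda>k. jacobian \<phi> (at (x + s *\<^sub>R axis i 1)) *v (k *\<^sub>R axis i 1))) (at s)"
        using has_derivative_compose[OF 1 J(1)] .
      then have "((\<lambda>s. \<phi> (x + s *\<^sub>R axis i 1) $ i) has_derivative
         (\<lambda>k. (jacobian \<phi> (at (x + s *\<^sub>R axis i 1)) *v (k *\<^sub>R axis i 1)) $ i)) (at s)"
        by (rule bounded_linear.has_derivative[OF bounded_linear_vec_nth])
      moreover have "(\<lambda>k. (jacobian \<phi> (at (x + s *\<^sub>R axis i 1)) *v (k *\<^sub>R axis i 1)) $ i)
          = (*) (jacobian \<phi> (at (x + s *\<^sub>R axis i 1)) $ i $ i)"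
        by (rule ext) (simp add: matrix_vector_mult_scaleR matrix_vector_mult_basis column_def)
      ultimately show ?thesis unfolding has_field_derivative_def by simp
    qed
  qed (use A B J(2) in \<open>auto simp: shift_bound_def\<close>)
  have ii: "integrable lborel (\<lambda>x. indicator A x * jacobian \<phi> (at x) $ i $ i)" for i
  proof (rule lborel_integrable_compact_support[of _ "B i" R])
    have "0 \<le> B i" using B[of 0 i] by linarith
    then show "\<bar>indicator A x * jacobian \<phi> (at x) $ i $ i\<bar> \<le> B i" for x
      using B[of x i] by (auto simp: indicator_def)
    show "indicator A x * jacobian \<phi> (at x) $ i $ i = 0" if "x \<notin> cball 0 R" for x
      using K(2)[OF contra_subsetD[OF R that]] by simp
  qed measurable
  have eq: "(\<lambda>x. indicator A x * divergence \<phi> x) = (\<lambda>x. \<Sum>i\<in>UNIV. indicator A x * jacobian \<phi> (at x) $ i $ i)"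
    by (simp add: divergence_def trace_def sum_distrib_left)
  have m: "(\<lambda>x. indicator A x * divergence \<phi> x) \<in> borel_measurable borel" unfolding eq by measurable
  have i: "integrable lborel (\<lambda>x. indicator A x * divergence \<phi> x)"
    unfolding eq by (intro Bochner_Integration.integrable_sum ii)
  then show "integrable lebesgue (\<lambda>x. indicator A x * divergence \<phi> x)" using m by (simp add: integrable_completion)
  have "(\<integral>x. indicator A x * divergence \<phi> x \<partial>lebesgue) = (\<integral>x. indicator A x * divergence \<phi> x \<partial>lborel)"
    using m by (simp add: integral_completion)
  also have "\<dots> = (\<Sum>i\<in>UNIV. \<integral>x. indicator A x * jacobian \<phi> (at x) $ i $ i \<partial>lborel)"
    unfolding eq by (intro Bochner_Integration.integral_sum ii)
  also have "\<bar>\<dots>\<bar> \<le> (\<Sum>i\<in>(UNIV::'n set). C)" by (rule order_trans[OF sum_abs sum_mono]) (rule one)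
  finally show "\<bar>\<integral>x. indicator A x * divergence \<phi> x \<partial>lebesgue\<bar> \<le> real CARD('n) * C" by simp
qed

lemma C1_compact_field_scaleR:
  assumes "C1_compact_field \<Omega> \<phi>"
  shows "C1_compact_field \<Omega> (\<lambda>x. c *\<^sub>R \<phi> x)" "divergence (\<lambda>x. c *\<^sub>R \<phi> x) x = c * divergence \<phi> x"
proof -
  note J = C1_compact_field_jacobian[OF assms]
  have j: "jacobian (\<lambda>x. c *\<^sub>R \<phi> x) (at x) = c *\<^sub>R jacobian \<phi> (at x)" for x
  proof -
    have "((\<lambda>x. c *\<^sub>R \<phi> x) has_derivative (\<lambda>h. c *\<^sub>R (jacobian \<phi> (at x) *v h))) (at x)"
      by (rule has_derivative_scaleR_right[OF J(1)])
    then have "frechet_derivative (\<lambda>x. c *\<^sub>R \<phi> x) (at x) = (\<lambda>h. c *\<^sub>R (jacobian \<phi> (at x) *v h))"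
      by (rule frechet_derivative_at[symmetric])
    then show ?thesis unfolding jacobian_def[of "\<lambda>x. c *\<^sub>R \<phi> x"]
      by (simp add: matrix_def vec_eq_iff matrix_vector_mult_basis column_def)
  qed
  show "divergence (\<lambda>x. c *\<^sub>R \<phi> x) x = c * divergence \<phi> x"
    by (simp add: divergence_def j trace_def sum_distrib_left)
  show "C1_compact_field \<Omega> (\<lambda>x. c *\<^sub>R \<phi> x)"
    using assms unfolding C1_compact_field_def j
    by (auto intro!: continuous_intros derivative_intros)
qed

text \<open>The whole space is invariant under translations, so the preceding bound holds with \<open>C = 0\<close>; rescaling removes the
condition that the field be bounded by one.\<close>

lemma integral_divergence_zero:
  fixes \<phi> :: "real ^ 'n \<Rightarrow> real ^ 'n"
  assumes \<phi>: "C1_compact_field \<Omega> \<phi>"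
  shows "integrable lebesgue (divergence \<phi>)" "(\<integral>x. divergence \<phi> x \<partial>lebesgue) = 0"
proof -
  note J = C1_compact_field_jacobian[OF \<phi>]
  obtain K where K: "compact K" "\<And>x. x \<notin> K \<Longrightarrow> \<phi> x = 0" using J(5) by blast
  have "bounded (\<phi> ` K)"
    by (intro compact_imp_bounded compact_continuous_image continuous_on_subset[OF J(3)] K) auto
  then obtain B where B: "0 < B" "\<forall>y\<in>\<phi> ` K. norm y \<le> B" unfolding bounded_pos by blast
  then have Bx: "norm (\<phi> x) \<le> B" for x using K(2)[of x] by (cases "x \<in> K") auto
  let ?\<psi> = "\<lambda>x. (1/B) *\<^sub>R \<phi> x"
  have 1: "norm (?\<psi> x) \<le> 1" for x using Bx[of x] B(1) by (simp add: divide_simps)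
  have sb: "shift_bound 0 (UNIV :: (real^'n) set)" by (simp add: shift_bound_def)
  note r = integral_divergence_le[OF C1_compact_field_scaleR(1)[OF \<phi>] 1 sb]
  from r(1) have "integrable lebesgue (\<lambda>x. 1 / B * divergence \<phi> x)" by (simp add: C1_compact_field_scaleR(2)[OF \<phi>])
  then have "integrable lebesgue (\<lambda>x. B * (1 / B * divergence \<phi> x))" by (rule integrable_mult_right)
  then show "integrable lebesgue (divergence \<phi>)" using B(1) by simp
  from r(2) have "(\<integral>x. 1 / B * divergence \<phi> x \<partial>lebesgue) = 0" by (simp add: C1_compact_field_scaleR(2)[OF \<phi>])
  then show "(\<integral>x. divergence \<phi> x \<partial>lebesgue) = 0" using B(1) by simp
qed

lemma divergence_outside:
  assumes "C1_compact_field \<Omega> \<phi>" "x \<notin> \<Omega>"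
  shows "divergence \<phi> x = 0"
proof -
  have "jacobian \<phi> (at x) = 0" using C1_compact_field_jacobian(5)[OF assms(1)] assms(2) by blast
  then show ?thesis by (simp add: divergence_def trace_def)
qed

lemma integral_divergence_lebesgue_on:
  fixes \<phi> :: "real ^ 'n \<Rightarrow> real ^ 'n"
  assumes "C1_compact_field \<Omega> \<phi>" "\<Omega> \<in> sets lebesgue"
  shows "integrable (lebesgue_on \<Omega>) (divergence \<phi>)" "(\<integral>x. divergence \<phi> x \<partial>lebesgue_on \<Omega>) = 0"
proof -
  have eq: "(\<lambda>x. indicator \<Omega> x *\<^sub>R divergence \<phi> x) = divergence \<phi>"
    using divergence_outside[OF assms(1)] by (intro ext) (auto split: split_indicator)
  have \<Omega>: "\<Omega> \<inter> space lebesgue \<in> sets lebesgue" using assms(2) by simp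
  show "integrable (lebesgue_on \<Omega>) (divergence \<phi>)"
    unfolding integrable_restrict_space[OF \<Omega>] eq by (rule integral_divergence_zero(1)[OF assms(1)])
  show "(\<integral>x. divergence \<phi> x \<partial>lebesgue_on \<Omega>) = 0"
    unfolding integral_restrict_space[OF \<Omega>] eq by (rule integral_divergence_zero(2)[OF assms(1)])
qed

lemma perimeter_finite:
  fixes A \<Omega> :: "(real ^ 'n) set"
  assumes A: "shift_bound C A" and \<Omega>: "\<Omega> \<in> sets lebesgue"
  shows "perimeter (A \<inter> \<Omega>) \<Omega> < \<infinity>"
proof -
  have \<Omega>': "\<Omega> \<inter> space lebesgue \<in> sets lebesgue" using \<Omega> by simp
  have "perimeter (A \<inter> \<Omega>) \<Omega> \<le> ennreal (real CARD('n) * C)"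
    unfolding perimeter_def total_variation_def
  proof (rule SUP_least, clarify, rule ennreal_leI)
    fix \<phi> :: "real^'n \<Rightarrow> real^'n" assume \<phi>: "C1_compact_field \<Omega> \<phi>" "\<forall>x. norm (\<phi> x) \<le> 1"
    have eq: "(\<lambda>x. indicator \<Omega> x *\<^sub>R (indicator (A \<inter> \<Omega>) x * divergence \<phi> x)) = (\<lambda>x. indicator A x * divergence \<phi> x)"
      using divergence_outside[OF \<phi>(1)] by (intro ext) (auto split: split_indicator)
    have "(\<integral>x. indicator (A \<inter> \<Omega>) x * divergence \<phi> x \<partial>lebesgue_on \<Omega>) = (\<integral>x. indicator A x * divergence \<phi> x \<partial>lebesgue)"
      unfolding integral_restrict_space[OF \<Omega>'] eq ..
    also have "\<dots> \<le> real CARD('n) * C" using integral_divergence_le(2)[OF \<phi>(1) _ A] \<phi>(2) by (metis abs_le_D1)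
    finally show "(\<integral>x. indicator (A \<inter> \<Omega>) x * divergence \<phi> x \<partial>lebesgue_on \<Omega>) \<le> real CARD('n) * C" .
  qed
  then show ?thesis by (metis ennreal_less_top infinity_ennreal_def le_less_trans)
qed

text \<open>Moving one face of a box inwards by \<open>h\<close> removes a slab of width at most \<open>h\<close>.\<close>

lemma content_shrink_le:
  fixes a b :: "real ^ 'n"
  assumes h: "0 < h"
  shows "measure lborel (cbox a b) - measure lborel (cbox (a + h *\<^sub>R axis i 1) b) \<le> h * (\<Prod>j\<in>UNIV - {i}. \<bar>b $ j - a $ j\<bar>)"
proof (cases "cbox a b = {}")
  case True
  moreover have "0 \<le> h * (\<Prod>j\<in>UNIV - {i}. \<bar>b $ j - a $ j\<bar>)"
    using h by (intro mult_nonneg_nonneg prod_nonneg) auto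
  moreover have "0 \<le> measure lborel (cbox (a + h *\<^sub>R axis i 1) b)" by simp
  ultimately show ?thesis by (simp only: measure_empty)
next
  case False
  then have ab: "a $ j \<le> b $ j" for j by (simp add: interval_ne_empty_cart)
  let ?Q = "\<Prod>j\<in>UNIV - {i}. \<bar>b $ j - a $ j\<bar>"
  have 1: "measure lborel (cbox a b) = (b $ i - a $ i) * ?Q"
  proof -
    have "measure lborel (cbox a b) = (\<Prod>j\<in>UNIV. b $ j - a $ j)" by (rule content_cbox_cart[OF False])
    also have "\<dots> = (b $ i - a $ i) * (\<Prod>j\<in>UNIV - {i}. b $ j - a $ j)" by (subst prod.remove[of _ i]) auto
    also have "(\<Prod>j\<in>UNIV - {i}. b $ j - a $ j) = ?Q" using ab by (intro prod.cong) auto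
    finally show ?thesis .
  qed
  have Q: "0 \<le> ?Q" by (simp add: prod_nonneg)
  show ?thesis
  proof (cases "a $ i + h \<le> b $ i")
    case True
    have ne: "cbox (a + h *\<^sub>R axis i 1) b \<noteq> {}"
      unfolding interval_ne_empty_cart using True ab by (auto simp: axis_def)
    have "measure lborel (cbox (a + h *\<^sub>R axis i 1) b) = (\<Prod>j\<in>UNIV. b $ j - (a + h *\<^sub>R axis i 1) $ j)"
      by (rule content_cbox_cart[OF ne])
    also have "\<dots> = (b $ i - a $ i - h) * (\<Prod>j\<in>UNIV - {i}. b $ j - (a + h *\<^sub>R axis i 1) $ j)"
      by (subst prod.remove[of _ i]) auto
    also have "(\<Prod>j\<in>UNIV - {i}. b $ j - (a + h *\<^sub>R axis i 1) $ j) = ?Q"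
      using ab by (intro prod.cong) (auto simp: axis_def)
    finally show ?thesis unfolding 1 by (simp add: algebra_simps)
  next
    case False
    then have "(b $ i - a $ i) * ?Q \<le> h * ?Q" using Q by (intro mult_right_mono) auto
    moreover have "0 \<le> measure lborel (cbox (a + h *\<^sub>R axis i 1) b)" by simp
    ultimately show ?thesis unfolding 1 by linarith
  qed
qed

lemma shift_bound_cbox:
  fixes a b :: "real ^ 'n"
  shows "\<exists>C. shift_bound C (cbox a b)"
proof -
  define C where "C = 2 * (\<Sum>i\<in>UNIV. \<Prod>j\<in>UNIV - {i}. \<bar>b $ j - a $ j\<bar>)"
  have "shift_bound C (cbox a b)"
    unfolding shift_bound_def
  proof (intro conjI allI impI)
    fix i :: 'n and h :: real assume h: "0 < h" "h \<le> 1"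
    let ?B = "cbox a b" and ?c = "h *\<^sub>R axis i 1 :: real ^ 'n"
    let ?T = "cbox (a + ?c) (b + ?c)" and ?I = "cbox (a + ?c) b"
    have I: "?B \<inter> ?T = ?I"
      using h by (auto simp: mem_box_cart axis_def split: if_splits) (smt (verit, best))+
    have iT: "indicator ?B (x - ?c) = (indicator ?T x :: real)" for x
      by (auto simp: indicator_def mem_box_cart algebra_simps)
    have "measure lborel ?T = measure lborel ?B"
    proof -
      have "?T = (+) ?c ` ?B" using cbox_translation[of ?c a b] by (simp add: add.commute)
      then have "measure lebesgue ?T = measure lebesgue ?B" by (simp add: measure_translation)
      then show ?thesis by simp
    qed
    moreover have eq: "\<bar>indicator ?B (x - ?c) - indicator ?B x\<bar> = indicator ?B x + indicator ?T x - 2 * (indicator ?I x :: real)" for x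
      unfolding iT I[symmetric] by (auto simp: indicator_def)
    moreover have fin: "integrable lborel (indicator (cbox u v) :: real^'n \<Rightarrow> real)" for u v
      by (intro integrable_real_indicator) (use emeasure_compact_finite[OF compact_cbox, of u v] in auto)
    ultimately have "(\<integral>x. \<bar>indicator ?B (x - ?c) - indicator ?B x\<bar> \<partial>lborel) = 2 * (measure lborel ?B - measure lborel ?I)"
      by (simp add: fin)
    also have "\<dots> \<le> 2 * (h * (\<Prod>j\<in>UNIV - {i}. \<bar>b $ j - a $ j\<bar>))"
      using content_shrink_le[OF h(1), of a b i] by simp
    also have "\<dots> \<le> C * h"
    proof -
      have "(\<Prod>j\<in>UNIV - {i}. \<bar>b $ j - a $ j\<bar>) \<le> (\<Sum>i\<in>UNIV. \<Prod>j\<in>UNIV - {i}. \<bar>b $ j - a $ j\<bar>)"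
        by (rule member_le_sum) (auto intro: prod_nonneg)
      then show ?thesis unfolding C_def using h by (simp add: mult.commute mult_left_mono)
    qed
    finally show "(\<integral>x. \<bar>indicator ?B (x - ?c) - indicator ?B x\<bar> \<partial>lborel) \<le> C * h" .
    show "integrable lborel (\<lambda>x. \<bar>indicator ?B (x - ?c) - indicator ?B x\<bar> :: real)"
      unfolding eq using fin by auto
  qed auto
  then show ?thesis by blast
qed

lemma shift_bound_Un:
  assumes A: "shift_bound C A" and B: "shift_bound D B"
  shows "shift_bound (C + D) (A \<union> B)"
  unfolding shift_bound_def
proof (intro conjI allI impI)
  note [measurable] = A[unfolded shift_bound_def, THEN conjunct1] B[unfolded shift_bound_def, THEN conjunct1]
  show "A \<union> B \<in> sets borel" by measurable
  fix i :: 'a and h :: real assume h: "0 < h" "h \<le> 1"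
  let ?d = "\<lambda>E x. \<bar>indicator E (x - h *\<^sub>R axis i 1) - indicator E x\<bar> :: real"
  have iA: "integrable lborel (?d A)" "(\<integral>x. ?d A x \<partial>lborel) \<le> C * h"
    and iB: "integrable lborel (?d B)" "(\<integral>x. ?d B x \<partial>lborel) \<le> D * h"
    using A B h unfolding shift_bound_def by auto
  have le: "?d (A \<union> B) x \<le> ?d A x + ?d B x" for x by (auto simp: indicator_def)
  show int: "integrable lborel (?d (A \<union> B))"
  proof (rule Bochner_Integration.integrable_bound)
    show "integrable lborel (\<lambda>x. ?d A x + ?d B x)" using iA iB by simp
    show "AE x in lborel. norm (?d (A \<union> B) x) \<le> norm (?d A x + ?d B x)" using le by (intro AE_I2) simp
  qed measurable
  have "(\<integral>x. ?d (A \<union> B) x \<partial>lborel) \<le> (\<integral>x. ?d A x + ?d B x \<partial>lborel)"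
    by (rule integral_mono[OF int _ le]) (use iA iB in simp)
  also have "\<dots> \<le> (C + D) * h" using iA iB by (simp add: algebra_simps)
  finally show "(\<integral>x. ?d (A \<union> B) x \<partial>lborel) \<le> (C + D) * h" .
qed

lemma shift_bound_Union_cbox:
  assumes "finite F" "\<And>K. K \<in> F \<Longrightarrow> \<exists>a b. K = cbox a b"
  shows "\<exists>C. shift_bound C (\<Union>F :: (real ^ 'n) set)"
  using assms
proof (induction F rule: finite_induct)
  case empty
  show ?case by (intro exI[of _ 0]) (simp add: shift_bound_def)
next
  case (insert K F)
  obtain C where C: "shift_bound C (\<Union>F)" using insert by auto
  obtain a b where "K = cbox a b" using insert by blast
  then obtain D where D: "shift_bound D K" using shift_bound_cbox by blast
  show ?case using shift_bound_Un[OF D C] by (intro exI[of _ "D + C"]) simp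
qed

section \<open>Perimeter minimizers have finite limit energy\<close>

lemma approximate_by_finite_boxes:
  fixes S :: "(real ^ 'n) set"
  assumes S: "S \<in> lmeasurable" "bounded S" and e: "0 < e"
  obtains F where "finite F" "\<And>K. K \<in> F \<Longrightarrow> \<exists>a b. K = cbox a b"
    "measure lebesgue ((S - \<Union>F) \<union> (\<Union>F - S)) < e"
proof -
  obtain a b where ab: "S \<subseteq> cbox a b" using bounded_subset_cbox_symmetric[OF S(2)] by blast
  obtain D where D: "countable D" "\<And>K. K \<in> D \<Longrightarrow> K \<subseteq> cbox a b \<and> K \<noteq> {} \<and> (\<exists>c d. K = cbox c d)"
    "S \<subseteq> \<Union>D" "\<Union>D \<in> lmeasurable" "measure lebesgue (\<Union>D) \<le> measure lebesgue S + e/3"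
    using measurable_outer_intervals_bounded[OF S(1) ab, of "e/3"] e by (metis divide_pos_pos zero_less_numeral)
  have Dm: "K \<in> lmeasurable" if "K \<in> D" for K using D(2)[OF that] by auto
  obtain F where F: "finite F" "F \<subseteq> D" "measure lebesgue (\<Union>D) - e/3 < measure lebesgue (\<Union>F)"
  proof (rule measure_countable_Union_approachable[OF D(1), of "e/3" "measure lebesgue (\<Union>D)"])
    show "measure lebesgue (\<Union>F) \<le> measure lebesgue (\<Union>D)" if "F \<subseteq> D" "finite F" for F
      using that Dm D(4) by (intro measure_mono_fmeasurable) (auto intro!: fmeasurableD countable_finite)
  qed (use e Dm that in auto)
  have Fm: "\<Union>F \<in> lmeasurable" using F(1,2) Dm by (auto intro!: fmeasurable.finite_Union)
  have "measure lebesgue ((S - \<Union>F) \<union> (\<Union>F - S)) \<le> measure lebesgue ((\<Union>D - \<Union>F) \<union> (\<Union>D - S))"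
    using S(1) Fm D(3,4) F(2) by (intro measure_mono_fmeasurable) (auto intro!: fmeasurable.Un fmeasurable.Diff)
  also have "\<dots> \<le> measure lebesgue (\<Union>D - \<Union>F) + measure lebesgue (\<Union>D - S)"
    using S(1) Fm D(4) by (intro measure_Un_le) (auto intro!: fmeasurableD)
  also have "measure lebesgue (\<Union>D - \<Union>F) = measure lebesgue (\<Union>D) - measure lebesgue (\<Union>F)"
    using Fm D(4) F(2) by (intro measurable_measure_Diff) (auto intro!: fmeasurableD)
  also have "measure lebesgue (\<Union>D - S) = measure lebesgue (\<Union>D) - measure lebesgue S"
    using S(1) D(3,4) by (intro measurable_measure_Diff) (auto intro!: fmeasurableD)
  finally have "measure lebesgue ((S - \<Union>F) \<union> (\<Union>F - S)) < e" using F(3) D(5) e by simp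
  then show ?thesis using that[of F] F(1,2) D(2) by blast
qed

text \<open>The intermediate value theorem along the cubes centred at the origin: the measure of the part of \<open>X\<close> in a cube depends
continuously on the side length, because the measure of the cube does.\<close>

lemma cut_measure_surjective:
  fixes X :: "(real ^ 'n) set"
  assumes X: "X \<in> lmeasurable" "bounded X" and c: "0 \<le> c" "c \<le> measure lebesgue X"
  obtains a b where "measure lebesgue (X \<inter> cbox a b) = c"
proof -
  define Q where "Q s = (cbox (- s *\<^sub>R 1) (s *\<^sub>R 1) :: (real ^ 'n) set)" for s
  define q where "q s = (2 * s) ^ CARD('n)" for s :: real
  have qQ: "measure lebesgue (Q s) = q s" if "0 \<le> s" for s
  proof -
    have "cbox (- s *\<^sub>R 1) (s *\<^sub>R 1 :: real ^ 'n) \<noteq> {}" unfolding interval_ne_empty_cart using that by simp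
    from content_cbox_cart[OF this] show ?thesis by (simp add: Q_def q_def)
  qed
  have Qm: "Q s \<in> lmeasurable" for s by (simp add: Q_def)
  have mono: "Q s \<subseteq> Q t" if "s \<le> t" for s t
    using that unfolding Q_def by (auto simp: mem_box_cart) (meson order_trans neg_le_iff_le)+
  define g where "g s = measure lebesgue (X \<inter> Q s)" for s
  have XQ: "X \<inter> Q s \<in> lmeasurable" for s using X(1) Qm by (intro fmeasurable.Int)
  have g: "\<bar>g t - g s\<bar> \<le> q t - q s" if "0 \<le> s" "s \<le> t" for s t
  proof -
    have "g s \<le> g t" unfolding g_def using mono[OF that(2)] XQ by (intro measure_mono_fmeasurable) (auto intro!: fmeasurableD)
    have "g t - g s = measure lebesgue (X \<inter> Q t - X \<inter> Q s)"
      unfolding g_def using mono[OF that(2)] XQ by (intro measurable_measure_Diff[symmetric]) (auto intro!: fmeasurableD)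
    also have "\<dots> \<le> measure lebesgue (Q t - Q s)"
      using XQ Qm by (intro measure_mono_fmeasurable) (auto intro!: fmeasurableD sets.Diff fmeasurable.Diff)
    also have "\<dots> = q t - q s"
      using mono[OF that(2)] Qm that by (subst measurable_measure_Diff) (auto intro!: fmeasurableD simp: qQ)
    finally show ?thesis using \<open>g s \<le> g t\<close> by simp
  qed
  obtain R where R: "0 < R" "\<And>x. x \<in> X \<Longrightarrow> norm x \<le> R" using X(2) bounded_pos by metis
  have "X \<subseteq> Q R"
  proof
    fix x assume "x \<in> X"
    then have "\<bar>x $ i\<bar> \<le> R" for i using R(2) component_le_norm_cart order_trans by blast
    then show "x \<in> Q R" by (auto simp: Q_def mem_box_cart abs_le_iff minus_le_iff)
  qed
  then have gR: "g R = measure lebesgue X" by (simp add: g_def Int_absorb2)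
  have "g 0 \<le> measure lebesgue (Q 0)" unfolding g_def using XQ Qm by (intro measure_mono_fmeasurable) (auto intro!: fmeasurableD)
  then have g0: "g 0 = 0" using qQ[of 0] by (simp add: q_def g_def power_0_left measure_le_0_iff)
  have gq: "dist (g t) (g s) \<le> dist (q t) (q s)" if "s \<in> {0..R}" "t \<in> {0..R}" for s t
    using g[of s t] g[of t s] that by (cases "s \<le> t") (auto simp: dist_real_def abs_minus_commute)
  have "continuous_on {0..R} q" unfolding q_def by (intro continuous_intros)
  then have "continuous_on {0..R} g"
    unfolding continuous_on_iff using gq by (meson le_less_trans)
  then obtain s where "0 \<le> s" "g s = c"
    using IVT'[of g 0 c R] c g0 gR R(1) by auto
  then show ?thesis using that unfolding g_def Q_def by blast
qed

lemma measure_symdiff_triangle: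
  assumes "A \<in> lmeasurable" "B \<in> lmeasurable" "C \<in> lmeasurable"
  shows "measure lebesgue ((A - C) \<union> (C - A)) \<le>
    measure lebesgue ((A - B) \<union> (B - A)) + measure lebesgue ((B - C) \<union> (C - B))"
proof -
  have "measure lebesgue ((A - C) \<union> (C - A)) \<le> measure lebesgue (((A - B) \<union> (B - A)) \<union> ((B - C) \<union> (C - B)))"
    using assms by (intro measure_mono_fmeasurable) (auto intro!: fmeasurable.Un fmeasurable.Diff fmeasurableD sets.Un sets.Diff)
  also have "\<dots> \<le> measure lebesgue ((A - B) \<union> (B - A)) + measure lebesgue ((B - C) \<union> (C - B))"
    using assms by (intro measure_Un_le) (auto intro!: fmeasurableD sets.Un sets.Diff)
  finally show ?thesis .
qed

text \<open>A finite union of boxes, cut off at the boundary of \<open>\<Omega>\<close>, approximates \<open>E0\<close> in measure.  If its volume is too large, it is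
intersected with a suitable cube; if too small, a suitable cube is added.  The correction changes
the set by no more than the error in the volume, hence by less than \<open>\<rho> / 2\<close>.\<close>

lemma finite_perimeter_competitor:
  fixes \<Omega> E0 :: "(real ^ 'n) set"
  assumes \<Omega>: "open \<Omega>" "bounded \<Omega>" and E0: "E0 \<in> sets lebesgue" "E0 \<subseteq> \<Omega>" and \<rho>: "0 < \<rho>"
  obtains E where "E \<in> sets borel" "E \<subseteq> \<Omega>" "measure lebesgue E0 = measure lebesgue E"
    "measure lebesgue ((E0 - E) \<union> (E - E0)) < \<rho>" "perimeter E \<Omega> < \<infinity>"
proof -
  let ?m = "measure lebesgue"
  note found = that
  have \<Omega>m: "\<Omega> \<in> lmeasurable" using \<Omega> by (simp add: lmeasurable_open)
  have bE0: "bounded E0" using \<Omega>(2) E0(2) bounded_subset by blast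
  have E0m: "E0 \<in> lmeasurable" by (rule bounded_set_imp_lmeasurable[OF bE0 E0(1)])
  obtain F where F: "finite F" "\<And>K. K \<in> F \<Longrightarrow> \<exists>a b. K = cbox a b"
    and FE: "?m ((E0 - \<Union>F) \<union> (\<Union>F - E0)) < \<rho> / 2"
    using approximate_by_finite_boxes[OF E0m bE0, of "\<rho>/2"] \<rho> by (metis half_gt_zero)
  have Fm: "\<Union>F \<in> lmeasurable" using F by (intro fmeasurable.finite_Union) auto
  define A where "A = \<Union>F \<inter> \<Omega>"
  have Am: "A \<in> lmeasurable" unfolding A_def using Fm \<Omega>m by (intro fmeasurable.Int)
  have sd: "(E0 - A) \<union> (A - E0) \<in> lmeasurable" using Am E0m by (intro fmeasurable.Un fmeasurable.Diff) auto
  have AE: "?m ((E0 - A) \<union> (A - E0)) < \<rho> / 2"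
  proof (rule le_less_trans[OF _ FE], rule measure_mono_fmeasurable)
    show "(E0 - \<Union>F) \<union> (\<Union>F - E0) \<in> lmeasurable" using Fm E0m by (intro fmeasurable.Un fmeasurable.Diff) auto
  qed (use E0(2) sd in \<open>auto simp: A_def intro!: fmeasurableD\<close>)
  have d1: "?m E0 - ?m A < \<rho> / 2" "?m A - ?m E0 < \<rho> / 2"
  proof -
    have "?m E0 \<le> ?m (A \<union> ((E0 - A) \<union> (A - E0)))" "?m A \<le> ?m (E0 \<union> ((E0 - A) \<union> (A - E0)))"
      using sd Am E0m by (intro measure_mono_fmeasurable; auto intro!: fmeasurable.Un fmeasurable.Diff)+
    moreover have "?m (A \<union> ((E0 - A) \<union> (A - E0))) \<le> ?m A + ?m ((E0 - A) \<union> (A - E0))"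
      "?m (E0 \<union> ((E0 - A) \<union> (A - E0))) \<le> ?m E0 + ?m ((E0 - A) \<union> (A - E0))"
      using sd Am E0m by (intro measure_Un_le; auto intro!: fmeasurableD)+
    ultimately show "?m E0 - ?m A < \<rho> / 2" "?m A - ?m E0 < \<rho> / 2" using AE by linarith+
  qed
  have conclude: thesis if G: "finite G" "\<And>K. K \<in> G \<Longrightarrow> \<exists>a b. K = cbox a b" "?m E0 = ?m (\<Union>G \<inter> \<Omega>)"
    "?m ((A - \<Union>G \<inter> \<Omega>) \<union> (\<Union>G \<inter> \<Omega> - A)) < \<rho> / 2" for G
  proof (rule found[of "\<Union>G \<inter> \<Omega>"])
    obtain C where C: "shift_bound C (\<Union>G)" using shift_bound_Union_cbox[OF G(1,2)] by blast
    have Gm: "\<Union>G \<in> lmeasurable" using G(1,2) by (intro fmeasurable.finite_Union) auto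
    show "\<Union>G \<inter> \<Omega> \<in> sets borel" using C \<Omega>(1) by (auto simp: shift_bound_def)
    show "perimeter (\<Union>G \<inter> \<Omega>) \<Omega> < \<infinity>" by (rule perimeter_finite[OF C]) (use \<Omega>m in auto)
    show "?m ((E0 - \<Union>G \<inter> \<Omega>) \<union> (\<Union>G \<inter> \<Omega> - E0)) < \<rho>"
      using measure_symdiff_triangle[OF E0m Am fmeasurable.Int[OF Gm \<Omega>m]] AE G(4) by simp
  qed (use G in auto)
  have bA: "bounded A" "bounded (\<Omega> - A)" using \<Omega>(2) by (auto simp: A_def intro: bounded_subset)
  show thesis
  proof (cases "?m E0 \<le> ?m A")
    case True
    obtain a b where ab: "?m (A \<inter> cbox a b) = ?m E0" using cut_measure_surjective[OF Am bA(1) _ True] by auto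
    let ?G = "(\<lambda>K. K \<inter> cbox a b) ` F"
    have eq: "\<Union>?G \<inter> \<Omega> = A \<inter> cbox a b" by (auto simp: A_def)
    show thesis
    proof (rule conclude[of ?G])
      show "\<exists>c d. K = cbox c d" if K: "K \<in> ?G" for K
      proof -
        obtain L where "L \<in> F" "K = L \<inter> cbox a b" using K by blast
        moreover then obtain c d where "L = cbox c d" using F(2) by blast
        ultimately show ?thesis by (simp add: Int_interval) blast
      qed
      have "(A - \<Union>?G \<inter> \<Omega>) \<union> (\<Union>?G \<inter> \<Omega> - A) = A - A \<inter> cbox a b" unfolding eq by auto
      moreover have "?m (A - A \<inter> cbox a b) = ?m A - ?m (A \<inter> cbox a b)"
        using Am by (intro measurable_measure_Diff) (auto intro!: fmeasurableD fmeasurable.Int)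
      ultimately show "?m ((A - \<Union>?G \<inter> \<Omega>) \<union> (\<Union>?G \<inter> \<Omega> - A)) < \<rho> / 2" using d1 ab by simp
      show "finite ?G" using F(1) by simp
      show "?m E0 = ?m (\<Union>?G \<inter> \<Omega>)" unfolding eq using ab by simp
    qed
  next
    case False
    have X: "\<Omega> - A \<in> lmeasurable" using \<Omega>m Am by (auto intro: fmeasurable.Diff)
    have "?m (\<Omega> - A) = ?m \<Omega> - ?m A" using Am \<Omega>m
      by (intro measurable_measure_Diff) (auto intro!: fmeasurableD simp: A_def)
    moreover have "?m E0 \<le> ?m \<Omega>" using E0 \<Omega>m by (intro measure_mono_fmeasurable) auto
    ultimately obtain a b where ab: "?m ((\<Omega> - A) \<inter> cbox a b) = ?m E0 - ?m A"
      using cut_measure_surjective[OF X bA(2), of "?m E0 - ?m A"] False by auto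
    let ?G = "insert (cbox a b) F" and ?Y = "(\<Omega> - A) \<inter> cbox a b"
    have eq: "\<Union>?G \<inter> \<Omega> = A \<union> ?Y" by (auto simp: A_def)
    have Y: "?Y \<in> lmeasurable" using X by (intro fmeasurable.Int) auto
    show thesis
    proof (rule conclude[of ?G])
      show "\<exists>c d. K = cbox c d" if "K \<in> ?G" for K using that F(2) by blast
      have "(A - \<Union>?G \<inter> \<Omega>) \<union> (\<Union>?G \<inter> \<Omega> - A) = ?Y" unfolding eq by auto
      then show "?m ((A - \<Union>?G \<inter> \<Omega>) \<union> (\<Union>?G \<inter> \<Omega> - A)) < \<rho> / 2" using d1 ab by simp
      have "?m (A \<union> ?Y) = ?m A + ?m ?Y"
      proof -
        have "A \<inter> ?Y = {}" by auto
        then show ?thesis using measure_Un3[OF Am Y] by (simp only: measure_empty)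
      qed
      then show "?m E0 = ?m (\<Union>?G \<inter> \<Omega>)" unfolding eq using ab by simp
    qed (use F(1) in auto)
  qed
qed

text \<open>A competitor of finite perimeter bounds the infimum that defines the minimizer.\<close>

lemma local_perimeter_minimizer_finite:
  fixes \<Omega> E0 :: "(real ^ 'n) set"
  assumes \<Omega>: "open \<Omega>" "bounded \<Omega>" and E0: "local_perimeter_minimizer \<Omega> E0"
  shows "perimeter E0 \<Omega> < \<infinity>"
proof -
  obtain \<rho> where "E0 \<in> sets lebesgue" "E0 \<subseteq> \<Omega>" and \<rho>: "0 < \<rho>" and inf: "perimeter E0 \<Omega> =
        (INF E\<in>{E. E \<in> sets borel \<and> E \<subseteq> \<Omega> \<and> measure lebesgue E0 = measure lebesgue E \<and>
                   measure lebesgue ((E0 - E) \<union> (E - E0)) < \<rho>}. perimeter E \<Omega>)"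
    using E0 unfolding local_perimeter_minimizer_def by blast
  obtain E where E: "E \<in> sets borel" "E \<subseteq> \<Omega>" "measure lebesgue E0 = measure lebesgue E"
    "measure lebesgue ((E0 - E) \<union> (E - E0)) < \<rho>" "perimeter E \<Omega> < \<infinity>"
    using finite_perimeter_competitor[OF \<Omega> \<open>E0 \<in> sets lebesgue\<close> \<open>E0 \<subseteq> \<Omega>\<close> \<rho>] by blast
  have "perimeter E0 \<Omega> \<le> perimeter E \<Omega>"
    unfolding inf by (rule INF_lower) (use E in auto)
  then show ?thesis using E(5) by (rule le_less_trans)
qed

lemma two_phase_eq: "x \<in> \<Omega> \<Longrightarrow> two_phase \<Omega> E0 x = 1 - 2 * indicator E0 x"
  by (auto simp: two_phase_def indicator_def)

text \<open>Inside \<open>\<Omega>\<close> the two-phase function is \<open>1 - 2 * indicator E0\<close>, and constants do not contribute because divergences of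
compactly supported fields integrate to zero.\<close>

lemma total_variation_two_phase_le:
  fixes \<Omega> E0 :: "(real ^ 'n) set"
  assumes \<Omega>: "\<Omega> \<in> sets lebesgue" and E0: "E0 \<in> sets lebesgue" "E0 \<subseteq> \<Omega>"
  shows "total_variation \<Omega> (two_phase \<Omega> E0) \<le> 2 * perimeter E0 \<Omega>"
  unfolding total_variation_def
proof (rule SUP_least, clarify)
  fix \<phi> :: "real^'n \<Rightarrow> real^'n" assume \<phi>: "C1_compact_field \<Omega> \<phi>" "\<forall>x. norm (\<phi> x) \<le> 1"
  let ?L = "lebesgue_on \<Omega>" and ?\<psi> = "\<lambda>x. (-1) *\<^sub>R \<phi> x"
  have [measurable]: "E0 \<in> sets ?L" using \<Omega> E0 by (simp add: sets_restrict_space_iff)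
  note d = integral_divergence_lebesgue_on[OF \<phi>(1) \<Omega>]
  have [measurable]: "divergence \<phi> \<in> borel_measurable ?L" using d(1) by auto
  have i: "integrable ?L (\<lambda>x. indicator E0 x * divergence \<phi> x)"
    by (rule Bochner_Integration.integrable_bound[OF d(1)]) (auto simp: indicator_def intro!: AE_I2)
  have "(\<integral>x. two_phase \<Omega> E0 x * divergence \<phi> x \<partial>?L) = (\<integral>x. divergence \<phi> x - 2 * (indicator E0 x * divergence \<phi> x) \<partial>?L)"
    by (intro Bochner_Integration.integral_cong) (auto simp: two_phase_eq algebra_simps)
  also have "\<dots> = 2 * (\<integral>x. indicator E0 x * divergence ?\<psi> x \<partial>?L)"
    using d i by (simp add: C1_compact_field_scaleR(2)[OF \<phi>(1), of "-1", simplified])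
  finally have "ennreal (\<integral>x. two_phase \<Omega> E0 x * divergence \<phi> x \<partial>?L) = 2 * ennreal (\<integral>x. indicator E0 x * divergence ?\<psi> x \<partial>?L)"
    by (simp add: ennreal_mult')
  also have "\<dots> \<le> 2 * perimeter E0 \<Omega>"
    unfolding perimeter_def total_variation_def
    using C1_compact_field_scaleR(1)[OF \<phi>(1), of "-1"] \<phi>(2) by (intro mult_left_mono SUP_upper) auto
  finally show "ennreal (\<integral>x. two_phase \<Omega> E0 x * divergence \<phi> x \<partial>?L) \<le> 2 * perimeter E0 \<Omega>" .
qed

lemma two_phase_integral:
  fixes \<Omega> E0 :: "(real ^ 'n) set"
  assumes \<Omega>: "\<Omega> \<in> lmeasurable" and E0: "E0 \<in> sets lebesgue" "E0 \<subseteq> \<Omega>"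
  shows "integrable (lebesgue_on \<Omega>) (two_phase \<Omega> E0)"
    "(\<integral>x. two_phase \<Omega> E0 x \<partial>lebesgue_on \<Omega>) = measure lebesgue \<Omega> - 2 * measure lebesgue E0"
proof -
  let ?L = "lebesgue_on \<Omega>"
  interpret finite_measure ?L by (rule finite_measure_lebesgue_on[OF \<Omega>])
  have [measurable]: "E0 \<in> sets ?L" using \<Omega> E0 by (simp add: sets_restrict_space_iff fmeasurableD)
  have i: "integrable ?L (\<lambda>x. 1 - 2 * indicator E0 x :: real)"
    by (intro Bochner_Integration.integrable_diff integrable_mult_right integrable_real_indicator)
      (auto simp: less_top[symmetric])
  have "measure ?L E0 = measure lebesgue E0" using \<Omega> E0 by (simp add: measure_restrict_space fmeasurableD)
  then have "measure ?L (E0 \<inter> \<Omega>) = measure lebesgue E0" using E0(2) by (simp add: Int_absorb2)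
  moreover have "measure ?L \<Omega> = measure lebesgue \<Omega>" using \<Omega> by (simp add: measure_restrict_space fmeasurableD)
  ultimately have "(\<integral>x. 1 - 2 * indicator E0 x \<partial>?L) = measure lebesgue \<Omega> - 2 * measure lebesgue E0"
    by (simp add: integrable_real_indicator less_top[symmetric])
  moreover have "(\<integral>x. two_phase \<Omega> E0 x \<partial>?L) = (\<integral>x. 1 - 2 * indicator E0 x \<partial>?L)"
    by (rule Bochner_Integration.integral_cong) (auto simp: two_phase_eq)
  ultimately show "(\<integral>x. two_phase \<Omega> E0 x \<partial>?L) = measure lebesgue \<Omega> - 2 * measure lebesgue E0" by simp
  have "integrable ?L (two_phase \<Omega> E0) = integrable ?L (\<lambda>x. 1 - 2 * indicator E0 x :: real)"
    by (rule Bochner_Integration.integrable_cong) (auto simp: two_phase_eq)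
  with i show "integrable ?L (two_phase \<Omega> E0)" by simp
qed

lemma limit_energy_two_phase_finite:
  fixes \<Omega> E0 :: "(real ^ 'n) set"
  assumes \<Omega>: "\<Omega> \<in> lmeasurable" and E0: "E0 \<in> sets lebesgue" "E0 \<subseteq> \<Omega>" and P: "perimeter E0 \<Omega> < \<infinity>"
    and m: "m = measure lebesgue \<Omega> - 2 * measure lebesgue E0"
  shows "limit_energy \<Omega> W m (two_phase \<Omega> E0) < \<infinity>"
proof -
  have "total_variation \<Omega> (two_phase \<Omega> E0) \<le> 2 * perimeter E0 \<Omega>"
    by (rule total_variation_two_phase_le) (use \<Omega> E0 in auto)
  also have "\<dots> < \<infinity>" using P by (simp add: ennreal_mult_less_top)
  finally have "two_phase \<Omega> E0 \<in> BV_pm1 \<Omega>"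
    unfolding BV_pm1_def using two_phase_integral(1)[OF \<Omega> E0]
    by (auto intro!: AE_I2 simp: two_phase_def indicator_def)
  moreover have "{x \<in> \<Omega>. two_phase \<Omega> E0 x = -1} = E0"
    using E0(2) by (auto simp: two_phase_def indicator_def split: if_splits)
  ultimately show ?thesis
    unfolding limit_energy_def using two_phase_integral(2)[OF \<Omega> E0] m P by (simp add: ennreal_mult_less_top)
qed

section \<open>Functions with a weak gradient\<close>

lemma H1_with_gradient_const:
  fixes \<Omega> :: "(real ^ 'n) set"
  assumes "\<Omega> \<in> lmeasurable"
  shows "H1_with_gradient \<Omega> (\<lambda>_. 1) (\<lambda>_. 0)"
proof -
  interpret finite_measure "lebesgue_on \<Omega>" by (rule finite_measure_lebesgue_on[OF assms])
  show ?thesis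
    unfolding H1_with_gradient_def L2_fun_def using integral_divergence_lebesgue_on(2) assms by auto
qed

text \<open>Linearity is immediate once the pairings with a test field are known to be integrable, which holds since
the field and its divergence are bounded.\<close>

lemma H1_with_gradient_diff:
  fixes \<Omega> :: "(real ^ 'n) set"
  assumes \<Omega>: "\<Omega> \<in> lmeasurable" and u: "H1_with_gradient \<Omega> u g" and w: "H1_with_gradient \<Omega> w h"
  shows "H1_with_gradient \<Omega> (\<lambda>x. u x - w x) (\<lambda>x. g x - h x)"
  unfolding H1_with_gradient_def
proof (intro conjI allI impI)
  let ?L = "lebesgue_on \<Omega>"
  note u' = u[unfolded H1_with_gradient_def L2_fun_def] and w' = w[unfolded H1_with_gradient_def L2_fun_def]
  show "L2_fun ?L (\<lambda>x. u x - w x)" using u' w' L2_diff[of u ?L w] by (auto simp: L2_fun_def)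
  have sq: "(norm (a - b))\<^sup>2 \<le> 2 * (norm a)\<^sup>2 + 2 * (norm b)\<^sup>2" for a b :: "real ^ 'n"
    using order_trans[OF power_mono[OF norm_triangle_ineq4 norm_ge_zero] square_sum_le] .
  show "L2_fun ?L (\<lambda>x. g x - h x)"
    unfolding L2_fun_def
  proof (intro conjI)
    show "integrable ?L (\<lambda>x. (norm (g x - h x))\<^sup>2)"
      by (rule Bochner_Integration.integrable_bound[of _ "\<lambda>x. 2 * (norm (g x))\<^sup>2 + 2 * (norm (h x))\<^sup>2"])
        (use u' w' sq in \<open>auto intro!: AE_I2\<close>)
  qed (use u' w' in auto)
  fix \<phi> :: "real ^ 'n \<Rightarrow> real ^ 'n" assume \<phi>: "C1_compact_field \<Omega> \<phi>"
  note J = C1_compact_field_jacobian[OF \<phi>]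
  obtain K where K: "compact K" "\<And>x. x \<notin> K \<Longrightarrow> \<phi> x = 0 \<and> jacobian \<phi> (at x) = 0" using J(5) by blast
  have dm: "divergence \<phi> \<in> borel_measurable ?L" "\<phi> \<in> borel_measurable ?L"
    using integral_divergence_lebesgue_on(1)[OF \<phi>] \<Omega> J(3)
    by (auto intro!: borel_measurable_lebesgue_on_compose borel_measurable_continuous_onI)
  have "bounded (divergence \<phi> ` K)" "bounded (\<phi> ` K)"
    unfolding divergence_def trace_def
    by (intro compact_imp_bounded compact_continuous_image continuous_on_sum continuous_on_subset[OF J(2)] continuous_on_subset[OF J(3)] K; simp)+
  then obtain B C where B: "\<And>x. x \<in> K \<Longrightarrow> \<bar>divergence \<phi> x\<bar> \<le> B" and C: "\<And>x. x \<in> K \<Longrightarrow> norm (\<phi> x) \<le> C"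
    unfolding bounded_iff by auto
  have B': "\<bar>divergence \<phi> x\<bar> \<le> \<bar>B\<bar>" and C': "norm (\<phi> x) \<le> \<bar>C\<bar>" for x
    using B[of x] C[of x] K(2)[of x] by (cases "x \<in> K"; force simp: divergence_def trace_def)+
  have fin: "finite_measure ?L" by (rule finite_measure_lebesgue_on[OF \<Omega>])
  have i1: "integrable ?L (\<lambda>x. f x * divergence \<phi> x)" if f: "f \<in> borel_measurable ?L" "integrable ?L (\<lambda>x. (norm (f x))\<^sup>2)" for f :: "real ^ 'n \<Rightarrow> real"
  proof -
    have fi: "integrable ?L f" using square_integrable_imp_integrable_finite[OF fin f(1)] f(2) by simp
    have le: "norm (f x * divergence \<phi> x) \<le> norm (\<bar>B\<bar> * f x)" for x
      using mult_right_mono[OF B'[of x], of "\<bar>f x\<bar>"] by (simp add: abs_mult mult.commute)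
    show ?thesis
      by (rule Bochner_Integration.integrable_bound[of _ "\<lambda>x. \<bar>B\<bar> * f x", OF _ _ AE_I2[OF le]]) (use fi dm f in auto)
  qed
  have i2: "integrable ?L (\<lambda>x. f x \<bullet> \<phi> x)" if f: "f \<in> borel_measurable ?L" "integrable ?L (\<lambda>x. (norm (f x))\<^sup>2)" for f :: "real ^ 'n \<Rightarrow> real ^ 'n"
  proof -
    have fi: "integrable ?L (\<lambda>x. norm (f x))" using square_integrable_imp_integrable_finite[OF fin, of "\<lambda>x. norm (f x)"] f by simp
    show ?thesis
    proof (rule Bochner_Integration.integrable_bound[of _ "\<lambda>x. \<bar>C\<bar> * norm (f x)"])
      show "AE x in ?L. norm (f x \<bullet> \<phi> x) \<le> norm (\<bar>C\<bar> * norm (f x))"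
      proof (rule AE_I2)
        fix x
        have "\<bar>f x \<bullet> \<phi> x\<bar> \<le> norm (f x) * norm (\<phi> x)" by (rule Cauchy_Schwarz_ineq2)
        also have "\<dots> \<le> norm (f x) * \<bar>C\<bar>" using C' by (intro mult_left_mono) auto
        finally show "norm (f x \<bullet> \<phi> x) \<le> norm (\<bar>C\<bar> * norm (f x))" by (simp add: mult.commute)
      qed
    qed (use fi f dm in auto)
  qed
  have "(\<integral>x. (u x - w x) * divergence \<phi> x \<partial>?L) = (\<integral>x. u x * divergence \<phi> x \<partial>?L) - (\<integral>x. w x * divergence \<phi> x \<partial>?L)"
    using u' w' i1[of u] i1[of w] by (simp add: left_diff_distrib)
  also have "\<dots> = - ((\<integral>x. g x \<bullet> \<phi> x \<partial>?L) - (\<integral>x. h x \<bullet> \<phi> x \<partial>?L))" using u' w' \<phi> by simp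
  also have "\<dots> = - (\<integral>x. (g x - h x) \<bullet> \<phi> x \<partial>?L)" using u' w' i2[of g] i2[of h] by (simp add: inner_diff_left)
  finally show "(\<integral>x. (u x - w x) * divergence \<phi> x \<partial>?L) = - (\<integral>x. (g x - h x) \<bullet> \<phi> x \<partial>?L)" .
qed

text \<open>Convexity of half the squared norm, at the point \<open>g\<close>.\<close>

lemma L2_inner_diff_ge:
  fixes g h :: "'a \<Rightarrow> real ^ 'n"
  assumes g: "L2_fun M g" and h: "L2_fun M h"
  shows "(\<integral>x. (norm (g x))\<^sup>2 \<partial>M) / 2 - (\<integral>x. (norm (h x))\<^sup>2 \<partial>M) / 2 \<le> (\<integral>x. g x \<bullet> (g x - h x) \<partial>M)"
proof -
  note g' = g[unfolded L2_fun_def] and h' = h[unfolded L2_fun_def]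
  have pt: "(norm a)\<^sup>2 / 2 - (norm b)\<^sup>2 / 2 \<le> a \<bullet> (a - b)" "\<bar>a \<bullet> (a - b)\<bar> \<le> 2 * (norm a)\<^sup>2 + (norm b)\<^sup>2" for a b :: "real ^ 'n"
  proof -
    have ab: "\<bar>a \<bullet> b\<bar> \<le> norm a * norm b" by (rule Cauchy_Schwarz_ineq2)
    have "0 \<le> (norm a - norm b)\<^sup>2" by simp
    then have "norm a * norm b \<le> (norm a)\<^sup>2 / 2 + (norm b)\<^sup>2 / 2" by (simp add: power2_diff)
    with ab have 1: "\<bar>a \<bullet> b\<bar> \<le> (norm a)\<^sup>2 / 2 + (norm b)\<^sup>2 / 2" by linarith
    have 2: "a \<bullet> (a - b) = (norm a)\<^sup>2 - a \<bullet> b" by (simp add: inner_diff_right power2_norm_eq_inner)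
    show "(norm a)\<^sup>2 / 2 - (norm b)\<^sup>2 / 2 \<le> a \<bullet> (a - b)" using 1 2 by linarith
    have "0 \<le> (norm a)\<^sup>2" "0 \<le> (norm b)\<^sup>2" by simp_all
    then show "\<bar>a \<bullet> (a - b)\<bar> \<le> 2 * (norm a)\<^sup>2 + (norm b)\<^sup>2" using 1 2 by linarith
  qed
  have i: "integrable M (\<lambda>x. g x \<bullet> (g x - h x))"
  proof (rule Bochner_Integration.integrable_bound[of _ "\<lambda>x. 2 * (norm (g x))\<^sup>2 + (norm (h x))\<^sup>2"])
    show "AE x in M. norm (g x \<bullet> (g x - h x)) \<le> norm (2 * (norm (g x))\<^sup>2 + (norm (h x))\<^sup>2)"
      using pt(2) by (intro AE_I2) simp
  qed (use g' h' in auto)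
  have "(\<integral>x. (norm (g x))\<^sup>2 \<partial>M) / 2 - (\<integral>x. (norm (h x))\<^sup>2 \<partial>M) / 2 = (\<integral>x. (norm (g x))\<^sup>2 / 2 - (norm (h x))\<^sup>2 / 2 \<partial>M)"
    using g' h' by simp
  also have "\<dots> \<le> (\<integral>x. g x \<bullet> (g x - h x) \<partial>M)"
    by (rule integral_mono) (use g' h' i pt(1) in auto)
  finally show ?thesis .
qed

section \<open>Dissipation along the nonlocal Allen--Cahn flow\<close>

text \<open>One time slice of the weak formulation, with time derivative \<open>v\<close> and spatial gradient \<open>g\<close>.\<close>

definition weak_AC ::
    "(real ^ 'n) set \<Rightarrow> (real \<Rightarrow> real) \<Rightarrow> real \<Rightarrow> (real ^ 'n \<Rightarrow> real) \<Rightarrow> (real ^ 'n \<Rightarrow> real)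
       \<Rightarrow> (real ^ 'n \<Rightarrow> real ^ 'n) \<Rightarrow> bool" where
  "weak_AC \<Omega> W \<epsilon> u v g \<longleftrightarrow> H1_with_gradient \<Omega> u g \<and>
           (\<forall>\<phi> h. H1_with_gradient \<Omega> \<phi> h \<longrightarrow>
              (\<integral>x. v x * \<phi> x \<partial>lebesgue_on \<Omega>) =
                - \<epsilon>\<^sup>2 * (\<integral>x. g x \<bullet> h x \<partial>lebesgue_on \<Omega>)
                - (\<integral>x. deriv W (u x) * \<phi> x \<partial>lebesgue_on \<Omega>)
                + \<epsilon> * lagrange_multiplier \<Omega> W \<epsilon> u * (\<integral>x. \<phi> x \<partial>lebesgue_on \<Omega>))"

text \<open>A weak solution whose time derivative \<open>v\<close> and spatial gradient \<open>g\<close> have been named, for a nonnegative potential of class \<open>C\<^sup>1\<close> and an initial datum of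
finite energy with weak gradient \<open>g0\<close>.\<close>

locale AC_flow =
  fixes \<Omega> :: "(real ^ 'n) set" and W :: "real \<Rightarrow> real" and \<epsilon> :: real
    and u0 :: "real ^ 'n \<Rightarrow> real" and g0 :: "real ^ 'n \<Rightarrow> real ^ 'n"
    and u v :: "real \<Rightarrow> real ^ 'n \<Rightarrow> real" and g :: "real \<Rightarrow> real ^ 'n \<Rightarrow> real ^ 'n"
  assumes domain: "\<Omega> \<in> lmeasurable" "measure lebesgue \<Omega> = 1"
    and \<epsilon>: "0 < \<epsilon>"
    and W: "\<And>s. 0 \<le> W s" "\<And>s. (W has_real_derivative deriv W s) (at s)" "continuous_on UNIV (deriv W)"
    and datum: "H1_with_gradient \<Omega> u0 g0" "integrable (lebesgue_on \<Omega>) (\<lambda>x. W (u0 x))"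
    and start: "AE x in lebesgue_on \<Omega>. u 0 x = u0 x"
    and reg: "\<And>T. 0 < T \<Longrightarrow> L2_fun (lebesgue_on {0..T} \<Otimes>\<^sub>M lebesgue_on \<Omega>) (\<lambda>(t, x). u t x)"
       "\<And>T. 0 < T \<Longrightarrow> L2_fun (lebesgue_on {0..T} \<Otimes>\<^sub>M lebesgue_on \<Omega>) (\<lambda>(t, x). v t x)"
       "\<And>T. 0 < T \<Longrightarrow> L2_fun (lebesgue_on {0..T} \<Otimes>\<^sub>M lebesgue_on \<Omega>) (\<lambda>(t, x). g t x)"
       "\<And>T. 0 < T \<Longrightarrow> L2_fun (lebesgue_on {0..T} \<Otimes>\<^sub>M lebesgue_on \<Omega>) (\<lambda>(t, x). deriv W (u t x))"
    and evol: "\<And>t. 0 \<le> t \<Longrightarrow> AE x in lebesgue_on \<Omega>. u t x = u 0 x + (\<integral>s. v s x \<partial>lebesgue_on {0..t})"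
    and weak: "AE t in lebesgue_on {0..}. weak_AC \<Omega> W \<epsilon> (u t) (v t) (g t)"
begin

abbreviation "N \<equiv> lebesgue_on \<Omega>"
abbreviation "P T \<equiv> lebesgue_on {0..T::real}"

definition "F t x = primitive (\<lambda>s. v s x) t"

text \<open>A representative of the solution that is jointly measurable and, for almost every \<open>x\<close>, a primitive in time.  It agrees
with \<open>u\<close> almost everywhere at each time, and all pointwise calculus in time is done with it.\<close>

definition "U t x = u0 x + F t x"

definition "dirichlet G = \<epsilon>\<^sup>2 / 2 * (\<integral>x. (norm (G x))\<^sup>2 \<partial>N)"

text \<open>This is \<open>\<epsilon>\<close> times the energy of the initial datum.\<close>

definition "init_energy = dirichlet g0 + (\<integral>x. W (u0 x) \<partial>N)"

abbreviation "weak_eq t \<equiv> weak_AC \<Omega> W \<epsilon> (u t) (v t) (g t)"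

sublocale N: finite_measure N by (rule finite_measure_lebesgue_on[OF domain(1)])

lemma dirichlet_nonneg: "0 \<le> dirichlet G"
  unfolding dirichlet_def by simp

lemma pair: "pair_sigma_finite (P T) N"
proof -
  interpret PT: sigma_finite_measure "P T" by (rule sigma_finite_time)
  show ?thesis ..
qed

lemma finite_pair: "finite_measure (P T \<Otimes>\<^sub>M N)"
  by (rule finite_measure_pair_measure) (simp_all add: N.finite_measure_axioms)

lemma AE_weak_eq_shift: "AE t in P T. t < h \<or> weak_eq (t - h)"
proof -
  have "AE t in lebesgue. t \<in> {0..} \<longrightarrow> weak_eq t"
    using weak by (subst (asm) AE_restrict_space_iff) auto
  then obtain Z where Z: "negligible Z" "\<And>t. t \<notin> Z \<Longrightarrow> 0 \<le> t \<Longrightarrow> weak_eq t"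
    unfolding eventually_ae_filter negligible_iff_null_sets by auto
  have "negligible ((+) h ` Z)" by (rule negligible_translation[OF Z(1)])
  then have "AE t in lebesgue. t \<notin> (+) h ` Z" by (simp add: AE_not_in negligible_iff_null_sets)
  then have "AE t in lebesgue. t \<in> {0..T} \<longrightarrow> t < h \<or> weak_eq (t - h)"
  proof (rule eventually_mono)
    fix t assume t: "t \<notin> (+) h ` Z"
    have "t - h \<notin> Z" using t by (metis add_diff_cancel_left' diff_add_cancel image_eqI add.commute)
    then show "t \<in> {0..T} \<longrightarrow> t < h \<or> weak_eq (t - h)" using Z(2)[of "t - h"] by (cases "t < h") auto
  qed
  then show ?thesis by (subst AE_restrict_space_iff) auto
qed

lemma AE_weak_eq: "AE t in P T. weak_eq t"
  using AE_weak_eq_shift[of 0 T] AE_space by eventually_elim auto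

lemma measure_N_domain: "measure N \<Omega> = 1"
  using domain by (simp add: measure_restrict_space fmeasurableD)

text \<open>Testing with the constant function one: the Lagrange multiplier is chosen so that mass is conserved.\<close>

lemma mean_zero:
  assumes "weak_eq t"
  shows "(\<integral>x. v t x \<partial>N) = 0"
proof -
  have "(\<integral>x. v t x * 1 \<partial>N) = - \<epsilon>\<^sup>2 * (\<integral>x. g t x \<bullet> 0 \<partial>N) - (\<integral>x. deriv W (u t x) * 1 \<partial>N)
                + \<epsilon> * lagrange_multiplier \<Omega> W \<epsilon> (u t) * (\<integral>x. 1 \<partial>N)"
    using assms H1_with_gradient_const[OF domain(1)] unfolding weak_AC_def by blast
  then show ?thesis using \<epsilon> measure_N_domain domain by (simp add: lagrange_multiplier_def)
qed

lemma v_L2: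
  assumes "0 < T"
  shows "case_prod v \<in> borel_measurable (P T \<Otimes>\<^sub>M N)" "integrable (P T \<Otimes>\<^sub>M N) (\<lambda>(t,x). (v t x)\<^sup>2)"
    "integrable (P T \<Otimes>\<^sub>M N) (case_prod v)"
proof -
  show 1: "case_prod v \<in> borel_measurable (P T \<Otimes>\<^sub>M N)" "integrable (P T \<Otimes>\<^sub>M N) (\<lambda>(t,x). (v t x)\<^sup>2)"
    using reg(2)[OF assms] by (auto simp: L2_fun_def case_prod_unfold)
  show "integrable (P T \<Otimes>\<^sub>M N) (case_prod v)"
    by (rule square_integrable_imp_integrable_finite[OF finite_pair]) (use 1 in \<open>simp_all add: case_prod_unfold\<close>)
qed

lemma F_nonpos: "t \<le> 0 \<Longrightarrow> F t x = 0"
  by (simp add: F_def primitive_nonpos)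

lemma F_integral:
  assumes T: "0 < T" "t \<le> T"
  shows "integrable N (F t)" "(\<integral>x. F t x \<partial>N) = 0"
proof -
  interpret pair_sigma_finite "P T" N by (rule pair)
  let ?f = "\<lambda>s x. indicator {..t} s * v s x"
  have m: "(\<lambda>p. indicator {..t} (fst p) :: real) \<in> borel_measurable (P T \<Otimes>\<^sub>M N)"
    by (rule measurable_compose[OF measurable_fst]) (auto intro!: borel_measurable_lebesgue_on_compose)
  have i: "integrable (P T \<Otimes>\<^sub>M N) (case_prod ?f)"
    by (rule Bochner_Integration.integrable_bound[OF v_L2(3)[OF T(1)]])
      (use m v_L2(1)[OF T(1)] in \<open>auto intro!: AE_I2 simp: case_prod_unfold abs_mult mult_left_le_one_le\<close>)
  have eq: "F t = (\<lambda>x. LINT s|P T. ?f s x)" by (rule ext) (simp add: F_def primitive_eq[OF T(2)])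
  show "integrable N (F t)" unfolding eq by (rule integrable_snd[OF i])
  have "(\<integral>x. F t x \<partial>N) = (LINT s|P T. (\<integral>x. ?f s x \<partial>N))" unfolding eq by (rule Fubini_integral[OF i])
  also have "\<dots> = 0"
  proof (rule integral_eq_zero_AE)
    show "AE s in P T. (\<integral>x. ?f s x \<partial>N) = 0"
      using AE_weak_eq[of T] by eventually_elim (simp add: mean_zero)
  qed
  finally show "(\<integral>x. F t x \<partial>N) = 0" .
qed

lemma evolF:
  assumes "0 \<le> t"
  shows "AE x in N. u t x = U t x"
  using evol[OF assms] start by eventually_elim (simp add: U_def F_def primitive_def)

text \<open>By the equation, \<open>w\<close> is \<open>\<epsilon>\<^sup>2\<close> times the Laplacian of \<open>u\<close>, up to a function of time alone.\<close>

definition "w t x = v t x + deriv W (u t x)"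

text \<open>The equation at time \<open>t\<close> is tested with \<open>u(t) - u(t - h)\<close>, where \<open>u(t - h)\<close> is replaced by the initial datum if
\<open>t < h\<close>.  This function has mean zero, so the Lagrange multiplier drops out, and convexity compares the two Dirichlet energies.\<close>

lemma dissipation_step:
  assumes t: "0 \<le> t" "weak_eq t" and h: "0 < h" "t < h \<or> weak_eq (t - h)"
    and sl: "v t \<in> borel_measurable N" "integrable N (\<lambda>x. (v t x)\<^sup>2)"
     "(\<lambda>x. deriv W (u t x)) \<in> borel_measurable N" "integrable N (\<lambda>x. (deriv W (u t x))\<^sup>2)"
  shows "(\<integral>x. w t x * (F t x - F (t - h) x) \<partial>N) \<le> (if t < h then dirichlet g0 else dirichlet (g (t - h))) - dirichlet (g t)"
proof -
  define q where "q = (if t < h then u0 else u (t - h))"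
  define G where "G = (if t < h then g0 else g (t - h))"
  have tH: "H1_with_gradient \<Omega> (u t) (g t)" using t(2) by (simp add: weak_AC_def)
  have qH: "H1_with_gradient \<Omega> q G" using datum(1) h(2) by (auto simp: q_def G_def weak_AC_def)
  have \<phi>H: "H1_with_gradient \<Omega> (\<lambda>x. u t x - q x) (\<lambda>x. g t x - G x)"
    by (rule H1_with_gradient_diff[OF domain(1) tH qH])
  have \<phi>F: "AE x in N. u t x - q x = F t x - F (t - h) x"
  proof (cases "t < h")
    case True
    show ?thesis using evolF[OF t(1)] by eventually_elim (use True in \<open>simp add: q_def U_def F_nonpos\<close>)
  next
    case False
    then have "AE x in N. u (t - h) x = U (t - h) x" by (intro evolF) simp
    with evolF[OF t(1)] show ?thesis by eventually_elim (use False in \<open>simp add: q_def U_def\<close>)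
  qed
  have \<phi>2: "(\<lambda>x. u t x - q x) \<in> borel_measurable N" "integrable N (\<lambda>x. (u t x - q x)\<^sup>2)"
    using \<phi>H by (auto simp: H1_with_gradient_def L2_fun_def)
  have T: "0 < t + h" "t \<le> t + h" "t - h \<le> t + h" using t h by auto
  note Fi = F_integral[OF T(1,2)] F_integral[OF T(1,3)]
  have wm: "w t \<in> borel_measurable N" unfolding w_def[abs_def] using sl by simp
  have "(\<integral>x. u t x - q x \<partial>N) = (\<integral>x. F t x - F (t - h) x \<partial>N)"
    by (rule integral_cong_AE) (use \<phi>F \<phi>2 Fi(1,3) in auto)
  also have "\<dots> = 0" using Fi by simp
  finally have mass: "(\<integral>x. u t x - q x \<partial>N) = 0" .
  have "(\<integral>x. w t x * (F t x - F (t - h) x) \<partial>N) = (\<integral>x. w t x * (u t x - q x) \<partial>N)"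
    by (rule integral_cong_AE) (use \<phi>F \<phi>2 Fi(1,3) wm in auto)
  also have "\<dots> = (\<integral>x. v t x * (u t x - q x) \<partial>N) + (\<integral>x. deriv W (u t x) * (u t x - q x) \<partial>N)"
    unfolding w_def distrib_right by (intro Bochner_Integration.integral_add L2_mult sl \<phi>2)
  also have "(\<integral>x. v t x * (u t x - q x) \<partial>N) = - \<epsilon>\<^sup>2 * (\<integral>x. g t x \<bullet> (g t x - G x) \<partial>N)
                - (\<integral>x. deriv W (u t x) * (u t x - q x) \<partial>N)
                + \<epsilon> * lagrange_multiplier \<Omega> W \<epsilon> (u t) * (\<integral>x. u t x - q x \<partial>N)"
    using t(2) \<phi>H unfolding weak_AC_def by blast
  finally have "(\<integral>x. w t x * (F t x - F (t - h) x) \<partial>N) = - \<epsilon>\<^sup>2 * (\<integral>x. g t x \<bullet> (g t x - G x) \<partial>N)"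
    by (simp add: mass)
  also have "\<dots> \<le> - \<epsilon>\<^sup>2 * ((\<integral>x. (norm (g t x))\<^sup>2 \<partial>N) / 2 - (\<integral>x. (norm (G x))\<^sup>2 \<partial>N) / 2)"
    using L2_inner_diff_ge[of N "g t" G] tH qH by (simp add: H1_with_gradient_def mult_left_mono)
  also have "\<dots> = (if t < h then dirichlet g0 else dirichlet (g (t - h))) - dirichlet (g t)"
    by (simp add: dirichlet_def G_def algebra_simps)
  finally show ?thesis .
qed

lemma dissipation_integrated:
  assumes T: "0 < T"
  shows "integrable (P T \<Otimes>\<^sub>M N) (\<lambda>(t,x). w t x * v t x)"
    "(\<integral>x. (LINT t|P T. w t x * v t x) \<partial>N) \<le> dirichlet g0"
proof -
  interpret pair_sigma_finite "P T" N by (rule pair)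
  note v = v_L2[OF T]
  have W': "(\<lambda>(t, x). deriv W (u t x)) \<in> borel_measurable (P T \<Otimes>\<^sub>M N)" "integrable (P T \<Otimes>\<^sub>M N) (\<lambda>(t,x). (deriv W (u t x))\<^sup>2)"
    using reg(4)[OF T] by (auto simp: L2_fun_def case_prod_unfold)
  have g: "(\<lambda>(t, x). g t x) \<in> borel_measurable (P T \<Otimes>\<^sub>M N)" "integrable (P T \<Otimes>\<^sub>M N) (\<lambda>(t,x). (norm (g t x))\<^sup>2)"
    using reg(3)[OF T] by (auto simp: L2_fun_def case_prod_unfold)
  have w: "case_prod w \<in> borel_measurable (P T \<Otimes>\<^sub>M N)" "integrable (P T \<Otimes>\<^sub>M N) (\<lambda>(t,x). (w t x)\<^sup>2)"
    using v(1,2) W' L2_add[of "case_prod v" "P T \<Otimes>\<^sub>M N" "\<lambda>(t,x). deriv W (u t x)"]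
    by (simp_all add: w_def case_prod_unfold)
  show "integrable (P T \<Otimes>\<^sub>M N) (\<lambda>(t,x). w t x * v t x)"
    using L2_mult[OF w(1) _ v(1)] w(2) v(2) by (simp add: case_prod_unfold)
  have sm: "(\<lambda>x. f t x) \<in> borel_measurable N" if "t \<in> space (P T)" "case_prod f \<in> borel_measurable (P T \<Otimes>\<^sub>M N)"
    for t and f :: "real \<Rightarrow> real ^ 'n \<Rightarrow> real"
    using measurable_compose[OF measurable_Pair1'[OF that(1)] that(2)] by simp
  have si: "AE t in P T. integrable N (\<lambda>x. (v t x)\<^sup>2)" "AE t in P T. integrable N (\<lambda>x. (deriv W (u t x))\<^sup>2)"
    using AE_integrable_fst[of "\<lambda>t x. (v t x)\<^sup>2"] AE_integrable_fst[of "\<lambda>t x. (deriv W (u t x))\<^sup>2"] v(2) W'(2) by auto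
  show "(\<integral>x. (LINT t|P T. w t x * v t x) \<partial>N) \<le> dirichlet g0"
  proof (rule energy_inequality_limit[OF N.finite_measure_axioms T v(1,2) w, where D="\<lambda>t. dirichlet (g t)"])
    show "integrable (P T) (\<lambda>t. dirichlet (g t))"
      unfolding dirichlet_def using integrable_fst[of "\<lambda>t x. (norm (g t x))\<^sup>2"] g(2) by simp
    fix h :: real assume h: "0 < h" "h \<le> T"
    show "AE t in P T. (\<integral>x. w t x * (primitive (\<lambda>s. v s x) t - primitive (\<lambda>s. v s x) (t - h)) \<partial>N)
          \<le> (if t < h then dirichlet g0 else dirichlet (g (t - h))) - dirichlet (g t)"
      using AE_weak_eq[of T] AE_weak_eq_shift[of h T] si AE_space
    proof eventually_elim
      case (elim t)
      show ?case
        using dissipation_step[of t h] elim h sm[OF elim(5) v(1)] sm[OF elim(5) W'(1)] unfolding F_def by simp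
    qed
  qed (simp_all add: dirichlet_nonneg)
qed

end

lemma borel_measurable_antiderivative:
  fixes \<Psi> :: "real \<Rightarrow> real"
  assumes "\<And>y. (\<Psi> has_real_derivative \<psi> y) (at y)"
  shows "\<Psi> \<in> borel_measurable borel"
  using DERIV_isCont[OF assms] by (intro borel_measurable_continuous_onI) (simp add: continuous_on_eq_continuous_at)

context AC_flow begin

lemma u0_measurable: "u0 \<in> borel_measurable N"
  using datum(1) by (simp add: H1_with_gradient_def L2_fun_def)

lemma U_measurable:
  assumes T: "0 < T"
  shows "case_prod U \<in> borel_measurable (P T \<Otimes>\<^sub>M N)"
  using primitive_pair_measurable[OF v_L2(1)[OF T], of 0] measurable_compose[OF measurable_snd u0_measurable, of "P T"]
  unfolding U_def F_def case_prod_unfold by simp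

lemma U_slice_measurable:
  assumes "0 \<le> t"
  shows "U t \<in> borel_measurable N"
proof -
  have "F t \<in> borel_measurable N" using F_integral(1)[of "t + 1" t] assms by simp
  then show ?thesis unfolding U_def[abs_def] using u0_measurable by simp
qed

lemma v_slice:
  assumes T: "0 < T"
  shows "AE x in N. (\<lambda>t. v t x) \<in> borel_measurable (P T) \<and> integrable (P T) (\<lambda>t. (v t x)\<^sup>2)"
    "integrable N (\<lambda>x. LINT t|P T. (v t x)\<^sup>2)"
proof -
  interpret pair_sigma_finite "P T" N by (rule pair)
  note v = v_L2[OF T]
  have "(\<lambda>t. v t x) \<in> borel_measurable (P T)" if "x \<in> space N" for x
    using measurable_compose[OF measurable_Pair2'[OF that] v(1)] by simp
  moreover have "AE x in N. integrable (P T) (\<lambda>t. (v t x)\<^sup>2)"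
    using AE_integrable_snd[of "\<lambda>t x. (v t x)\<^sup>2"] v(2) by simp
  ultimately show "AE x in N. (\<lambda>t. v t x) \<in> borel_measurable (P T) \<and> integrable (P T) (\<lambda>t. (v t x)\<^sup>2)"
    using AE_space by (auto elim: AE_mp intro!: AE_I2)
  show "integrable N (\<lambda>x. LINT t|P T. (v t x)\<^sup>2)"
    using integrable_snd[of "\<lambda>t x. (v t x)\<^sup>2"] v(2) by simp
qed

lemma chain_rule_U:
  assumes T: "0 < T" and \<psi>: "continuous_on UNIV \<psi>" "\<And>y. (\<Psi> has_real_derivative \<psi> y) (at y)"
  shows "AE x in N. (LINT t|P T. \<psi> (U t x) * v t x) = \<Psi> (U T x) - \<Psi> (u0 x)"
  using v_slice(1)[OF T]
proof eventually_elim
  case (elim x)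
  show ?case unfolding U_def F_def
    by (rule chain_rule_primitive[OF \<psi>]) (use elim T in auto)
qed

text \<open>For every time the two functions agree outside a null set of points; since both are jointly measurable, Fubini
exchanges this for a null set of times at almost every point.\<close>

lemma u_eq_U:
  assumes T: "0 < T"
  shows "AE x in N. AE t in P T. u t x = U t x"
proof -
  interpret pair_sigma_finite "P T" N by (rule pair)
  have u: "(\<lambda>(t, x). u t x) \<in> borel_measurable (P T \<Otimes>\<^sub>M N)" using reg(1)[OF T] by (simp add: L2_fun_def)
  have "AE t in P T. AE x in N. u t x = U t x"
    by (rule AE_I2) (simp add: evolF)
  moreover have "{p \<in> space (P T \<Otimes>\<^sub>M N). u (fst p) (snd p) = U (fst p) (snd p)} \<in> sets (P T \<Otimes>\<^sub>M N)"
    using u U_measurable[OF T] unfolding case_prod_unfold by measurable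
  ultimately show ?thesis using AE_commute[of "\<lambda>t x. u t x = U t x"] by simp
qed

text \<open>Since \<open>w = \<partial>\<^sub>t u + W'(u)\<close>, the chain rule at each point \<open>x\<close> turns the integral of \<open>w \<partial>\<^sub>t u\<close> over time into that of \<open>(\<partial>\<^sub>t u)\<^sup>2\<close> plus the
increment of \<open>W(u)\<close>.\<close>

lemma energy_bound:
  assumes T: "0 < T"
  shows "integrable N (\<lambda>x. W (U T x))"
    "(\<integral>x. (LINT t|P T. (v t x)\<^sup>2) \<partial>N) + (\<integral>x. W (U T x) \<partial>N) \<le> init_energy"
proof -
  interpret pair_sigma_finite "P T" N by (rule pair)
  have W': "(\<lambda>(t, x). deriv W (u t x)) \<in> borel_measurable (P T \<Otimes>\<^sub>M N)" "integrable (P T \<Otimes>\<^sub>M N) (\<lambda>(t,x). (deriv W (u t x))\<^sup>2)"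
    using reg(4)[OF T] by (auto simp: L2_fun_def case_prod_unfold)
  have W's: "(\<lambda>t. deriv W (u t x)) \<in> borel_measurable (P T)" if "x \<in> space N" for x
    using measurable_compose[OF measurable_Pair2'[OF that] W'(1)] by simp
  have W'i: "AE x in N. integrable (P T) (\<lambda>t. (deriv W (u t x))\<^sup>2)"
    using AE_integrable_snd[of "\<lambda>t x. (deriv W (u t x))\<^sup>2"] W'(2) by simp
  note dm = dissipation_integrated[OF T]
  have key: "AE x in N. (LINT t|P T. w t x * v t x) = (LINT t|P T. (v t x)\<^sup>2) + (W (U T x) - W (u0 x))"
    using v_slice(1)[OF T] chain_rule_U[OF T W(3,2)] u_eq_U[OF T] W'i AE_space
  proof eventually_elim
    case (elim x)
    have i: "integrable (P T) (\<lambda>t. deriv W (u t x) * v t x)"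
      using elim W's[OF elim(5)] by (intro L2_mult) auto
    have cm: "(\<lambda>t. deriv W (U t x) * v t x) \<in> borel_measurable (P T)"
      using elim measurable_compose[OF measurable_Pair2'[OF elim(5)] U_measurable[OF T]]
        borel_measurable_continuous_onI[OF W(3)] by (intro borel_measurable_times) auto
    have "(LINT t|P T. w t x * v t x) = (LINT t|P T. (v t x)\<^sup>2 + deriv W (u t x) * v t x)"
      by (simp add: w_def power2_eq_square algebra_simps)
    also have "\<dots> = (LINT t|P T. (v t x)\<^sup>2) + (LINT t|P T. deriv W (u t x) * v t x)"
      using elim i by simp
    also have "(LINT t|P T. deriv W (u t x) * v t x) = (LINT t|P T. deriv W (U t x) * v t x)"
      using elim(3) by (intro integral_cong_AE borel_measurable_integrable[OF i] cm) (auto elim: eventually_mono)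
    finally show ?case using elim(2) by simp
  qed
  have Wm: "(\<lambda>x. W (U T x)) \<in> borel_measurable N"
    using measurable_compose[OF U_slice_measurable borel_measurable_antiderivative[OF W(2)]] T by simp
  have iw: "integrable N (\<lambda>x. LINT t|P T. w t x * v t x)" using integrable_snd[OF dm(1)] .
  have eq: "AE x in N. W (U T x) = (LINT t|P T. w t x * v t x) - (LINT t|P T. (v t x)\<^sup>2) + W (u0 x)"
    using key by eventually_elim simp
  have i: "integrable N (\<lambda>x. (LINT t|P T. w t x * v t x) - (LINT t|P T. (v t x)\<^sup>2) + W (u0 x))"
    using iw v_slice(2)[OF T] datum(2) by simp
  show WU: "integrable N (\<lambda>x. W (U T x))"
    using integrable_cong_AE[OF Wm borel_measurable_integrable[OF i] eq] i by simp
  have "(\<integral>x. W (U T x) \<partial>N) = (\<integral>x. (LINT t|P T. w t x * v t x) - (LINT t|P T. (v t x)\<^sup>2) + W (u0 x) \<partial>N)"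
    by (rule integral_cong_AE[OF Wm borel_measurable_integrable[OF i] eq])
  also have "\<dots> = (\<integral>x. (LINT t|P T. w t x * v t x) \<partial>N) - (\<integral>x. (LINT t|P T. (v t x)\<^sup>2) \<partial>N) + (\<integral>x. W (u0 x) \<partial>N)"
    using iw v_slice(2)[OF T] datum(2) by simp
  finally show "(\<integral>x. (LINT t|P T. (v t x)\<^sup>2) \<partial>N) + (\<integral>x. W (U T x) \<partial>N) \<le> init_energy"
    using dm(2) by (simp add: init_energy_def)
qed

lemma energy_bound_W:
  assumes "0 \<le> t"
  shows "integrable N (\<lambda>x. W (U t x))" "(\<integral>x. W (U t x) \<partial>N) \<le> init_energy"
proof -
  have *: "integrable N (\<lambda>x. W (U t x)) \<and> (\<integral>x. W (U t x) \<partial>N) \<le> init_energy"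
  proof (cases "t = 0")
    case True
    then show ?thesis using datum(2) dirichlet_nonneg[of g0] by (simp add: U_def F_nonpos init_energy_def)
  next
    case False
    then have t: "0 < t" using assms by simp
    have "0 \<le> (\<integral>x. (LINT s|P t. (v s x)\<^sup>2) \<partial>N)" by simp
    then show ?thesis using energy_bound[OF t] by linarith
  qed
  then show "integrable N (\<lambda>x. W (U t x))" "(\<integral>x. W (U t x) \<partial>N) \<le> init_energy" by auto
qed

text \<open>At each point the increment of \<open>\<Psi>(u)\<close> is the time integral of \<open>\<psi>(u) \<partial>\<^sub>t u\<close>.  By Young's inequality it is controlled by the time integrals of \<open>\<psi>(u)\<^sup>2\<close>, which is at most
\<open>W(u)\<close>, and of \<open>(\<partial>\<^sub>t u)\<^sup>2\<close>.  Integrated over \<open>\<Omega>\<close> these are at most \<open>T * init_energy\<close> and \<open>init_energy\<close>.\<close>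

lemma slow_motion_estimate:
  assumes T: "0 < T" and a: "0 < a" and \<psi>: "continuous_on UNIV \<psi>" "\<And>y. (\<Psi> has_real_derivative \<psi> y) (at y)"
    and \<psi>1: "\<And>y. \<bar>\<psi> y\<bar> \<le> 1" and \<psi>W: "\<And>y. (\<psi> y)\<^sup>2 \<le> W y"
  shows "integrable N (\<lambda>x. \<Psi> (U T x) - \<Psi> (u0 x))"
    "(\<integral>x. \<bar>\<Psi> (U T x) - \<Psi> (u0 x)\<bar> \<partial>N) \<le> a / 2 * (T * init_energy) + 1 / (2 * a) * init_energy"
proof -
  interpret pair_sigma_finite "P T" N by (rule pair)
  interpret PT: finite_measure "P T" by simp
  have \<psi>m: "\<psi> \<in> borel_measurable borel" by (rule borel_measurable_continuous_onI[OF \<psi>(1)])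
  have \<Psi>m: "\<Psi> \<in> borel_measurable borel" by (rule borel_measurable_antiderivative[OF \<psi>(2)])
  have \<psi>U: "(\<lambda>(t, x). (\<psi> (U t x))\<^sup>2) \<in> borel_measurable (P T \<Otimes>\<^sub>M N)"
    using measurable_compose[OF U_measurable[OF T] \<psi>m] unfolding case_prod_unfold by simp
  interpret PN: finite_measure "P T \<Otimes>\<^sub>M N" by (rule finite_pair)
  have \<psi>2: "(\<psi> y)\<^sup>2 \<le> 1" for y using \<psi>1[of y] by (simp add: abs_square_le_1)
  have i: "integrable (P T \<Otimes>\<^sub>M N) (\<lambda>(t, x). (\<psi> (U t x))\<^sup>2)"
    by (rule PN.integrable_const_bound[of _ 1]) (use \<psi>U \<psi>2 in auto)
  define A where "A x = (LINT t|P T. (\<psi> (U t x))\<^sup>2)" for x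
  define V where "V x = (LINT t|P T. (v t x)\<^sup>2)" for x
  have Ai: "integrable N A" unfolding A_def using integrable_snd[OF i] .
  have Vi: "integrable N V" unfolding V_def by (rule v_slice(2)[OF T])
  have "(\<integral>x. A x \<partial>N) = (LINT t|P T. (\<integral>x. (\<psi> (U t x))\<^sup>2 \<partial>N))" unfolding A_def by (rule Fubini_integral[OF i])
  also have "\<dots> \<le> (LINT t|P T. init_energy)"
  proof (rule integral_mono_AE)
    show "integrable (P T) (\<lambda>t. \<integral>x. (\<psi> (U t x))\<^sup>2 \<partial>N)" using integrable_fst[OF i] .
    show "AE t in P T. (\<integral>x. (\<psi> (U t x))\<^sup>2 \<partial>N) \<le> init_energy"
      using AE_integrable_fst[OF i] AE_space
    proof eventually_elim
      case (elim t)
      then have t: "0 \<le> t" by simp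
      have "(\<integral>x. (\<psi> (U t x))\<^sup>2 \<partial>N) \<le> (\<integral>x. W (U t x) \<partial>N)"
        by (rule integral_mono[OF elim(1) energy_bound_W(1)[OF t] \<psi>W])
      then show ?case using energy_bound_W(2)[OF t] by linarith
    qed
  qed auto
  also have "\<dots> = T * init_energy" using T by (simp add: measure_restrict_space)
  finally have AE0: "(\<integral>x. A x \<partial>N) \<le> T * init_energy" .
  have VE0: "(\<integral>x. V x \<partial>N) \<le> init_energy"
  proof -
    have "0 \<le> (\<integral>x. W (U T x) \<partial>N)" using W(1) by simp
    then show ?thesis using energy_bound(2)[OF T] unfolding V_def by linarith
  qed
  have pt: "AE x in N. \<bar>\<Psi> (U T x) - \<Psi> (u0 x)\<bar> \<le> a / 2 * A x + 1 / (2 * a) * V x"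
    using chain_rule_U[OF T \<psi>] v_slice(1)[OF T] AE_space
  proof eventually_elim
    case (elim x)
    have m: "(\<lambda>t. \<psi> (U t x)) \<in> borel_measurable (P T)"
      using measurable_compose[OF measurable_compose[OF measurable_Pair2'[OF elim(3)] U_measurable[OF T]] \<psi>m] by simp
    have "integrable (P T) (\<lambda>t. (\<psi> (U t x))\<^sup>2)"
      by (rule PT.integrable_const_bound[of _ 1]) (use m \<psi>2 in auto)
    then show ?case unfolding elim(1)[symmetric] A_def V_def
      using elim(2) m a by (intro integral_product_abs_le) auto
  qed
  have dm: "(\<lambda>x. \<Psi> (U T x) - \<Psi> (u0 x)) \<in> borel_measurable N"
    using measurable_compose[OF U_slice_measurable \<Psi>m, of T] measurable_compose[OF u0_measurable \<Psi>m] T by simp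
  have bi: "integrable N (\<lambda>x. a / 2 * A x + 1 / (2 * a) * V x)" using Ai Vi by simp
  show di: "integrable N (\<lambda>x. \<Psi> (U T x) - \<Psi> (u0 x))"
    by (rule Bochner_Integration.integrable_bound[OF bi dm]) (use pt in \<open>auto elim!: eventually_mono\<close>)
  have "(\<integral>x. \<bar>\<Psi> (U T x) - \<Psi> (u0 x)\<bar> \<partial>N) \<le> (\<integral>x. a / 2 * A x + 1 / (2 * a) * V x \<partial>N)"
    by (rule integral_mono_AE) (use di bi pt in auto)
  also have "\<dots> = a / 2 * (\<integral>x. A x \<partial>N) + 1 / (2 * a) * (\<integral>x. V x \<partial>N)" using Ai Vi by simp
  also have "\<dots> \<le> a / 2 * (T * init_energy) + 1 / (2 * a) * init_energy"
    using AE0 VE0 a by (intro add_mono mult_left_mono) auto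
  finally show "(\<integral>x. \<bar>\<Psi> (U T x) - \<Psi> (u0 x)\<bar> \<partial>N) \<le> a / 2 * (T * init_energy) + 1 / (2 * a) * init_energy" .
qed

end

section \<open>Double-well potentials\<close>

lemma double_well_C1:
  assumes "double_well W"
  shows "\<And>s. 0 \<le> W s" "\<And>s. (W has_real_derivative deriv W s) (at s)" "continuous_on UNIV (deriv W)" "\<And>s. W s = 0 \<longleftrightarrow> s = -1 \<or> s = 1"
proof -
  note a = assms[unfolded double_well_def]
  show "0 \<le> W s" for s using a by blast
  show "(W has_real_derivative deriv W s) (at s)" for s
    using a unfolding differentiable_on_def by (simp add: DERIV_deriv_iff_real_differentiable)
  show "continuous_on UNIV (deriv W)" using a by (auto intro: differentiable_imp_continuous_on)
  have "{s. W s = 0} = {-1, 1}" using a by blast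
  then show "W s = 0 \<longleftrightarrow> s = -1 \<or> s = 1" for s by blast
qed

text \<open>The derivative does not vanish to the right of \<open>b\<close> and so has a constant sign there.  It cannot be negative, for then \<open>f\<close> would decrease
with slope below \<open>-1\<close> and become negative.\<close>

lemma linear_growth_right:
  fixes f f' :: "real \<Rightarrow> real"
  assumes f: "\<And>s. 0 \<le> f s" and D: "\<And>s. (f has_real_derivative f' s) (at s)" and c: "continuous_on UNIV f'"
    and big: "\<And>s. b \<le> s \<Longrightarrow> 1 < \<bar>f' s\<bar>" and s: "b \<le> s"
  shows "s - b \<le> f s"
proof -
  have pos: "0 < f' r" if r: "b \<le> r" for r
  proof (rule ccontr)
    assume "\<not> 0 < f' r"
    then have neg: "f' r < 0" using big[OF r] by auto
    have neg': "f' z < - 1" if z: "r \<le> z" for z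
    proof (rule ccontr)
      assume "\<not> f' z < - 1"
      then have "0 \<le> f' z" using big[of z] r z by auto
      then obtain y where "r \<le> y" "y \<le> z" "f' y = 0"
        using IVT'[of f' r 0 z] neg z continuous_on_subset[OF c] by auto
      then show False using big[of y] r by simp
    qed
    have "\<exists>z>r. z < r + (f r + 1) \<and> f (r + (f r + 1)) - f r = (r + (f r + 1) - r) * f' z"
      by (rule MVT2) (use D f[of r] in auto)
    then obtain z where z: "r < z" "f (r + (f r + 1)) - f r = (f r + 1) * f' z" by auto
    have "(f r + 1) * f' z \<le> (f r + 1) * (- 1)" using neg'[of z] z f[of r] by (intro mult_left_mono) auto
    then show False using z(2) f[of "r + (f r + 1)"] by simp
  qed
  show ?thesis
  proof (cases "s = b")
    case True
    then show ?thesis using f by simp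
  next
    case False
    then have "b < s" using s by simp
    then have "\<exists>z>b. z < s \<and> f s - f b = (s - b) * f' z" by (rule MVT2) (use D in auto)
    then obtain z where z: "b < z" "f s - f b = (s - b) * f' z" by auto
    have "(s - b) * 1 \<le> (s - b) * f' z" using pos[of z] big[of z] z s by (intro mult_left_mono) auto
    then show ?thesis using z(2) f[of b] by simp
  qed
qed

lemma double_well_growth:
  assumes W: "double_well W"
  obtains R where "0 \<le> R" "\<And>s. \<bar>s\<bar> - R \<le> W s"
proof -
  note C1 = double_well_C1[OF W]
  have "Liminf at_infinity (\<lambda>s. ereal \<bar>deriv W s\<bar>) = \<infinity>" using W by (simp add: double_well_def)
  then have "ereal 1 < Liminf at_infinity (\<lambda>s. ereal \<bar>deriv W s\<bar>)" by simp
  then have "\<forall>\<^sub>F s in at_infinity. ereal 1 < ereal \<bar>deriv W s\<bar>" by (rule less_LiminfD)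
  then obtain b where b: "\<And>s. b \<le> norm s \<Longrightarrow> 1 < \<bar>deriv W s\<bar>" by (auto simp: eventually_at_infinity)
  define R where "R = \<bar>b\<bar>"
  have bR: "1 < \<bar>deriv W s\<bar>" if "R \<le> \<bar>s\<bar>" for s using b[of s] that by (simp add: R_def)
  have right: "s - R \<le> W s" if "R \<le> s" for s
    by (rule linear_growth_right[OF C1(1-3) _ that]) (use bR R_def in auto)
  have left: "s - R \<le> W (- s)" if "R \<le> s" for s
  proof (rule linear_growth_right[where f="\<lambda>s. W (- s)" and f'="\<lambda>s. - deriv W (- s)", OF _ _ _ _ that])
    show "((\<lambda>s. W (- s)) has_real_derivative - deriv W (- s)) (at s)" for s
      using DERIV_chain2[OF C1(2) DERIV_minus[OF DERIV_ident], of s] by simp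
    show "continuous_on UNIV (\<lambda>s. - deriv W (- s))"
      by (intro continuous_intros continuous_on_compose2[OF C1(3)]) auto
  qed (use C1(1) bR R_def in auto)
  show thesis
  proof (rule that[of R])
    show "\<bar>s\<bar> - R \<le> W s" for s
      using right[of s] left[of "- s"] C1(1)[of s] by (cases "R \<le> s"; cases "R \<le> - s") auto
  qed (simp add: R_def)
qed

lemma antiderivative_exists:
  fixes \<psi> :: "real \<Rightarrow> real"
  assumes "continuous_on UNIV \<psi>"
  obtains \<Psi> where "\<And>y. (\<Psi> has_real_derivative \<psi> y) (at y)"
proof -
  have "\<exists>F. \<forall>x :: real. - \<infinity> < ereal x \<longrightarrow> ereal x < \<infinity> \<longrightarrow> (F has_vector_derivative \<psi> x) (at x)"
    by (rule einterval_antiderivative) (use assms in \<open>auto simp: continuous_on_eq_continuous_at\<close>)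
  then show ?thesis using that by (auto simp: has_real_derivative_iff_has_vector_derivative)
qed

text \<open>The integrand of the Modica--Mortola function, cut off at one.  The cutoff makes its primitive Lipschitz
with constant one, so that \<open>L\<^sup>1\<close> convergence of the initial data passes to their images.\<close>

definition modica :: "(real \<Rightarrow> real) \<Rightarrow> real \<Rightarrow> real" where
  "modica W y = min 1 (sqrt (W y))"

lemma modica_properties:
  assumes W: "double_well W"
  shows "continuous_on UNIV (modica W)" "\<bar>modica W y\<bar> \<le> 1" "(modica W y)\<^sup>2 \<le> W y" "0 \<le> modica W y" "modica W y = 0 \<longleftrightarrow> y = -1 \<or> y = 1"
proof -
  note C1 = double_well_C1[OF W]
  have "continuous_on UNIV W" using DERIV_isCont[OF C1(2)] by (simp add: continuous_on_eq_continuous_at)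
  then show "continuous_on UNIV (modica W)" unfolding modica_def by (intro continuous_intros)
  show "\<bar>modica W y\<bar> \<le> 1" "0 \<le> modica W y" using C1(1)[of y] by (auto simp: modica_def)
  have "(modica W y)\<^sup>2 \<le> (sqrt (W y))\<^sup>2" using C1(1)[of y] by (intro power_mono) (auto simp: modica_def)
  then show "(modica W y)\<^sup>2 \<le> W y" using C1(1)[of y] by simp
  show "modica W y = 0 \<longleftrightarrow> y = -1 \<or> y = 1" using C1(4)[of y] C1(1)[of y] by (auto simp: modica_def min_def split: if_splits)
qed

text \<open>Strict monotonicity holds because every open interval contains a point at which \<open>W\<close> is positive.\<close>

lemma modica_antiderivative:
  assumes W: "double_well W" and D: "\<And>y. (\<Psi> has_real_derivative modica W y) (at y)"
  shows "\<bar>\<Psi> x - \<Psi> y\<bar> \<le> \<bar>x - y\<bar>" "x \<le> y \<Longrightarrow> \<Psi> x \<le> \<Psi> y" "x < y \<Longrightarrow> \<Psi> x < \<Psi> y"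
proof -
  show mono: "\<Psi> x \<le> \<Psi> y" if "x \<le> y" for x y
    by (rule DERIV_nonneg_imp_nondecreasing[OF that]) (use D modica_properties(4)[OF W] in blast)
  have lip: "\<bar>\<Psi> x - \<Psi> y\<bar> \<le> \<bar>x - y\<bar>" if "x < y" for x y
  proof -
    have "\<exists>z>x. z < y \<and> \<Psi> y - \<Psi> x = (y - x) * modica W z" by (rule MVT2[OF that]) (rule D)
    then obtain z where "\<Psi> y - \<Psi> x = (y - x) * modica W z" by blast
    then have "\<bar>\<Psi> y - \<Psi> x\<bar> = \<bar>y - x\<bar> * \<bar>modica W z\<bar>" by (simp add: abs_mult)
    also have "\<dots> \<le> \<bar>y - x\<bar> * 1" by (rule mult_left_mono[OF modica_properties(2)[OF W]]) simp
    finally show ?thesis by (simp add: abs_minus_commute)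
  qed
  show "\<bar>\<Psi> x - \<Psi> y\<bar> \<le> \<bar>x - y\<bar>"
    using lip[of x y] lip[of y x] by (cases x y rule: linorder_cases) (auto simp: abs_minus_commute)
  show "\<Psi> x < \<Psi> y" if "x < y"
  proof -
    have "infinite ({x<..<y} - {-1, 1})" using that by (simp add: infinite_Ioo Diff_infinite_finite)
    then obtain z where z: "x < z" "z < y" "z \<noteq> -1" "z \<noteq> 1" by (metis Diff_iff ex_in_conv finite.emptyI greaterThanLessThan_iff insertCI)
    then have "0 < modica W z" using modica_properties(4,5)[OF W, of z] by auto
    from DERIV_pos_inc_right[OF D this] obtain d where d: "0 < d" "\<And>h. 0 < h \<Longrightarrow> h < d \<Longrightarrow> \<Psi> z < \<Psi> (z + h)" by blast
    define h where "h = min (d / 2) (y - z)"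
    have "0 < h" "h < d" "z + h \<le> y" using d z by (auto simp: h_def)
    then have "\<Psi> z < \<Psi> y" using d(2)[of h] mono[of "z + h" y] by simp
    then show ?thesis using mono[of x z] z by simp
  qed
qed

text \<open>Near \<open>b\<close> the error \<open>\<eta>\<close> is enough.  On the rest of a bounded interval \<open>\<Psi> a\<close> differs from \<open>\<Psi> b\<close> by at least a positive constant
\<open>\<kappa>\<close>, by strict monotonicity; and outside a bounded interval \<open>W a\<close> dominates the distance by its linear growth.\<close>

lemma well_distance_bound:
  assumes W: "double_well W" and D: "\<And>y. (\<Psi> has_real_derivative modica W y) (at y)" and \<eta>: "0 < \<eta>"
  obtains C where "0 \<le> C" "\<And>a b. b = -1 \<or> b = 1 \<Longrightarrow> \<bar>a - b\<bar> \<le> \<eta> + C * (W a + \<bar>\<Psi> a - \<Psi> b\<bar>)"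
proof -
  obtain R where R: "0 \<le> R" "\<And>s. \<bar>s\<bar> - R \<le> W s" using double_well_growth[OF W] by blast
  note Wpos = double_well_C1(1)[OF W]
  define k where "k b = min (\<Psi> (b + \<eta>) - \<Psi> b) (\<Psi> b - \<Psi> (b - \<eta>))" for b
  have k: "0 < k b" for b
    using modica_antiderivative(3)[OF W D, of b "b + \<eta>"] modica_antiderivative(3)[OF W D, of "b - \<eta>" b] \<eta> by (simp add: k_def)
  define \<kappa> where "\<kappa> = min (k (-1)) (k 1)"
  have \<kappa>: "0 < \<kappa>" using k by (simp add: \<kappa>_def)
  have far: "\<kappa> \<le> \<bar>\<Psi> a - \<Psi> b\<bar>" if b: "b = -1 \<or> b = 1" and "\<eta> < \<bar>a - b\<bar>" for a b
  proof -
    have "\<kappa> \<le> k b" using b by (auto simp: \<kappa>_def)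
    also have "k b \<le> \<bar>\<Psi> a - \<Psi> b\<bar>"
    proof (cases "b \<le> a")
      case True
      then have "\<Psi> (b + \<eta>) \<le> \<Psi> a" using that by (intro modica_antiderivative(2)[OF W D]) auto
      then show ?thesis by (simp add: k_def)
    next
      case False
      then have "\<Psi> a \<le> \<Psi> (b - \<eta>)" using that by (intro modica_antiderivative(2)[OF W D]) auto
      then show ?thesis by (simp add: k_def)
    qed
    finally show ?thesis .
  qed
  \<comment> \<open>The first summand serves \<open>2 * R + 1 < \<bar>a\<bar>\<close>, where the distance is at most \<open>2 * W a\<close>; the second serves the
    points in between, where the distance is at most \<open>2 * R + 2\<close>.\<close>
  define C where "C = 2 + (2 * R + 2) / \<kappa>"
  have C: "2 \<le> C" "(2 * R + 2) / \<kappa> \<le> C" using R \<kappa> by (auto simp: C_def)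
  show thesis
  proof (rule that[of C])
    fix a b :: real assume b: "b = -1 \<or> b = 1"
    have nn: "0 \<le> C * W a" "0 \<le> C * \<bar>\<Psi> a - \<Psi> b\<bar>" using C Wpos by auto
    consider "\<bar>a - b\<bar> \<le> \<eta>" | "\<eta> < \<bar>a - b\<bar>" "\<bar>a\<bar> \<le> 2 * R + 1" | "2 * R + 1 < \<bar>a\<bar>" by linarith
    then show "\<bar>a - b\<bar> \<le> \<eta> + C * (W a + \<bar>\<Psi> a - \<Psi> b\<bar>)"
    proof cases
      case 1
      then show ?thesis using nn by (simp add: distrib_left)
    next
      case 2
      have "\<bar>a - b\<bar> \<le> 2 * R + 2" using 2 b by auto
      also have "\<dots> = (2 * R + 2) / \<kappa> * \<kappa>" using \<kappa> by simp
      also have "\<dots> \<le> C * \<bar>\<Psi> a - \<Psi> b\<bar>" using C R \<kappa> far[OF b 2(1)] by (intro mult_mono) auto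
      finally show ?thesis using nn \<eta> by (simp add: distrib_left)
    next
      case 3
      have "\<bar>a - b\<bar> \<le> 2 * W a" using 3 b R(2)[of a] by auto
      also have "\<dots> \<le> C * W a" using C Wpos by (intro mult_right_mono) auto
      finally show ?thesis using nn \<eta> by (simp add: distrib_left)
    qed
  qed (use C in simp)
qed

lemma energy_finite:
  fixes \<Omega> :: "(real ^ 'n) set"
  assumes \<epsilon>: "0 < \<epsilon>" and W: "\<And>s. 0 \<le> W s" "W \<in> borel_measurable borel" and K: "0 \<le> K"
    and E: "energy \<Omega> W m \<epsilon> u \<le> ennreal K"
  shows "H1_with_gradient \<Omega> u (weak_grad \<Omega> u)" "integrable (lebesgue_on \<Omega>) (\<lambda>x. W (u x))"
    "\<epsilon>\<^sup>2 / 2 * (\<integral>x. (norm (weak_grad \<Omega> u x))\<^sup>2 \<partial>lebesgue_on \<Omega>) + (\<integral>x. W (u x) \<partial>lebesgue_on \<Omega>) \<le> \<epsilon> * K"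
proof -
  let ?N = "lebesgue_on \<Omega>" and ?g = "weak_grad \<Omega> u"
  define f where "f x = 1 / \<epsilon> * W (u x) + \<epsilon> / 2 * (norm (?g x))\<^sup>2" for x
  have u: "u \<in> H1 \<Omega>" and le: "(\<integral>\<^sup>+x. ennreal (f x) \<partial>?N) \<le> ennreal K"
    using E unfolding energy_def f_def by (auto split: if_splits simp: top_unique)
  show H: "H1_with_gradient \<Omega> u ?g"
    using u someI_ex[of "H1_with_gradient \<Omega> u"] unfolding H1_def weak_grad_def by simp
  then have g: "?g \<in> borel_measurable ?N" "integrable ?N (\<lambda>x. (norm (?g x))\<^sup>2)" and um: "u \<in> borel_measurable ?N"
    by (auto simp: H1_with_gradient_def L2_fun_def)
  have Wm: "(\<lambda>x. W (u x)) \<in> borel_measurable ?N" using measurable_compose[OF um W(2)] .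
  have fm: "f \<in> borel_measurable ?N" unfolding f_def using Wm g(1) by measurable
  have f0: "0 \<le> f x" for x unfolding f_def using \<epsilon> W(1) by simp
  have fi: "integrable ?N f"
    by (rule integrableI_nonneg[OF fm]) (use f0 le in \<open>auto simp: le_less_trans[OF _ ennreal_less_top]\<close>)
  have fK: "(\<integral>x. f x \<partial>?N) \<le> K"
    using le nn_integral_eq_integral[OF fi] f0 K by simp
  have Wf: "(\<lambda>x. W (u x)) = (\<lambda>x. \<epsilon> * f x - \<epsilon>\<^sup>2 / 2 * (norm (?g x))\<^sup>2)"
    using \<epsilon> by (auto simp: f_def field_simps power2_eq_square)
  show "integrable ?N (\<lambda>x. W (u x))" unfolding Wf using fi g by simp
  have "(\<integral>x. W (u x) \<partial>?N) = \<epsilon> * (\<integral>x. f x \<partial>?N) - \<epsilon>\<^sup>2 / 2 * (\<integral>x. (norm (?g x))\<^sup>2 \<partial>?N)"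
    unfolding Wf using fi g by simp
  moreover have "\<epsilon> * (\<integral>x. f x \<partial>?N) \<le> \<epsilon> * K" using fK \<epsilon> by simp
  ultimately show "\<epsilon>\<^sup>2 / 2 * (\<integral>x. (norm (?g x))\<^sup>2 \<partial>?N) + (\<integral>x. W (u x) \<partial>?N) \<le> \<epsilon> * K" by linarith
qed

section \<open>Slow motion\<close>

context AC_flow begin

text \<open>The distance of \<open>u(t)\<close> to the two-phase function \<open>z\<close> is estimated pointwise by \<open>well_distance_bound\<close>.  There \<open>\<Psi>(u(t)) - \<Psi>(z)\<close> splits into the
increment of \<open>\<Psi>(u)\<close> since time \<open>0\<close> and the distance of the initial datum to \<open>z\<close>.\<close>

lemma L1_distance_estimate:
  assumes W: "double_well W" and D: "\<And>y. (\<Psi> has_real_derivative modica W y) (at y)"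
    and c: "0 \<le> c" "\<And>a b. b = -1 \<or> b = 1 \<Longrightarrow> \<bar>a - b\<bar> \<le> \<eta> + c * (W a + \<bar>\<Psi> a - \<Psi> b\<bar>)" and \<eta>: "0 \<le> \<eta>"
    and z: "z \<in> borel_measurable N" "\<And>x. x \<in> \<Omega> \<Longrightarrow> z x = -1 \<or> z x = 1"
    and t: "0 \<le> t" "t \<le> T" and a: "0 < a"
  shows "(\<integral>\<^sup>+x. ennreal \<bar>u t x - z x\<bar> \<partial>N) \<le>
    ennreal (\<eta> + c * (init_energy + (a / 2 * (T * init_energy) + 1 / (2 * a) * init_energy))) + ennreal c * (\<integral>\<^sup>+x. ennreal \<bar>u0 x - z x\<bar> \<partial>N)"
proof -
  define B where "B = a / 2 * (T * init_energy) + 1 / (2 * a) * init_energy"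
  have init_energy: "0 \<le> init_energy" using dirichlet_nonneg[of g0] double_well_C1(1)[OF W] by (simp add: init_energy_def)
  have est: "integrable N (\<lambda>x. \<Psi> (U t x) - \<Psi> (u0 x)) \<and> (\<integral>x. \<bar>\<Psi> (U t x) - \<Psi> (u0 x)\<bar> \<partial>N) \<le> B"
  proof (cases "t = 0")
    case True
    then show ?thesis using init_energy a t by (simp add: U_def F_nonpos B_def)
  next
    case False
    then have t0: "0 < t" using t by simp
    note s = slow_motion_estimate[OF t0 a modica_properties(1)[OF W] D modica_properties(2,3)[OF W]]
    have "a / 2 * (t * init_energy) + 1 / (2 * a) * init_energy \<le> B"
      unfolding B_def using t a init_energy by (intro add_mono mult_left_mono mult_right_mono) auto
    then show ?thesis using s by linarith
  qed
  have \<Psi>m: "\<Psi> \<in> borel_measurable borel" by (rule borel_measurable_antiderivative[OF D])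
  let ?f = "\<lambda>x. \<eta> + c * (W (U t x) + \<bar>\<Psi> (U t x) - \<Psi> (u0 x)\<bar>)"
  have fi: "integrable N ?f" using energy_bound_W(1)[OF t(1)] est by auto
  have f0: "0 \<le> ?f x" for x using c(1) \<eta> double_well_C1(1)[OF W] by simp
  have "(\<integral>\<^sup>+x. ennreal \<bar>u t x - z x\<bar> \<partial>N) \<le> (\<integral>\<^sup>+x. ennreal (?f x) + ennreal c * ennreal \<bar>u0 x - z x\<bar> \<partial>N)"
  proof (rule nn_integral_mono_AE)
    show "AE x in N. ennreal \<bar>u t x - z x\<bar> \<le> ennreal (?f x) + ennreal c * ennreal \<bar>u0 x - z x\<bar>"
      using evolF[OF t(1)] AE_space
    proof eventually_elim
      case (elim x)
      have "\<bar>\<Psi> (U t x) - \<Psi> (z x)\<bar> \<le> \<bar>\<Psi> (U t x) - \<Psi> (u0 x)\<bar> + \<bar>u0 x - z x\<bar>"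
        using modica_antiderivative(1)[OF W D, of "u0 x" "z x"] by linarith
      then have "c * (W (U t x) + \<bar>\<Psi> (U t x) - \<Psi> (z x)\<bar>) \<le> c * (W (U t x) + (\<bar>\<Psi> (U t x) - \<Psi> (u0 x)\<bar> + \<bar>u0 x - z x\<bar>))"
        using c(1) by (intro mult_left_mono) auto
      then have "\<bar>u t x - z x\<bar> \<le> ?f x + c * \<bar>u0 x - z x\<bar>"
        using c(2)[OF z(2), of x "U t x"] elim by (simp add: algebra_simps)
      then have "ennreal \<bar>u t x - z x\<bar> \<le> ennreal (?f x + c * \<bar>u0 x - z x\<bar>)" by (rule ennreal_leI)
      also have "\<dots> = ennreal (?f x) + ennreal (c * \<bar>u0 x - z x\<bar>)" using f0[of x] c(1) by (intro ennreal_plus) auto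
      finally show ?case using c(1) by (simp add: ennreal_mult)
    qed
  qed
  also have "\<dots> = (\<integral>\<^sup>+x. ennreal (?f x) \<partial>N) + (\<integral>\<^sup>+x. ennreal c * ennreal \<bar>u0 x - z x\<bar> \<partial>N)"
    using fi z u0_measurable by (intro nn_integral_add) auto
  also have "(\<integral>\<^sup>+x. ennreal c * ennreal \<bar>u0 x - z x\<bar> \<partial>N) = ennreal c * (\<integral>\<^sup>+x. ennreal \<bar>u0 x - z x\<bar> \<partial>N)"
    using z u0_measurable by (intro nn_integral_cmult) auto
  also have "(\<integral>\<^sup>+x. ennreal (?f x) \<partial>N) = ennreal (\<integral>x. ?f x \<partial>N)" using fi f0 by (intro nn_integral_eq_integral) auto
  also have "\<dots> \<le> ennreal (\<eta> + c * (init_energy + B))"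
  proof (rule ennreal_leI)
    have "(\<integral>x. ?f x \<partial>N) = \<eta> + c * ((\<integral>x. W (U t x) \<partial>N) + (\<integral>x. \<bar>\<Psi> (U t x) - \<Psi> (u0 x)\<bar> \<partial>N))"
      using energy_bound_W(1)[OF t(1)] est measure_N_domain by simp
    also have "\<dots> \<le> \<eta> + c * (init_energy + B)"
      using energy_bound_W(2)[OF t(1)] est c(1) by (intro add_left_mono mult_left_mono add_mono) auto
    finally show "(\<integral>x. ?f x \<partial>N) \<le> \<eta> + c * (init_energy + B)" .
  qed
  finally show ?thesis unfolding B_def by (simp add: add_right_mono)
qed

end

lemma nonlocal_AC_solution_flow:
  fixes \<Omega> :: "(real ^ 'n) set"
  assumes \<Omega>: "\<Omega> \<in> lmeasurable" "measure lebesgue \<Omega> = 1" and \<epsilon>: "0 < \<epsilon>" and W: "double_well W" and K: "0 \<le> K"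
    and E: "energy \<Omega> W m \<epsilon> u0 \<le> ennreal K" and sol: "nonlocal_AC_solution \<Omega> W \<epsilon> u0 u"
  obtains v g where "AC_flow \<Omega> W \<epsilon> u0 (weak_grad \<Omega> u0) u v g" "AC_flow.init_energy \<Omega> W \<epsilon> u0 (weak_grad \<Omega> u0) \<le> \<epsilon> * K"
proof -
  note C1 = double_well_C1[OF W]
  note e = energy_finite[OF \<epsilon> C1(1) borel_measurable_antiderivative[OF C1(2)] K E]
  obtain v g where vg: "\<forall>T>0. L2_fun (lebesgue_on {0..T} \<Otimes>\<^sub>M lebesgue_on \<Omega>) (\<lambda>(t, x). u t x) \<and>
               L2_fun (lebesgue_on {0..T} \<Otimes>\<^sub>M lebesgue_on \<Omega>) (\<lambda>(t, x). v t x) \<and>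
               L2_fun (lebesgue_on {0..T} \<Otimes>\<^sub>M lebesgue_on \<Omega>) (\<lambda>(t, x). g t x) \<and>
               L2_fun (lebesgue_on {0..T} \<Otimes>\<^sub>M lebesgue_on \<Omega>) (\<lambda>(t, x). deriv W (u t x))"
    "\<forall>t\<ge>0. AE x in lebesgue_on \<Omega>. u t x = u 0 x + (\<integral>s. v s x \<partial>lebesgue_on {0..t})"
    "AE t in lebesgue_on {0..}. weak_AC \<Omega> W \<epsilon> (u t) (v t) (g t)"
    and st: "AE x in lebesgue_on \<Omega>. u 0 x = u0 x"
    using sol unfolding nonlocal_AC_solution_def weak_AC_def by blast
  have flow: "AC_flow \<Omega> W \<epsilon> u0 (weak_grad \<Omega> u0) u v g"
    by unfold_locales (use \<Omega> \<epsilon> C1 e vg st in blast)+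
  show thesis
  proof (rule that[OF flow])
    show "AC_flow.init_energy \<Omega> W \<epsilon> u0 (weak_grad \<Omega> u0) \<le> \<epsilon> * K"
      using e(3) unfolding AC_flow.init_energy_def[OF flow] AC_flow.dirichlet_def[OF flow] .
  qed
qed

theorem theorem1p8:
  fixes \<Omega> E0 :: "(real ^ 'n) set"
    and W :: "real \<Rightarrow> real"
    and m \<sigma> \<delta> C \<epsilon>0 M :: real
    and u0 :: "real \<Rightarrow> real ^ 'n \<Rightarrow> real"
    and u :: "real \<Rightarrow> real \<Rightarrow> real ^ 'n \<Rightarrow> real"
  assumes dim: "1 < CARD('n)" "CARD('n) \<le> 7"
    and domain: "open \<Omega>" "bounded \<Omega>" "connected \<Omega>" "measure lebesgue \<Omega> = 1"
    and boundary: "0 < \<sigma>" "\<sigma> \<le> 1" "boundary_of_class 4 \<sigma> \<Omega>"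
    and potential: "double_well W"
    and mass: "-1 < m" "m < 1"
    and minimizer: "local_perimeter_minimizer \<Omega> E0" "measure lebesgue E0 = (1 - m) / 2"
    and taylor: "0 < \<delta>" "taylor_order_two (local_isoperimetric \<Omega> \<delta> E0) ((1 - m) / 2)"
    and range: "0 < \<epsilon>0"
    and initial: "\<And>\<epsilon>. 0 < \<epsilon> \<Longrightarrow> \<epsilon> < \<epsilon>0 \<Longrightarrow> u0 \<epsilon> \<in> X1 \<Omega> m \<inter> Linf \<Omega>"
    and convergence:
      "((\<lambda>\<epsilon>. \<integral>\<^sup>+x. ennreal \<bar>u0 \<epsilon> x - two_phase \<Omega> E0 x\<bar> \<partial>lebesgue_on \<Omega>) \<longlongrightarrow> 0) (at_right 0)"
    and energy_bound: "0 < C"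
      "\<And>\<epsilon>. 0 < \<epsilon> \<Longrightarrow> \<epsilon> < \<epsilon>0 \<Longrightarrow>
         energy \<Omega> W m \<epsilon> (u0 \<epsilon>) \<le> limit_energy \<Omega> W m (two_phase \<Omega> E0) + ennreal (C * \<epsilon>)"
    and solution: "\<And>\<epsilon>. 0 < \<epsilon> \<Longrightarrow> \<epsilon> < \<epsilon>0 \<Longrightarrow> nonlocal_AC_solution \<Omega> W \<epsilon> (u0 \<epsilon>) (u \<epsilon>)"
    and time: "0 < M"
  shows "((\<lambda>\<epsilon>. SUP t\<in>{0..M / \<epsilon>}.
             \<integral>\<^sup>+x. ennreal \<bar>u \<epsilon> t x - two_phase \<Omega> E0 x\<bar> \<partial>lebesgue_on \<Omega>) \<longlongrightarrow> 0) (at_right 0)"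
proof -
  let ?N = "lebesgue_on \<Omega>" and ?z = "two_phase \<Omega> E0"
  have \<Omega>: "\<Omega> \<in> lmeasurable" using domain by (simp add: lmeasurable_open)
  have E0: "E0 \<in> sets lebesgue" "E0 \<subseteq> \<Omega>" using minimizer(1) by (auto simp: local_perimeter_minimizer_def)
  have "limit_energy \<Omega> W m ?z < \<infinity>"
    by (rule limit_energy_two_phase_finite[OF \<Omega> E0 local_perimeter_minimizer_finite[OF domain(1,2) minimizer(1)]])
      (use domain(4) minimizer(2) in simp)
  then obtain L where L: "0 \<le> L" "limit_energy \<Omega> W m ?z = ennreal L" by (cases "limit_energy \<Omega> W m ?z") auto
  define K where "K = L + C * \<epsilon>0"
  have K: "0 \<le> K" using L energy_bound(1) range by (simp add: K_def)
  have EK: "energy \<Omega> W m \<epsilon> (u0 \<epsilon>) \<le> ennreal K" if "0 < \<epsilon>" "\<epsilon> < \<epsilon>0" for \<epsilon>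
  proof -
    have "energy \<Omega> W m \<epsilon> (u0 \<epsilon>) \<le> ennreal (L + C * \<epsilon>)"
      using energy_bound(2)[OF that] L energy_bound(1) that by (simp add: ennreal_plus)
    also have "\<dots> \<le> ennreal K" unfolding K_def using that energy_bound(1) by (intro ennreal_leI add_left_mono mult_left_mono) auto
    finally show ?thesis .
  qed
  obtain \<Psi> where \<Psi>: "\<And>y. (\<Psi> has_real_derivative modica W y) (at y)"
    using antiderivative_exists[OF modica_properties(1)[OF potential]] by blast
  have zm: "?z \<in> borel_measurable ?N" using two_phase_integral(1)[OF \<Omega> E0] by simp
  have zv: "?z x = -1 \<or> ?z x = 1" if "x \<in> \<Omega>" for x using that by (auto simp: two_phase_def indicator_def)
  let ?S = "\<lambda>\<epsilon>. SUP t\<in>{0..M / \<epsilon>}. \<integral>\<^sup>+x. ennreal \<bar>u \<epsilon> t x - ?z x\<bar> \<partial>?N"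
  let ?I = "\<lambda>\<epsilon>. \<integral>\<^sup>+x. ennreal \<bar>u0 \<epsilon> x - ?z x\<bar> \<partial>?N"
  show ?thesis
  proof (rule order_tendstoI)
    fix e :: ennreal assume "0 < e"
    then obtain r where r: "0 < r" "r < e" using dense by blast
    then obtain \<eta> where \<eta>: "r = ennreal \<eta>" "0 < \<eta>" by (cases r) (auto simp: ennreal_less_zero_iff)
    obtain c where c: "0 \<le> c" "\<And>a b. b = -1 \<or> b = 1 \<Longrightarrow> \<bar>a - b\<bar> \<le> \<eta> + c * (W a + \<bar>\<Psi> a - \<Psi> b\<bar>)"
      using well_distance_bound[OF potential \<Psi> \<eta>(2)] by blast
    let ?B = "\<lambda>\<epsilon>. \<eta> + c * (\<epsilon> * K + (sqrt \<epsilon> / 2 * (M * K) + sqrt \<epsilon> / 2 * K))"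
    let ?G = "\<lambda>\<epsilon>. ennreal (?B \<epsilon>) + ennreal c * ?I \<epsilon>"
    have bound: "?S \<epsilon> \<le> ?G \<epsilon>" if \<epsilon>: "0 < \<epsilon>" "\<epsilon> < \<epsilon>0" for \<epsilon>
    proof (rule SUP_least)
      fix t assume t: "t \<in> {0..M / \<epsilon>}"
      obtain v g where flow: "AC_flow \<Omega> W \<epsilon> (u0 \<epsilon>) (weak_grad \<Omega> (u0 \<epsilon>)) (u \<epsilon>) v g"
        and E: "AC_flow.init_energy \<Omega> W \<epsilon> (u0 \<epsilon>) (weak_grad \<Omega> (u0 \<epsilon>)) \<le> \<epsilon> * K"
        using nonlocal_AC_solution_flow[OF \<Omega> domain(4) \<epsilon>(1) potential K EK[OF \<epsilon>] solution[OF \<epsilon>]] by blast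
      \<comment> \<open>The weight \<open>a = sqrt \<epsilon>\<close> makes both terms of the estimate of order \<open>sqrt \<epsilon>\<close>, since the initial energy
        is of order \<open>\<epsilon>\<close> and the time of order \<open>1 / \<epsilon>\<close>.\<close>
      let ?E = "AC_flow.init_energy \<Omega> W \<epsilon> (u0 \<epsilon>) (weak_grad \<Omega> (u0 \<epsilon>))"
      have "(\<integral>\<^sup>+x. ennreal \<bar>u \<epsilon> t x - ?z x\<bar> \<partial>?N) \<le>
        ennreal (\<eta> + c * (?E + (sqrt \<epsilon> / 2 * (M / \<epsilon> * ?E) + 1 / (2 * sqrt \<epsilon>) * ?E))) + ennreal c * ?I \<epsilon>"
        by (rule AC_flow.L1_distance_estimate[OF flow potential \<Psi> c]) (use zm zv t \<epsilon> \<eta> in auto)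
      also have "\<dots> \<le> ?G \<epsilon>"
      proof (intro add_right_mono ennreal_leI add_left_mono mult_left_mono add_mono)
        show "M / \<epsilon> * ?E \<le> M * K"
          using mult_left_mono[OF E, of "M / \<epsilon>"] time \<epsilon> by simp
        have "1 / (2 * sqrt \<epsilon>) * ?E \<le> 1 / (2 * sqrt \<epsilon>) * (\<epsilon> * K)" by (intro mult_left_mono E) (use \<epsilon> in simp)
        also have "\<dots> = (sqrt \<epsilon> * sqrt \<epsilon>) / (2 * sqrt \<epsilon>) * K" using \<epsilon> by simp
        also have "\<dots> = sqrt \<epsilon> / 2 * K" using \<epsilon> by (simp del: real_sqrt_mult_self)
        finally show "1 / (2 * sqrt \<epsilon>) * ?E \<le> sqrt \<epsilon> / 2 * K" .
      qed (use E c \<epsilon> in auto)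
      finally show "(\<integral>\<^sup>+x. ennreal \<bar>u \<epsilon> t x - ?z x\<bar> \<partial>?N) \<le> ?G \<epsilon>" .
    qed
    have "(?B \<longlongrightarrow> \<eta> + c * (0 * K + (sqrt 0 / 2 * (M * K) + sqrt 0 / 2 * K))) (at_right 0)"
      by (intro tendsto_intros) auto
    then have "(?G \<longlongrightarrow> ennreal \<eta> + ennreal c * 0) (at_right 0)"
      by (intro tendsto_add ennreal_tendsto_cmult tendsto_ennrealI convergence) auto
    then have "(?G \<longlongrightarrow> r) (at_right 0)" by (simp add: \<eta>)
    then have "\<forall>\<^sub>F \<epsilon> in at_right 0. ?G \<epsilon> < e" using r(2) by (rule order_tendstoD(2))
    moreover have "\<forall>\<^sub>F \<epsilon> in at_right 0. 0 < \<epsilon> \<and> \<epsilon> < \<epsilon>0"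
      using range by (auto simp: eventually_at_right_less eventually_conj_iff intro: eventually_at_right_field[THEN iffD2])
    ultimately show "\<forall>\<^sub>F \<epsilon> in at_right 0. ?S \<epsilon> < e"
      by eventually_elim (use bound in \<open>auto intro: le_less_trans\<close>)
  qed simp
qed

end
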